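(* Let $\Gamma$ be a typing environment and $\sigma\triangleright P$ a configuration with $\Gamma\vdash\sigma\triangleright P$. If $\sigma\triangleright P\to\sigma'\triangleright P'$, then there exists a typing environment $\Gamma'$ such that $\Gamma'\vdash\sigma'\triangleright P'$.
   Context: Syntax (π-calculus with allocation). Channel names $c,d\in\mathcal N$, variables $x,y$, identifiers $u,v$ ranging over both, process variables $X$. Processes: $P,Q ::= u!\langle\vec v\rangle.P \mid u?(\vec x).P \mid \mathbf 0 \mid \mathsf{if}\ u=v\ \mathsf{then}\ P\ \mathsf{else}\ Q \mid \mathsf{rec}\,X.P \mid X \mid P\mid Q \mid (\nu c{:}s)P \mid \mathsf{alloc}\,x.P \mid \mathsf{free}\,u.P$, where $s\in\{\top,\bot\}$ (allocated/deallocated). Input binds $\vec x$, $\mathsf{alloc}$ binds $x$, $(\nu c{:}s)$ binds $c$, $\mathsf{rec}$ binds $X$. A channel state is a finite partial map $\sigma$ from channel names to $\{\top,\bot\}$; a configuration $\sigma\triangleright P$ requires the free names of $P$ to lie in $\mathrm{dom}(\sigma)$; it is closed if $P$ has no free variables. Contexts: $\mathcal C ::= [-]\mid \mathcal C\mid P\mid P\mid\mathcal C\mid (\nu c)\mathcal C$, applied to configurations by $[\sigma\triangleright P]=\sigma\triangleright P$; if $\mathcal C[\sigma\triangleright P]=\sigma'\triangleright P'$ then $(\mathcal C\mid Q)[\sigma\triangleright P]=\sigma'\triangleright(P'\mid Q)$, $(Q\mid\mathcal C)[\sigma\triangleright P]=\sigma'\triangleright(Q\mid P')$; and if $\mathcal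 C[\sigma\triangleright P]=\sigma',c{:}s\triangleright P'$ then $((\nu c)\mathcal C)[\sigma\triangleright P]=\sigma'\triangleright(\nu c{:}s)P'$. $\equiv$ is a standard π-calculus structural equivalence. Reduction $\to$ is the least relation on closed configurations closed under contexts (if $\sigma\triangleright P\to\sigma''\triangleright P''$ then $\mathcal C[\sigma\triangleright P]\to\mathcal C[\sigma''\triangleright P'']$) satisfying: $\sigma\triangleright c!\langle\vec b\rangle.Q\mid c?(\vec x).P\to\sigma\triangleright Q\mid P\{\vec b/\vec x\}$ if $\sigma(c)=\top$; $\sigma\triangleright\mathsf{rec}\,X.P\to\sigma\triangleright P\{\mathsf{rec}\,X.P/X\}$; $\sigma\triangleright\mathsf{if}\ c=c\ \mathsf{then}\ P\ \mathsf{else}\ Q\to\sigma\triangleright P$; $\sigma\triangleright\mathsf{if}\ c=d\ \mathsf{then}\ P\ \mathsf{else}\ Q\to\sigma\triangleright Q$ if $c\ne d$; $\sigma\triangleright\mathsf{alloc}\,x.P\to\sigma\triangleright(\nu c{:}\top)(P\{c/x\})$ if $c\notin\mathrm{dom}(\sigma)$; $\sigma,c{:}\top\triangleright\mathsf{free}\,c.P\to\sigma,c{:}\bot\triangleright P$; and if $P\equiv P_1$, $\sigma\triangleright P_1\to\sigma'\triangleright Q_1$ and $Q_1\equiv Q$ then $\sigma\triangleright P\to\sigma'\triangleright Q$. Types: $T::=[T_1,\dots,T_n]^a\mid\mathsf{Proc}$, attributes $a::=\mathsf{aff}\mid\mathsf{un}\mid\bullet_i$ ($i\in\mathbb N$;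 $\bullet_i$ = unique after $i$ steps). Typing environments are finite multisets of assumptions $u:T$ or $X:\mathsf{Proc}$. Decrement: $\Gamma,u:[\vec T]^{a-1}$ is $\Gamma$ if $a=\mathsf{aff}$, $\Gamma,u:[\vec T]^{\mathsf{un}}$ if $a=\mathsf{un}$, $\Gamma,u:[\vec T]^{\bullet_i}$ if $a=\bullet_{i+1}$. Splitting: $[\vec T]^{\mathsf{un}}=[\vec T]^{\mathsf{un}}\circ[\vec T]^{\mathsf{un}}$, $\mathsf{Proc}=\mathsf{Proc}\circ\mathsf{Proc}$, $[\vec T]^{\bullet_i}=[\vec T]^{\mathsf{aff}}\circ[\vec T]^{\bullet_{i+1}}$. Subtyping rules: $\bullet_i\le\bullet_{i+1}$, $\bullet_{i+1}\le\mathsf{un}$, $\mathsf{un}\le\mathsf{aff}$, $[\vec T]^{a_1}\le[\vec T]^{a_2}$ if $a_1\le a_2$. The judgement $\Gamma\vdash P$ is inductively defined by (bound variables fresh, commas denote multiset union): if $\Gamma,u:[\vec T]^{a-1},\vec x:\vec T\vdash P$ then $\Gamma,u:[\vec T]^a\vdash u?(\vec x).P$; if $\Gamma,u:[\vec T]^{a-1}\vdash P$ then $\Gamma,u:[\vec T]^a,\vec v:\vec T\vdash u!\langle\vec v\rangle.P$; if $\Gamma_1\vdash P$ and $\Gamma_2\vdash Q$ then $\Gamma_1,\Gamma_2\vdash P\mid Q$; if $u,v$ occur in $\Gamma$, $\Gamma\vdash P$ and $\Gamma\vdash Q$ then $\Gamma\vdash\mathsf{if}\ u=v\ \mathsf{then}\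 P\ \mathsf{else}\ Q$; if $\Gamma^{\mathsf{un}},X:\mathsf{Proc}\vdash P$ then $\Gamma^{\mathsf{un}}\vdash\mathsf{rec}\,X.P$, where $\Gamma^{\mathsf{un}}$ contains only unrestricted assumptions; $X:\mathsf{Proc}\vdash X$; if $\Gamma,x:[\vec T]^{\bullet_0}\vdash P$ then $\Gamma\vdash\mathsf{alloc}\,x.P$; if $\Gamma\vdash P$ then $\Gamma,u:[\vec T]^{\bullet_0}\vdash\mathsf{free}\,u.P$; $\emptyset\vdash\mathbf 0$; if $\Gamma,c:T\vdash P$ then $\Gamma\vdash(\nu c{:}\top)P$; if $\Gamma\vdash P$ then $\Gamma\vdash(\nu c{:}\bot)P$; and the structural rules: if $T=T_1\circ T_2$ and $\Gamma,u:T_1,u:T_2\vdash P$ then $\Gamma,u:T\vdash P$; if $\Gamma\vdash P$ then $\Gamma,u:T\vdash P$; if $\Gamma,u:T_2\vdash P$ and $T_1\le T_2$ then $\Gamma,u:T_1\vdash P$; if $\Gamma,u:[\vec T_2]^{\bullet_0}\vdash P$ then $\Gamma,u:[\vec T_1]^{\bullet_0}\vdash P$. Configuration typing: $\Gamma\vdash\sigma\triangleright P$ holds iff $\sigma(c)=\top$ for every channel name $c\in\mathrm{dom}(\Gamma)$, $\Gamma\vdash P$, and $\Gamma$ is a partial function. *)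

theory Defs
  imports Main "HOL-Library.Multiset"
begin

type_synonym chan = nat
type_synonym var = nat
type_synonym pvar = nat

datatype ident = Ch chan | Vr var

datatype chstate = Top | Bot   (* Top = allocated, Bot = deallocated *)

datatype proc =
    Out ident "ident list" proc
  | Inp ident "var list" proc            (* u?(xs).P, binds xs *)
  | Nil
  | If ident ident proc proc
  | Rec pvar proc                        (* rec X.P, binds X *)
  | PV pvar
  | Par proc proc
  | Res chan chstate proc                (* (nu c:s) P, binds c *)
  | Alloc var proc                       (* alloc x.P, binds x *)
  | Free ident proc

type_synonym chstates = "chan \<Rightarrow> chstate option"

fun ichs :: "ident \<Rightarrow> chan set" where
  "ichs (Ch c) = {c}" | "ichs (Vr x) = {}"

fun ivs :: "ident \<Rightarrow> var set" where
  "ivs (Ch c) = {}" | "ivs (Vr x) = {x}"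

fun fnch :: "proc \<Rightarrow> chan set" where
  "fnch (Out u vs P) = ichs u \<union> \<Union>(ichs ` set vs) \<union> fnch P"
| "fnch (Inp u xs P) = ichs u \<union> fnch P"
| "fnch Nil = {}"
| "fnch (If u v P Q) = ichs u \<union> ichs v \<union> fnch P \<union> fnch Q"
| "fnch (Rec X P) = fnch P"
| "fnch (PV X) = {}"
| "fnch (Par P Q) = fnch P \<union> fnch Q"
| "fnch (Res c s P) = fnch P - {c}"
| "fnch (Alloc x P) = fnch P"
| "fnch (Free u P) = ichs u \<union> fnch P"

fun fv :: "proc \<Rightarrow> var set" where
  "fv (Out u vs P) = ivs u \<union> \<Union>(ivs ` set vs) \<union> fv P"
| "fv (Inp u xs P) = ivs u \<union> (fv P - set xs)"
| "fv Nil = {}"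
| "fv (If u v P Q) = ivs u \<union> ivs v \<union> fv P \<union> fv Q"
| "fv (Rec X P) = fv P"
| "fv (PV X) = {}"
| "fv (Par P Q) = fv P \<union> fv Q"
| "fv (Res c s P) = fv P"
| "fv (Alloc x P) = fv P - {x}"
| "fv (Free u P) = ivs u \<union> fv P"

fun fpv :: "proc \<Rightarrow> pvar set" where
  "fpv (Out u vs P) = fpv P"
| "fpv (Inp u xs P) = fpv P"
| "fpv Nil = {}"
| "fpv (If u v P Q) = fpv P \<union> fpv Q"
| "fpv (Rec X P) = fpv P - {X}"
| "fpv (PV X) = {X}"
| "fpv (Par P Q) = fpv P \<union> fpv Q"
| "fpv (Res c s P) = fpv P"
| "fpv (Alloc x P) = fpv P"
| "fpv (Free u P) = fpv P"

fun bnch :: "proc \<Rightarrow> chan set" where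
  "bnch (Out u vs P) = bnch P"
| "bnch (Inp u xs P) = bnch P"
| "bnch Nil = {}"
| "bnch (If u v P Q) = bnch P \<union> bnch Q"
| "bnch (Rec X P) = bnch P"
| "bnch (PV X) = {}"
| "bnch (Par P Q) = bnch P \<union> bnch Q"
| "bnch (Res c s P) = insert c (bnch P)"
| "bnch (Alloc x P) = bnch P"
| "bnch (Free u P) = bnch P"

fun bv :: "proc \<Rightarrow> var set" where
  "bv (Out u vs P) = bv P"
| "bv (Inp u xs P) = set xs \<union> bv P"
| "bv Nil = {}"
| "bv (If u v P Q) = bv P \<union> bv Q"
| "bv (Rec X P) = bv P"
| "bv (PV X) = {}"
| "bv (Par P Q) = bv P \<union> bv Q"
| "bv (Res c s P) = bv P"
| "bv (Alloc x P) = insert x (bv P)"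
| "bv (Free u P) = bv P"

fun bpv :: "proc \<Rightarrow> pvar set" where
  "bpv (Out u vs P) = bpv P"
| "bpv (Inp u xs P) = bpv P"
| "bpv Nil = {}"
| "bpv (If u v P Q) = bpv P \<union> bpv Q"
| "bpv (Rec X P) = insert X (bpv P)"
| "bpv (PV X) = {}"
| "bpv (Par P Q) = bpv P \<union> bpv Q"
| "bpv (Res c s P) = bpv P"
| "bpv (Alloc x P) = bpv P"
| "bpv (Free u P) = bpv P"

text \<open>Simultaneous substitution of identifiers for (free) variables.  It is the
plain structural substitution; it is only used under side conditions ensuring that
no capture occurs (bound names fresh).\<close>

fun isu :: "(var \<Rightarrow> ident option) \<Rightarrow> ident \<Rightarrow> ident" where
  "isu f (Vr x) = (case f x of Some v \<Rightarrow> v | None \<Rightarrow> Vr x)"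
| "isu f (Ch c) = Ch c"

fun isubst :: "(var \<Rightarrow> ident option) \<Rightarrow> proc \<Rightarrow> proc" where
  "isubst f (Out u vs P) = Out (isu f u) (map (isu f) vs) (isubst f P)"
| "isubst f (Inp u xs P) =
     Inp (isu f u) xs (isubst (\<lambda>y. if y \<in> set xs then None else f y) P)"
| "isubst f Nil = Nil"
| "isubst f (If u v P Q) = If (isu f u) (isu f v) (isubst f P) (isubst f Q)"
| "isubst f (Rec X P) = Rec X (isubst f P)"
| "isubst f (PV X) = PV X"
| "isubst f (Par P Q) = Par (isubst f P) (isubst f Q)"
| "isubst f (Res c s P) = Res c s (isubst f P)"
| "isubst f (Alloc x P) = Alloc x (isubst (f(x := None)) P)"
| "isubst f (Free u P) = Free (isu f u) (isubst f P)"

fun psub :: "pvar \<Rightarrow> proc \<Rightarrow> proc \<Rightarrow> proc" where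
  "psub X R (Out u vs P) = Out u vs (psub X R P)"
| "psub X R (Inp u xs P) = Inp u xs (psub X R P)"
| "psub X R Nil = Nil"
| "psub X R (If u v P Q) = If u v (psub X R P) (psub X R Q)"
| "psub X R (Rec Y P) = (if Y = X then Rec Y P else Rec Y (psub X R P))"
| "psub X R (PV Y) = (if Y = X then R else PV Y)"
| "psub X R (Par P Q) = Par (psub X R P) (psub X R Q)"
| "psub X R (Res c s P) = Res c s (psub X R P)"
| "psub X R (Alloc x P) = Alloc x (psub X R P)"
| "psub X R (Free u P) = Free u (psub X R P)"

definition chr :: "chan \<Rightarrow> chan \<Rightarrow> ident \<Rightarrow> ident" where
  "chr c d u = (if u = Ch c then Ch d else u)"

fun chren :: "chan \<Rightarrow> chan \<Rightarrow> proc \<Rightarrow> proc" where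
  "chren c d (Out u vs P) = Out (chr c d u) (map (chr c d) vs) (chren c d P)"
| "chren c d (Inp u xs P) = Inp (chr c d u) xs (chren c d P)"
| "chren c d Nil = Nil"
| "chren c d (If u v P Q) = If (chr c d u) (chr c d v) (chren c d P) (chren c d Q)"
| "chren c d (Rec X P) = Rec X (chren c d P)"
| "chren c d (PV X) = PV X"
| "chren c d (Par P Q) = Par (chren c d P) (chren c d Q)"
| "chren c d (Res c' s P) = (if c' = c then Res c' s P else Res c' s (chren c d P))"
| "chren c d (Alloc x P) = Alloc x (chren c d P)"
| "chren c d (Free u P) = Free (chr c d u) (chren c d P)"

inductive aeq :: "proc \<Rightarrow> proc \<Rightarrow> bool" where
  aeq_refl: "aeq P P"
| aeq_sym: "aeq P Q \<Longrightarrow> aeq Q P"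
| aeq_trans: "aeq P Q \<Longrightarrow> aeq Q R \<Longrightarrow> aeq P R"
| aeq_Out: "aeq P Q \<Longrightarrow> aeq (Out u vs P) (Out u vs Q)"
| aeq_Inp: "aeq P Q \<Longrightarrow> aeq (Inp u xs P) (Inp u xs Q)"
| aeq_If1: "aeq P P' \<Longrightarrow> aeq (If u v P Q) (If u v P' Q)"
| aeq_If2: "aeq Q Q' \<Longrightarrow> aeq (If u v P Q) (If u v P Q')"
| aeq_Rec: "aeq P Q \<Longrightarrow> aeq (Rec X P) (Rec X Q)"
| aeq_Par1: "aeq P P' \<Longrightarrow> aeq (Par P Q) (Par P' Q)"
| aeq_Par2: "aeq Q Q' \<Longrightarrow> aeq (Par P Q) (Par P Q')"
| aeq_Res: "aeq P Q \<Longrightarrow> aeq (Res c s P) (Res c s Q)"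
| aeq_Alloc: "aeq P Q \<Longrightarrow> aeq (Alloc x P) (Alloc x Q)"
| aeq_Free: "aeq P Q \<Longrightarrow> aeq (Free u P) (Free u Q)"
| alpha_Res: "d \<notin> fnch P \<union> bnch P \<Longrightarrow> aeq (Res c s P) (Res d s (chren c d P))"
| alpha_Inp: "distinct xs \<Longrightarrow> distinct ys \<Longrightarrow> length ys = length xs \<Longrightarrow>
    set ys \<inter> (fv P \<union> bv P \<union> set xs) = {} \<Longrightarrow>
    aeq (Inp u xs P) (Inp u ys (isubst (map_of (zip xs (map Vr ys))) P))"
| alpha_Alloc: "y \<notin> fv P \<union> bv P \<union> {x} \<Longrightarrow>
    aeq (Alloc x P) (Alloc y (isubst ((\<lambda>_. None)(x := Some (Vr y))) P))"
| alpha_Rec: "Y \<notin> fpv P \<union> bpv P \<union> {X} \<Longrightarrow> aeq (Rec X P) (Rec Y (psub X (PV Y) P))"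

inductive sc :: "proc \<Rightarrow> proc \<Rightarrow> bool" (infix "\<equiv>\<^sub>s" 50) where
  sc_alpha: "aeq P Q \<Longrightarrow> P \<equiv>\<^sub>s Q"
| sc_sym: "P \<equiv>\<^sub>s Q \<Longrightarrow> Q \<equiv>\<^sub>s P"
| sc_trans: "P \<equiv>\<^sub>s Q \<Longrightarrow> Q \<equiv>\<^sub>s R \<Longrightarrow> P \<equiv>\<^sub>s R"
| sc_Out: "P \<equiv>\<^sub>s Q \<Longrightarrow> Out u vs P \<equiv>\<^sub>s Out u vs Q"
| sc_Inp: "P \<equiv>\<^sub>s Q \<Longrightarrow> Inp u xs P \<equiv>\<^sub>s Inp u xs Q"
| sc_If1: "P \<equiv>\<^sub>s P' \<Longrightarrow> If u v P Q \<equiv>\<^sub>s If u v P' Q"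
| sc_If2: "Q \<equiv>\<^sub>s Q' \<Longrightarrow> If u v P Q \<equiv>\<^sub>s If u v P Q'"
| sc_Rec: "P \<equiv>\<^sub>s Q \<Longrightarrow> Rec X P \<equiv>\<^sub>s Rec X Q"
| sc_Par1: "P \<equiv>\<^sub>s P' \<Longrightarrow> Par P Q \<equiv>\<^sub>s Par P' Q"
| sc_Par2: "Q \<equiv>\<^sub>s Q' \<Longrightarrow> Par P Q \<equiv>\<^sub>s Par P Q'"
| sc_Res: "P \<equiv>\<^sub>s Q \<Longrightarrow> Res c s P \<equiv>\<^sub>s Res c s Q"
| sc_Alloc: "P \<equiv>\<^sub>s Q \<Longrightarrow> Alloc x P \<equiv>\<^sub>s Alloc x Q"
| sc_Free: "P \<equiv>\<^sub>s Q \<Longrightarrow> Free u P \<equiv>\<^sub>s Free u Q"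
| sc_Par_Nil: "Par P Nil \<equiv>\<^sub>s P"
| sc_Par_comm: "Par P Q \<equiv>\<^sub>s Par Q P"
| sc_Par_assoc: "Par (Par P Q) R \<equiv>\<^sub>s Par P (Par Q R)"
| sc_Res_Nil: "Res c s Nil \<equiv>\<^sub>s Nil"
| sc_Res_swap: "c \<noteq> d \<Longrightarrow> Res c s (Res d t P) \<equiv>\<^sub>s Res d t (Res c s P)"
| sc_Res_extr: "c \<notin> fnch Q \<Longrightarrow> Par (Res c s P) Q \<equiv>\<^sub>s Res c s (Par P Q)"

definition config :: "chstates \<Rightarrow> proc \<Rightarrow> bool" where
  "config \<sigma> P \<longleftrightarrow> finite (dom \<sigma>) \<and> fnch P \<subseteq> dom \<sigma>"

definition closed_config :: "chstates \<Rightarrow> proc \<Rightarrow> bool" where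
  "closed_config \<sigma> P \<longleftrightarrow> config \<sigma> P \<and> fv P = {}"

datatype ctx = Hole | CParL ctx proc | CParR proc ctx | CRes chan ctx

fun capp :: "ctx \<Rightarrow> chstates \<Rightarrow> proc \<Rightarrow> (chstates \<times> proc) option" where
  "capp Hole \<sigma> P = Some (\<sigma>, P)"
| "capp (CParL C Q) \<sigma> P =
     (case capp C \<sigma> P of Some (\<sigma>', P') \<Rightarrow> Some (\<sigma>', Par P' Q) | None \<Rightarrow> None)"
| "capp (CParR Q C) \<sigma> P =
     (case capp C \<sigma> P of Some (\<sigma>', P') \<Rightarrow> Some (\<sigma>', Par Q P') | None \<Rightarrow> None)"
| "capp (CRes c C) \<sigma> P =
     (case capp C \<sigma> P of
        Some (\<sigma>', P') \<Rightarrow> (case \<sigma>' c of Some s \<Rightarrow> Some (\<sigma>'(c := None), Res c s P') | None \<Rightarrow> None)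
      | None \<Rightarrow> None)"

inductive red :: "chstates \<Rightarrow> proc \<Rightarrow> chstates \<Rightarrow> proc \<Rightarrow> bool" where
  red_comm: "closed_config \<sigma> (Par (Out (Ch c) (map Ch bs) Q) (Inp (Ch c) xs P)) \<Longrightarrow>
    closed_config \<sigma> (Par Q (isubst (map_of (zip xs (map Ch bs))) P)) \<Longrightarrow>
    \<sigma> c = Some Top \<Longrightarrow> length bs = length xs \<Longrightarrow> set bs \<inter> bnch P = {} \<Longrightarrow>
    red \<sigma> (Par (Out (Ch c) (map Ch bs) Q) (Inp (Ch c) xs P))
        \<sigma> (Par Q (isubst (map_of (zip xs (map Ch bs))) P))"
| red_rec: "closed_config \<sigma> (Rec X P) \<Longrightarrow> closed_config \<sigma> (psub X (Rec X P) P) \<Longrightarrow>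
    bnch P \<inter> fnch (Rec X P) = {} \<Longrightarrow> bv P \<inter> fv (Rec X P) = {} \<Longrightarrow>
    bpv P \<inter> fpv (Rec X P) = {} \<Longrightarrow>
    red \<sigma> (Rec X P) \<sigma> (psub X (Rec X P) P)"
| red_if_eq: "closed_config \<sigma> (If (Ch c) (Ch c) P Q) \<Longrightarrow> closed_config \<sigma> P \<Longrightarrow>
    red \<sigma> (If (Ch c) (Ch c) P Q) \<sigma> P"
| red_if_neq: "closed_config \<sigma> (If (Ch c) (Ch d) P Q) \<Longrightarrow> closed_config \<sigma> Q \<Longrightarrow> c \<noteq> d \<Longrightarrow>
    red \<sigma> (If (Ch c) (Ch d) P Q) \<sigma> Q"
| red_alloc: "closed_config \<sigma> (Alloc x P) \<Longrightarrow>
    closed_config \<sigma> (Res c Top (isubst ((\<lambda>_. None)(x := Some (Ch c))) P)) \<Longrightarrow>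
    c \<notin> dom \<sigma> \<Longrightarrow> c \<notin> bnch P \<Longrightarrow>
    red \<sigma> (Alloc x P) \<sigma> (Res c Top (isubst ((\<lambda>_. None)(x := Some (Ch c))) P))"
| red_free: "closed_config \<sigma> (Free (Ch c) P) \<Longrightarrow> closed_config (\<sigma>(c \<mapsto> Bot)) P \<Longrightarrow>
    \<sigma> c = Some Top \<Longrightarrow>
    red \<sigma> (Free (Ch c) P) (\<sigma>(c \<mapsto> Bot)) P"
| red_ctx: "red \<sigma> P \<sigma>'' P'' \<Longrightarrow>
    capp C \<sigma> P = Some (\<sigma>1, P1) \<Longrightarrow> capp C \<sigma>'' P'' = Some (\<sigma>2, P2) \<Longrightarrow>
    closed_config \<sigma>1 P1 \<Longrightarrow> closed_config \<sigma>2 P2 \<Longrightarrow>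
    red \<sigma>1 P1 \<sigma>2 P2"
| red_sc: "P \<equiv>\<^sub>s P1 \<Longrightarrow> red \<sigma> P1 \<sigma>' Q1 \<Longrightarrow> Q1 \<equiv>\<^sub>s Q \<Longrightarrow>
    closed_config \<sigma> P \<Longrightarrow> closed_config \<sigma>' Q \<Longrightarrow>
    red \<sigma> P \<sigma>' Q"

datatype attr = Affine | Unr | Uniq nat   (* Uniq i = \<bullet>_i, unique after i steps *)

datatype ty = ChT "ty list" attr | Proc

datatype asm = Has ident ty | IsProc pvar

datatype key = KId ident | KPV pvar

fun akey :: "asm \<Rightarrow> key" where
  "akey (Has u T) = KId u" | "akey (IsProc X) = KPV X"

type_synonym env = "asm multiset"

definition ids :: "env \<Rightarrow> ident set" where
  "ids \<Gamma> = {u. \<exists>T. Has u T \<in># \<Gamma>}"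

definition pvs :: "env \<Rightarrow> pvar set" where
  "pvs \<Gamma> = {X. IsProc X \<in># \<Gamma>}"

text \<open>Decrement: the multiset replacing u:[Ts]^a by u:[Ts]^(a-1); None if undefined.\<close>
fun dec :: "ident \<Rightarrow> ty list \<Rightarrow> attr \<Rightarrow> env option" where
  "dec u Ts Affine = Some {#}"
| "dec u Ts Unr = Some {# Has u (ChT Ts Unr) #}"
| "dec u Ts (Uniq 0) = None"
| "dec u Ts (Uniq (Suc i)) = Some {# Has u (ChT Ts (Uniq i)) #}"

inductive tsplit :: "ty \<Rightarrow> ty \<Rightarrow> ty \<Rightarrow> bool" where
  "tsplit (ChT Ts Unr) (ChT Ts Unr) (ChT Ts Unr)"
| "tsplit Proc Proc Proc"
| "tsplit (ChT Ts (Uniq i)) (ChT Ts Affine) (ChT Ts (Uniq (Suc i)))"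

inductive sub_attr :: "attr \<Rightarrow> attr \<Rightarrow> bool" where
  "sub_attr (Uniq i) (Uniq (Suc i))"
| "sub_attr (Uniq (Suc i)) Unr"
| "sub_attr Unr Affine"

inductive sub_ty :: "ty \<Rightarrow> ty \<Rightarrow> bool" where
  "sub_attr a1 a2 \<Longrightarrow> sub_ty (ChT Ts a1) (ChT Ts a2)"

fun unr :: "asm \<Rightarrow> bool" where
  "unr (Has u (ChT Ts a)) = (a = Unr)"
| "unr (Has u Proc) = True"
| "unr (IsProc X) = True"

text \<open>Raw typing judgement on concrete terms; binders are required to be fresh
(the paper's convention "bound variables fresh").\<close>

inductive rtyp :: "env \<Rightarrow> proc \<Rightarrow> bool" where
  t_in: "dec u Ts a = Some D \<Longrightarrow> length xs = length Ts \<Longrightarrow> distinct xs \<Longrightarrow>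
    (\<forall>x\<in>set xs. Vr x \<notin> ids \<Gamma> \<and> Vr x \<noteq> u) \<Longrightarrow>
    rtyp (\<Gamma> + D + mset (map2 (\<lambda>x T. Has (Vr x) T) xs Ts)) P \<Longrightarrow>
    rtyp (\<Gamma> + {# Has u (ChT Ts a) #}) (Inp u xs P)"
| t_out: "dec u Ts a = Some D \<Longrightarrow> length vs = length Ts \<Longrightarrow>
    rtyp (\<Gamma> + D) P \<Longrightarrow>
    rtyp (\<Gamma> + {# Has u (ChT Ts a) #} + mset (map2 Has vs Ts)) (Out u vs P)"
| t_par: "rtyp \<Gamma>1 P \<Longrightarrow> rtyp \<Gamma>2 Q \<Longrightarrow> rtyp (\<Gamma>1 + \<Gamma>2) (Par P Q)"
| t_if: "u \<in> ids \<Gamma> \<Longrightarrow> v \<in> ids \<Gamma> \<Longrightarrow> rtyp \<Gamma> P \<Longrightarrow> rtyp \<Gamma> Q \<Longrightarrow>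
    rtyp \<Gamma> (If u v P Q)"
| t_rec: "\<forall>a\<in>#\<Gamma>. unr a \<Longrightarrow> X \<notin> pvs \<Gamma> \<Longrightarrow> rtyp (\<Gamma> + {# IsProc X #}) P \<Longrightarrow>
    rtyp \<Gamma> (Rec X P)"
| t_pv: "rtyp {# IsProc X #} (PV X)"
| t_alloc: "Vr x \<notin> ids \<Gamma> \<Longrightarrow> rtyp (\<Gamma> + {# Has (Vr x) (ChT Ts (Uniq 0)) #}) P \<Longrightarrow>
    rtyp \<Gamma> (Alloc x P)"
| t_free: "rtyp \<Gamma> P \<Longrightarrow> rtyp (\<Gamma> + {# Has u (ChT Ts (Uniq 0)) #}) (Free u P)"
| t_nil: "rtyp {#} Nil"
| t_res_top: "Ch c \<notin> ids \<Gamma> \<Longrightarrow> rtyp (\<Gamma> + {# Has (Ch c) T #}) P \<Longrightarrow>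
    rtyp \<Gamma> (Res c Top P)"
| t_res_bot: "Ch c \<notin> ids \<Gamma> \<Longrightarrow> rtyp \<Gamma> P \<Longrightarrow> rtyp \<Gamma> (Res c Bot P)"
| t_split: "tsplit T T1 T2 \<Longrightarrow> rtyp (\<Gamma> + {# Has u T1, Has u T2 #}) P \<Longrightarrow>
    rtyp (\<Gamma> + {# Has u T #}) P"
| t_split_pv: "rtyp (\<Gamma> + {# IsProc X, IsProc X #}) P \<Longrightarrow> rtyp (\<Gamma> + {# IsProc X #}) P"
| t_weak: "rtyp \<Gamma> P \<Longrightarrow> rtyp (\<Gamma> + {# A #}) P"
| t_sub: "rtyp (\<Gamma> + {# Has u T2 #}) P \<Longrightarrow> sub_ty T1 T2 \<Longrightarrow> rtyp (\<Gamma> + {# Has u T1 #}) P"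
| t_bullet0: "rtyp (\<Gamma> + {# Has u (ChT Ts2 (Uniq 0)) #}) P \<Longrightarrow>
    rtyp (\<Gamma> + {# Has u (ChT Ts1 (Uniq 0)) #}) P"

definition typing :: "env \<Rightarrow> proc \<Rightarrow> bool" (infix "\<turnstile>\<^sub>P" 40) where
  "\<Gamma> \<turnstile>\<^sub>P P \<longleftrightarrow> (\<exists>P0. aeq P P0 \<and> rtyp \<Gamma> P0)"

definition env_partial_fun :: "env \<Rightarrow> bool" where
  "env_partial_fun \<Gamma> \<longleftrightarrow> (\<forall>k. size (filter_mset (\<lambda>a. akey a = k) \<Gamma>) \<le> 1)"

definition config_typing :: "env \<Rightarrow> chstates \<Rightarrow> proc \<Rightarrow> bool" where
  "config_typing \<Gamma> \<sigma> P \<longleftrightarrow>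
     (\<forall>c. Ch c \<in> ids \<Gamma> \<longrightarrow> \<sigma> c = Some Top) \<and> (\<Gamma> \<turnstile>\<^sub>P P) \<and> env_partial_fun \<Gamma>"

end

theory Submission
  imports Defs
begin

text \<open>The rules \<^const>\<open>rtyp\<close> are recast as a syntax-directed judgement \<open>vtyp P \<Delta> \<rho> S\<close>. The valuation
  \<open>\<rho>\<close> sends the identifiers of \<open>P\<close> to keys, the multiset \<open>\<Delta>\<close> holds assumptions on keys, \<open>S\<close> is the set
  of available process variables, and a binder is typed for every choice of key for the bound
  identifier. Substituting in \<open>P\<close> then amounts to changing \<open>\<rho>\<close>, so that alpha-equivalence, structural
  congruence and the substitution lemmas need no renaming of bound names.

  For subject reduction call \<open>\<Delta>\<close> coherent if at each key its assumptions are derivable from a single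
  one: they are unrestricted or affine, or else one is unique after \<open>i\<close> steps and the others are at
  most \<open>i\<close> affine ones, all with the same payload. Coherence survives the structural rules and forces
  the two ends of a communication to agree on the payload. A reduction step preserves it for the
  redex together with any frame of assumptions held by the context: a communication on a unique channel
  consumes one affine assumption and lowers \<open>i\<close> by one, and a channel that is freed has no other
  assumption. Collapsing a coherent environment to one assumption per key gives the partial function
  that configuration typing asks for.\<close>

section \<open>Structural rules on environments\<close>

text \<open>Some invariant is forced. A sender and a receiver on one channel can be typed under two
  affine assumptions with different payloads, and splitting at a parallel composition makes an
  environment mention a channel several times, so being a partial function does not survive inside a
  derivation. The index in the invariant counts permissions: splitting \<open>Uniq i\<close> hands
  out one affine assumption and leaves \<open>Uniq (Suc i)\<close>, so starting from
  \<open>Uniq 0\<close> the index bounds the affine assumptions still in circulation. At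
  \<open>Uniq 0\<close> none is left, which is why changing the payload or freeing the channel is
  harmless there. The valuations answer a second obstacle. \<open>rtyp\<close> requires fresh
  binders on concrete terms and lets structural rules interrupt a derivation anywhere, whereas
  \<open>typing\<close> and reduction work up to alpha-equivalence, so direct inversion of
  \<open>rtyp\<close> would mix renamings with structural steps.\<close>

type_synonym idenv = "(ident \<times> ty) multiset"

abbreviation keys :: "idenv \<Rightarrow> ident set" where
  "keys \<Delta> \<equiv> fst ` set_mset \<Delta>"

text \<open>The rules for weakening, splitting, subtyping and change of payload, read from
  conclusion to premise. Each trades one assumption for zero, one or two assumptions on the same
  identifier, so one shape covers all of them, and \<open>reaches\<close> leads from the environment
  of a conclusion to that of a premise.\<close>

inductive splits_to :: "ty \<Rightarrow> ty multiset \<Rightarrow> bool" where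
  "splits_to T {#}"
| "tsplit T T1 T2 \<Longrightarrow> splits_to T {#T1, T2#}"
| "sub_ty T1 T2 \<Longrightarrow> splits_to T1 {#T2#}"
| "splits_to (ChT Ts1 (Uniq 0)) {#ChT Ts2 (Uniq 0)#}"

inductive env_step :: "idenv \<Rightarrow> idenv \<Rightarrow> bool" where
  env_stepI: "splits_to T M \<Longrightarrow> env_step (\<Gamma> + {#(u, T)#}) (\<Gamma> + image_mset (Pair u) M)"

abbreviation reaches :: "idenv \<Rightarrow> idenv \<Rightarrow> bool" (infix "\<leadsto>" 50) where
  "\<Delta> \<leadsto> \<Gamma> \<equiv> env_step\<^sup>*\<^sup>* \<Delta> \<Gamma>"

lemma env_step_add: "env_step \<Delta> \<Gamma> \<Longrightarrow> env_step (\<Delta> + E) (\<Gamma> + E)"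
proof (induction rule: env_step.induct)
  case (env_stepI T M \<Gamma> u)
  then show ?case using env_step.intros[of T M "\<Gamma> + E" u] by (simp add: ac_simps)
qed

lemma reaches_add_right: "\<Delta> \<leadsto> \<Gamma> \<Longrightarrow> \<Delta> + E \<leadsto> \<Gamma> + E"
  by (induction rule: rtranclp_induct) (auto intro: env_step_add rtranclp.rtrancl_into_rtrancl)

lemma reaches_add: "\<Delta> \<leadsto> \<Gamma> \<Longrightarrow> \<Delta>' \<leadsto> \<Gamma>' \<Longrightarrow> \<Delta> + \<Delta>' \<leadsto> \<Gamma> + \<Gamma>'"
  using reaches_add_right[of \<Delta> \<Gamma> \<Delta>'] reaches_add_right[of \<Delta>' \<Gamma>' \<Gamma>]
  by (metis add.commute rtranclp_trans)

lemma reaches_weaken_left: "E + \<Delta> \<leadsto> \<Delta>"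
proof (induction E)
  case (add x E)
  have "env_step (E + \<Delta> + {#x#}) (E + \<Delta>)"
    using env_stepI[OF splits_to.intros(1), of "E + \<Delta>" "fst x" "snd x"] by simp
  then show ?case using add by (simp add: converse_rtranclp_into_rtranclp)
qed simp

lemma reaches_weaken_right: "\<Delta> + E \<leadsto> \<Delta>"
  using reaches_weaken_left[of E \<Delta>] by (simp add: ac_simps)

lemma reaches_filter_subset: "\<Delta> \<leadsto> filter_mset p \<Delta>"
  using reaches_weaken_right[of "filter_mset p \<Delta>" "filter_mset (\<lambda>x. \<not> p x) \<Delta>"]
  by (simp flip: multiset_partition)

definition rename :: "(ident \<Rightarrow> ident) \<Rightarrow> idenv \<Rightarrow> idenv" where
  "rename g \<Delta> = image_mset (\<lambda>x. (g (fst x), snd x)) \<Delta>"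

lemma rename_simps [simp]:
  "rename g {#} = {#}"
  "rename g (add_mset x \<Delta>) = add_mset (g (fst x), snd x) (rename g \<Delta>)"
  "rename g (\<Delta> + \<Gamma>) = rename g \<Delta> + rename g \<Gamma>"
  "rename g (image_mset (Pair u) M) = image_mset (Pair (g u)) M"
  "rename id \<Delta> = \<Delta>"
  by (auto simp: rename_def multiset.map_comp comp_def)

lemma keys_rename [simp]: "keys (rename g \<Delta>) = g ` keys \<Delta>"
  by (simp add: rename_def image_image)

lemma rename_mset_zip [simp]: "rename g (mset (zip ks Ts)) = mset (zip (map g ks) Ts)"
  by (induction ks Ts rule: list_induct2') auto

lemma rename_cong: "(\<And>u. u \<in> keys \<Delta> \<Longrightarrow> g u = h u) \<Longrightarrow> rename g \<Delta> = rename h \<Delta>"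
  unfolding rename_def by (rule image_mset_cong) auto

lemma reaches_rename: "\<Delta> \<leadsto> \<Gamma> \<Longrightarrow> rename g \<Delta> \<leadsto> rename g \<Gamma>"
proof (induction rule: rtranclp_induct)
  case (step y z)
  from step(2) have "env_step (rename g y) (rename g z)"
  proof cases
    case (env_stepI T M \<Gamma> u)
    then show ?thesis using env_step.intros[of T M "rename g \<Gamma>" "g u"] by simp
  qed
  with step show ?case by simp
qed simp

lemma reaches_filter_keys:
  assumes "\<Delta> \<leadsto> \<Gamma>"
  shows "filter_mset (\<lambda>x. fst x \<in> K) \<Delta> \<leadsto> filter_mset (\<lambda>x. fst x \<in> K) \<Gamma>"
  using assms
proof (induction rule: rtranclp_induct)
  case (step y z)
  from step(2) have "filter_mset (\<lambda>x. fst x \<in> K) y \<leadsto> filter_mset (\<lambda>x. fst x \<in> K) z"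
  proof cases
    case (env_stepI T M \<Gamma> u)
    have "filter_mset (\<lambda>x. fst x \<in> K) (image_mset (Pair u) M) = (if u \<in> K then image_mset (Pair u) M else {#})"
      by (auto simp: filter_mset_image_mset)
    with env_stepI show ?thesis
      using env_step.intros[of T M "filter_mset (\<lambda>x. fst x \<in> K) \<Gamma>" u] by auto
  qed
  with step show ?case by (meson rtranclp_trans)
qed simp

lemma reaches_keys: "\<Delta> \<leadsto> \<Gamma> \<Longrightarrow> keys \<Gamma> \<subseteq> keys \<Delta>"
proof (induction rule: rtranclp_induct)
  case (step y z)
  from step(2) have "keys z \<subseteq> keys y" by cases auto
  with step show ?case by blast
qed simp

fun unr_ty :: "ty \<Rightarrow> bool" where
  "unr_ty (ChT Ts a) = (a = Unr)"
| "unr_ty Proc = True"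

lemma unr_Has [simp]: "unr (Has u T) = unr_ty T"
  by (cases T) auto

abbreviation unr_env :: "idenv \<Rightarrow> bool" where
  "unr_env \<Delta> \<equiv> \<forall>x\<in>#\<Delta>. unr_ty (snd x)"

text \<open>An unrestricted type splits into two copies of itself. This pays for the copies of a
  recursive process made by unfolding.\<close>

lemma reaches_contract: "unr_env \<Delta> \<Longrightarrow> \<Delta> \<leadsto> \<Delta> + \<Delta>"
proof (induction \<Delta>)
  case (add x \<Delta>)
  obtain u T where x: "x = (u, T)" by force
  have "tsplit T T T" using add.prems by (cases T) (auto simp: x intro: tsplit.intros)
  then have "env_step {#x#} ({#x#} + {#x#})"
    using env_stepI[OF splits_to.intros(2), of T T T "{#}" u] by (simp add: x)
  then have "{#x#} + \<Delta> \<leadsto> ({#x#} + {#x#}) + (\<Delta> + \<Delta>)"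
    using add by (intro reaches_add) auto
  then show ?case by (simp add: ac_simps)
qed simp

section \<open>Typing relative to a valuation of identifiers\<close>

text \<open>The first occurrence wins if \<open>vs\<close> has repetitions, just as in
  \<open>map_of\<close>, so a substitution built by \<open>map_of (zip xs vs)\<close> is an
  \<open>assign\<close> without any distinctness condition.\<close>

fun assign :: "(ident \<Rightarrow> ident) \<Rightarrow> ident list \<Rightarrow> ident list \<Rightarrow> ident \<Rightarrow> ident" where
  "assign \<rho> (v # vs) (k # ks) = (assign \<rho> vs ks)(v := k)"
| "assign \<rho> _ _ = \<rho>"

text \<open>\<open>dec\<close> with the identifier left out: the decremented assumption has to sit
  on the key of the subject, not on the subject itself.\<close>

fun decrement :: "ty list \<Rightarrow> attr \<Rightarrow> ty multiset option" where
  "decrement Ts Affine = Some {#}"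
| "decrement Ts Unr = Some {#ChT Ts Unr#}"
| "decrement Ts (Uniq 0) = None"
| "decrement Ts (Uniq (Suc i)) = Some {#ChT Ts (Uniq i)#}"

text \<open>The keys need be neither fresh nor distinct. A communication instantiates them with the
  transmitted channels, which may repeat or be known to the receiver already.\<close>

definition binds :: "ident list \<Rightarrow> ty list \<Rightarrow> (idenv \<Rightarrow> (ident \<Rightarrow> ident) \<Rightarrow> bool) \<Rightarrow>
    idenv \<Rightarrow> (ident \<Rightarrow> ident) \<Rightarrow> bool" where
  "binds vs Ts B \<Gamma> \<rho> \<longleftrightarrow>
     (\<forall>ks. length ks = length vs \<longrightarrow> B (\<Gamma> + mset (zip ks Ts)) (assign \<rho> vs ks))"

text \<open>For \<open>Bot\<close> the empty list makes \<open>zip [k] []\<close> empty, so the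
  allocated and the deallocated restriction share one clause of \<open>vtyp\<close>.\<close>

definition res_tys :: "chstate \<Rightarrow> ty \<Rightarrow> ty list" where
  "res_tys s T = (if s = Top then [T] else [])"

text \<open>Structural steps are built in only where a rule divides or consumes assumptions, or
  demands unrestricted ones; past the other rules they can be permuted. Process variables admit
  weakening and contraction, so a set \<open>S\<close> records them.\<close>

primrec vtyp :: "proc \<Rightarrow> idenv \<Rightarrow> (ident \<Rightarrow> ident) \<Rightarrow> pvar set \<Rightarrow> bool" where
  "vtyp (Out u vs P) = (\<lambda>\<Delta> \<rho> S. \<exists>\<Gamma> Ts a D.
     \<Delta> \<leadsto> \<Gamma> + {#(\<rho> u, ChT Ts a)#} + mset (zip (map \<rho> vs) Ts) \<and>
     length vs = length Ts \<and> decrement Ts a = Some D \<and>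
     vtyp P (\<Gamma> + image_mset (Pair (\<rho> u)) D) \<rho> S)"
| "vtyp (Inp u xs P) = (\<lambda>\<Delta> \<rho> S. \<exists>\<Gamma> Ts a D.
     \<Delta> \<leadsto> \<Gamma> + {#(\<rho> u, ChT Ts a)#} \<and>
     length xs = length Ts \<and> distinct xs \<and> decrement Ts a = Some D \<and>
     binds (map Vr xs) Ts (\<lambda>\<Delta> \<rho>. vtyp P \<Delta> \<rho> S) (\<Gamma> + image_mset (Pair (\<rho> u)) D) \<rho>)"
| "vtyp Nil = (\<lambda>\<Delta> \<rho> S. True)"
| "vtyp (If u v P Q) = (\<lambda>\<Delta> \<rho> S. \<rho> u \<in> keys \<Delta> \<and> \<rho> v \<in> keys \<Delta> \<and> vtyp P \<Delta> \<rho> S \<and> vtyp Q \<Delta> \<rho> S)"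
| "vtyp (Rec X P) = (\<lambda>\<Delta> \<rho> S. \<exists>\<Gamma>. \<Delta> \<leadsto> \<Gamma> \<and> unr_env \<Gamma> \<and> vtyp P \<Gamma> \<rho> (insert X S))"
| "vtyp (PV X) = (\<lambda>\<Delta> \<rho> S. X \<in> S)"
| "vtyp (Par P Q) = (\<lambda>\<Delta> \<rho> S. \<exists>\<Gamma>1 \<Gamma>2. \<Delta> \<leadsto> \<Gamma>1 + \<Gamma>2 \<and> vtyp P \<Gamma>1 \<rho> S \<and> vtyp Q \<Gamma>2 \<rho> S)"
| "vtyp (Res c s P) = (\<lambda>\<Delta> \<rho> S. \<exists>T. binds [Ch c] (res_tys s T) (\<lambda>\<Delta> \<rho>. vtyp P \<Delta> \<rho> S) \<Delta> \<rho>)"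
| "vtyp (Alloc x P) = (\<lambda>\<Delta> \<rho> S. \<exists>Ts. binds [Vr x] [ChT Ts (Uniq 0)] (\<lambda>\<Delta> \<rho>. vtyp P \<Delta> \<rho> S) \<Delta> \<rho>)"
| "vtyp (Free u P) = (\<lambda>\<Delta> \<rho> S. \<exists>\<Gamma> Ts. \<Delta> \<leadsto> \<Gamma> + {#(\<rho> u, ChT Ts (Uniq 0))#} \<and> vtyp P \<Gamma> \<rho> S)"

text \<open>The structural rules are admissible: they are prepended to the \<open>reaches\<close> of
  a clause or pushed under its binder. The \<open>If\<close> clause survives because
  \<open>reaches\<close> never creates a key.\<close>

lemma vtyp_reaches: "vtyp P \<Delta>' \<rho> S \<Longrightarrow> \<Delta> \<leadsto> \<Delta>' \<Longrightarrow> vtyp P \<Delta> \<rho> S"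
proof (induction P arbitrary: \<Delta> \<Delta>' \<rho> S)
  case (Out u vs P)
  then show ?case using rtranclp_trans[OF Out.prems(2)] unfolding vtyp.simps by blast
next
  case (Inp u xs P)
  then show ?case using rtranclp_trans[OF Inp.prems(2)] unfolding vtyp.simps by blast
next
  case (If u v P Q)
  then show ?case using reaches_keys[OF If.prems(2)] by auto
next
  case (Rec X P)
  then show ?case using rtranclp_trans[OF Rec.prems(2)] unfolding vtyp.simps by blast
next
  case (Par P Q)
  then show ?case using rtranclp_trans[OF Par.prems(2)] unfolding vtyp.simps by blast
next
  case (Res c s P)
  then show ?case using reaches_add_right[OF Res.prems(2)] unfolding vtyp.simps binds_def by blast
next
  case (Alloc x P)
  then show ?case using reaches_add_right[OF Alloc.prems(2)] unfolding vtyp.simps binds_def by blast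
next
  case (Free u P)
  then show ?case using rtranclp_trans[OF Free.prems(2)] unfolding vtyp.simps by blast
qed auto

lemma vtyp_weaken: "vtyp P \<Delta> \<rho> S \<Longrightarrow> vtyp P (\<Delta> + E) \<rho> S"
  using vtyp_reaches reaches_weaken_right by blast

section \<open>Free identifiers and dependence of typing on the valuation\<close>

definition fids :: "proc \<Rightarrow> ident set" where
  "fids P = Ch ` fnch P \<union> Vr ` fv P"

definition bids :: "proc \<Rightarrow> ident set" where
  "bids P = Ch ` bnch P \<union> Vr ` bv P"

lemma mem_ichs: "c \<in> ichs u \<longleftrightarrow> u = Ch c"
  by (cases u) auto

lemma mem_ivs: "x \<in> ivs u \<longleftrightarrow> u = Vr x"
  by (cases u) auto

lemma mem_fids: "v \<in> fids P \<longleftrightarrow> (case v of Ch c \<Rightarrow> c \<in> fnch P | Vr x \<Rightarrow> x \<in> fv P)"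
  by (auto simp: fids_def split: ident.splits)

lemma fids_simps [simp]:
  "fids (Out u vs P) = {u} \<union> set vs \<union> fids P"
  "fids (Inp u xs P) = {u} \<union> (fids P - Vr ` set xs)"
  "fids Nil = {}"
  "fids (If u v P Q) = {u, v} \<union> fids P \<union> fids Q"
  "fids (Rec X P) = fids P"
  "fids (PV X) = {}"
  "fids (Par P Q) = fids P \<union> fids Q"
  "fids (Res c s P) = fids P - {Ch c}"
  "fids (Alloc x P) = fids P - {Vr x}"
  "fids (Free u P) = {u} \<union> fids P"
  by (auto simp: set_eq_iff mem_fids mem_ichs mem_ivs split: ident.splits)

lemma bids_simps [simp]:
  "bids (Out u vs P) = bids P"
  "bids (Inp u xs P) = Vr ` set xs \<union> bids P"
  "bids Nil = {}"
  "bids (If u v P Q) = bids P \<union> bids Q"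
  "bids (Rec X P) = bids P"
  "bids (PV X) = {}"
  "bids (Par P Q) = bids P \<union> bids Q"
  "bids (Res c s P) = insert (Ch c) (bids P)"
  "bids (Alloc x P) = insert (Vr x) (bids P)"
  "bids (Free u P) = bids P"
  by (auto simp: bids_def)

lemma finite_fids [simp]: "finite (fids P)"
  by (induction P) auto

lemma assign_notin: "v \<notin> set vs \<Longrightarrow> assign \<rho> vs ks v = \<rho> v"
  by (induction \<rho> vs ks rule: assign.induct) auto

lemma assign_cong:
  "length ks = length vs \<Longrightarrow> (v \<notin> set vs \<Longrightarrow> \<rho> v = \<rho>' v) \<Longrightarrow> assign \<rho> vs ks v = assign \<rho>' vs ks v"
  by (induction ks vs rule: list_induct2) auto

lemma binds_cong_idents:
  assumes "length vs = length vs'"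
    and "\<And>\<Delta> ks. length ks = length vs \<Longrightarrow> B \<Delta> (assign \<rho> vs ks) = B' \<Delta> (assign \<rho>' vs' ks)"
  shows "binds vs Ts B \<Gamma> \<rho> = binds vs' Ts B' \<Gamma> \<rho>'"
  using assms unfolding binds_def by auto

lemmas binds_cong = binds_cong_idents[OF refl]

lemma vtyp_cong:
  "(\<And>u. u \<in> fids P \<Longrightarrow> \<rho> u = \<rho>' u) \<Longrightarrow> S \<inter> fpv P = S' \<inter> fpv P \<Longrightarrow> vtyp P \<Delta> \<rho> S = vtyp P \<Delta> \<rho>' S'"
proof (induction P arbitrary: \<Delta> \<rho> \<rho>' S S')
  case (Out u vs P)
  have "map \<rho> vs = map \<rho>' vs" "\<rho> u = \<rho>' u" using Out.prems by auto
  moreover have "vtyp P \<Delta> \<rho> S = vtyp P \<Delta> \<rho>' S'" for \<Delta>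
    by (rule Out.IH) (use Out.prems in auto)
  ultimately show ?case by (simp only: vtyp.simps)
next
  case (Inp u xs P)
  have "\<rho> u = \<rho>' u" using Inp.prems by auto
  moreover have "binds (map Vr xs) Ts (\<lambda>\<Delta> \<rho>. vtyp P \<Delta> \<rho> S) \<Gamma> \<rho> = binds (map Vr xs) Ts (\<lambda>\<Delta> \<rho>. vtyp P \<Delta> \<rho> S') \<Gamma> \<rho>'" for Ts \<Gamma>
    by (rule binds_cong, rule Inp.IH) (use Inp.prems in \<open>auto intro!: assign_cong\<close>)
  ultimately show ?case by simp
next
  case (If u v P Q)
  have "vtyp P \<Delta> \<rho> S = vtyp P \<Delta> \<rho>' S'" by (rule If.IH(1)) (use If.prems in auto)
  moreover have "vtyp Q \<Delta> \<rho> S = vtyp Q \<Delta> \<rho>' S'" by (rule If.IH(2)) (use If.prems in auto)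
  ultimately show ?case using If.prems by auto
next
  case (Rec X P)
  have "vtyp P \<Delta> \<rho> (insert X S) = vtyp P \<Delta> \<rho>' (insert X S')" for \<Delta>
    by (rule Rec.IH) (use Rec.prems in auto)
  then show ?case by simp
next
  case (Par P Q)
  have "vtyp P \<Delta> \<rho> S = vtyp P \<Delta> \<rho>' S'" for \<Delta> by (rule Par.IH(1)) (use Par.prems in auto)
  moreover have "vtyp Q \<Delta> \<rho> S = vtyp Q \<Delta> \<rho>' S'" for \<Delta> by (rule Par.IH(2)) (use Par.prems in auto)
  ultimately show ?case by simp
next
  case (Res c s P)
  have "binds [Ch c] Ts (\<lambda>\<Delta> \<rho>. vtyp P \<Delta> \<rho> S) \<Delta> \<rho> = binds [Ch c] Ts (\<lambda>\<Delta> \<rho>. vtyp P \<Delta> \<rho> S') \<Delta> \<rho>'" for Ts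
    by (rule binds_cong, rule Res.IH) (use Res.prems in \<open>auto intro!: assign_cong\<close>)
  then show ?case by simp
next
  case (Alloc x P)
  have "binds [Vr x] Ts (\<lambda>\<Delta> \<rho>. vtyp P \<Delta> \<rho> S) \<Delta> \<rho> = binds [Vr x] Ts (\<lambda>\<Delta> \<rho>. vtyp P \<Delta> \<rho> S') \<Delta> \<rho>'" for Ts
    by (rule binds_cong, rule Alloc.IH) (use Alloc.prems in \<open>auto intro!: assign_cong\<close>)
  then show ?case by simp
next
  case (Free u P)
  have "\<rho> u = \<rho>' u" using Free.prems by auto
  moreover have "vtyp P \<Delta> \<rho> S = vtyp P \<Delta> \<rho>' S'" for \<Delta>
    by (rule Free.IH) (use Free.prems in auto)
  ultimately show ?case by simp
qed auto

section \<open>Renaming of keys\<close>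

lemma fresh_idents:
  assumes "finite (A :: ident set)"
  obtains ks where "length ks = n" "distinct ks" "set ks \<inter> A = {}"
proof -
  have "infinite (UNIV :: ident set)"
    using infinite_UNIV_nat inj_on_finite[of Ch UNIV UNIV] by (auto simp: inj_def)
  then have "infinite (- A)" using assms by (simp add: Compl_eq_Diff_UNIV)
  then obtain B where B: "finite B" "card B = n" "B \<subseteq> - A"
    using infinite_arbitrarily_large by blast
  then obtain ks where "set ks = B" "distinct ks" using finite_distinct_list by blast
  with B that[of ks] distinct_card[of ks] show ?thesis by auto
qed

lemma map_assign: "distinct ks \<Longrightarrow> length ks' = length ks \<Longrightarrow> map (assign g ks ks') ks = ks'"
proof (induction ks arbitrary: ks')
  case (Cons k ks)
  then obtain k' ks'' where "ks' = k' # ks''" by (cases ks') auto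
  moreover have "map (\<lambda>a. if a = k then k' else assign g ks ks'' a) ks = map (assign g ks ks'') ks"
    using Cons.prems by (intro map_cong) auto
  ultimately show ?case using Cons.IH[of ks''] Cons.prems by (simp add: fun_upd_def del: map_eq_conv)
qed simp

lemma comp_assign: "h (assign \<rho> vs ks v) = assign (\<lambda>v. h (\<rho> v)) vs (map h ks) v"
  by (induction \<rho> vs ks rule: assign.induct) auto

text \<open>A binder opened at distinct keys \<open>ks\<close> can be reopened at \<open>ks'\<close>
  by mapping the former to the latter. Nothing else moves, since outside \<open>vs\<close> the
  valuation does not hit \<open>ks\<close>.\<close>

lemma assign_assign:
  assumes "distinct ks" "length ks = length vs" "length ks' = length vs"
    and "v \<notin> set vs \<Longrightarrow> \<rho> v \<notin> set ks"
  shows "assign g ks ks' (assign \<rho> vs ks v) = assign (\<lambda>v. g (\<rho> v)) vs ks' v"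
proof -
  have "assign g ks ks' (assign \<rho> vs ks v) = assign (\<lambda>v. assign g ks ks' (\<rho> v)) vs ks' v"
    using assms by (simp add: comp_assign[where h = "assign g ks ks'"] map_assign)
  also have "\<dots> = assign (\<lambda>v. g (\<rho> v)) vs ks' v"
    by (rule assign_cong) (use assms in \<open>auto simp: assign_notin\<close>)
  finally show ?thesis .
qed

text \<open>The renaming property is the hypothesis \<open>ren\<close>, so that the same argument
  serves inside the induction proving that property and again afterwards for
  \<open>binds_fresh\<close>. It is applied to \<open>g\<close> overridden so as to send
  \<open>ks\<close> to \<open>ks'\<close>.\<close>

lemma rename_body:
  assumes ren: "\<And>\<Delta> \<rho> g. vtyp P \<Delta> \<rho> S \<Longrightarrow> vtyp P (rename g \<Delta>) (\<lambda>v. g (\<rho> v)) S"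
    and body: "vtyp P (\<Gamma> + mset (zip ks Ts)) (assign \<rho> vs ks) S"
    and ks: "distinct ks" "length ks = length vs" "set ks \<inter> keys \<Gamma> = {}"
      "set ks \<inter> \<rho> ` (fids P - set vs) = {}"
    and ks': "length ks' = length vs"
  shows "vtyp P (rename g \<Gamma> + mset (zip ks' Ts)) (assign (\<lambda>v. g (\<rho> v)) vs ks') S"
proof -
  have "rename (assign g ks ks') \<Gamma> = rename g \<Gamma>"
    by (rule rename_cong) (use ks in \<open>auto intro!: assign_notin\<close>)
  then have "vtyp P (rename g \<Gamma> + mset (zip ks' Ts)) (\<lambda>v. assign g ks ks' (assign \<rho> vs ks v)) S"
    using ren[OF body, of "assign g ks ks'"] ks ks' by (simp add: map_assign)
  moreover have "vtyp P \<Delta> (\<lambda>v. assign g ks ks' (assign \<rho> vs ks v)) S = vtyp P \<Delta> (assign (\<lambda>v. g (\<rho> v)) vs ks') S" for \<Delta>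
    by (rule vtyp_cong) (use ks ks' in \<open>auto intro!: assign_assign\<close>)
  ultimately show ?thesis by simp
qed

lemma binds_rename:
  assumes ren: "\<And>\<Delta> \<rho> g. vtyp P \<Delta> \<rho> S \<Longrightarrow> vtyp P (rename g \<Delta>) (\<lambda>v. g (\<rho> v)) S"
    and "binds vs Ts (\<lambda>\<Delta> \<rho>. vtyp P \<Delta> \<rho> S) \<Gamma> \<rho>"
  shows "binds vs Ts (\<lambda>\<Delta> \<rho>. vtyp P \<Delta> \<rho> S) (rename g \<Gamma>) (\<lambda>v. g (\<rho> v))"
proof -
  \<comment> \<open>The target keys need not lie in the range of \<open>g\<close>, so the binder is
    opened at fresh keys, on which \<open>g\<close> can be redefined freely.\<close>
  obtain ks where "length ks = length vs" "distinct ks" "set ks \<inter> (keys \<Gamma> \<union> \<rho> ` fids P) = {}"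
    using fresh_idents[of "keys \<Gamma> \<union> \<rho> ` fids P"] by auto
  then show ?thesis
    using assms(2) unfolding binds_def
    by (intro allI impI rename_body[where ks = ks, OF ren]) auto
qed

text \<open>The renaming need not be injective: environments are multisets, so merged keys keep all their
  assumptions.\<close>

lemma vtyp_rename: "vtyp P \<Delta> \<rho> S \<Longrightarrow> vtyp P (rename g \<Delta>) (\<lambda>v. g (\<rho> v)) S"
proof (induction P arbitrary: \<Delta> \<rho> S g)
  case (Out u vs P)
  then obtain \<Gamma> Ts a D where *: "\<Delta> \<leadsto> \<Gamma> + {#(\<rho> u, ChT Ts a)#} + mset (zip (map \<rho> vs) Ts)"
    "length vs = length Ts" "decrement Ts a = Some D" "vtyp P (\<Gamma> + image_mset (Pair (\<rho> u)) D) \<rho> S"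
    by auto
  have "rename g \<Delta> \<leadsto> rename g \<Gamma> + {#(g (\<rho> u), ChT Ts a)#} + mset (zip (map (\<lambda>v. g (\<rho> v)) vs) Ts)"
    using reaches_rename[OF *(1), of g] by (simp add: comp_def)
  moreover have "vtyp P (rename g \<Gamma> + image_mset (Pair (g (\<rho> u))) D) (\<lambda>v. g (\<rho> v)) S"
    using Out.IH[OF *(4), of g] by simp
  ultimately show ?case using *(2,3) unfolding vtyp.simps by blast
next
  case (Inp u xs P)
  then obtain \<Gamma> Ts a D where *: "\<Delta> \<leadsto> \<Gamma> + {#(\<rho> u, ChT Ts a)#}"
    "length xs = length Ts" "distinct xs" "decrement Ts a = Some D"
    "binds (map Vr xs) Ts (\<lambda>\<Delta> \<rho>. vtyp P \<Delta> \<rho> S) (\<Gamma> + image_mset (Pair (\<rho> u)) D) \<rho>"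
    by auto
  have "rename g \<Delta> \<leadsto> rename g \<Gamma> + {#(g (\<rho> u), ChT Ts a)#}"
    using reaches_rename[OF *(1), of g] by simp
  moreover have "binds (map Vr xs) Ts (\<lambda>\<Delta> \<rho>. vtyp P \<Delta> \<rho> S)
      (rename g \<Gamma> + image_mset (Pair (g (\<rho> u))) D) (\<lambda>v. g (\<rho> v))"
    using binds_rename[OF Inp.IH *(5), of g] by simp
  ultimately show ?case using *(2-4) unfolding vtyp.simps by blast
next
  case (If u v P Q)
  then show ?case by auto
next
  case (Rec X P)
  then obtain \<Gamma> where "\<Delta> \<leadsto> \<Gamma>" "unr_env \<Gamma>" "vtyp P \<Gamma> \<rho> (insert X S)" by auto
  then have "rename g \<Delta> \<leadsto> rename g \<Gamma>" "unr_env (rename g \<Gamma>)"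
    "vtyp P (rename g \<Gamma>) (\<lambda>v. g (\<rho> v)) (insert X S)"
    using Rec.IH reaches_rename[of \<Delta> \<Gamma> g] by (simp_all, simp add: rename_def)
  then show ?case by auto
next
  case (Par P Q)
  then obtain \<Gamma>1 \<Gamma>2 where "\<Delta> \<leadsto> \<Gamma>1 + \<Gamma>2" "vtyp P \<Gamma>1 \<rho> S" "vtyp Q \<Gamma>2 \<rho> S" by auto
  then have "rename g \<Delta> \<leadsto> rename g \<Gamma>1 + rename g \<Gamma>2" "vtyp P (rename g \<Gamma>1) (\<lambda>v. g (\<rho> v)) S"
    "vtyp Q (rename g \<Gamma>2) (\<lambda>v. g (\<rho> v)) S"
    using Par.IH reaches_rename[of \<Delta> "\<Gamma>1 + \<Gamma>2" g] by auto
  then show ?case unfolding vtyp.simps by blast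
next
  case (Res c s P)
  then show ?case unfolding vtyp.simps using binds_rename[OF Res.IH] by blast
next
  case (Alloc x P)
  then show ?case unfolding vtyp.simps using binds_rename[OF Alloc.IH] by blast
next
  case (Free u P)
  then obtain \<Gamma> Ts where "\<Delta> \<leadsto> \<Gamma> + {#(\<rho> u, ChT Ts (Uniq 0))#}" "vtyp P \<Gamma> \<rho> S" by auto
  then have "rename g \<Delta> \<leadsto> rename g \<Gamma> + {#(g (\<rho> u), ChT Ts (Uniq 0))#}" "vtyp P (rename g \<Gamma>) (\<lambda>v. g (\<rho> v)) S"
    using Free.IH reaches_rename[of \<Delta> _ g] by fastforce+
  then show ?case unfolding vtyp.simps by blast
qed auto

text \<open>A body typed at one fresh choice of keys is typed at every choice; this is why the universal
  quantifier in \<^const>\<open>binds\<close> loses nothing.\<close>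

lemma binds_fresh:
  assumes "vtyp P (\<Gamma> + mset (zip ks Ts)) (assign \<rho> vs ks) S"
    and "distinct ks" "length ks = length vs" "set ks \<inter> keys \<Gamma> = {}"
      "set ks \<inter> \<rho> ` (fids P - set vs) = {}"
  shows "binds vs Ts (\<lambda>\<Delta> \<rho>. vtyp P \<Delta> \<rho> S) \<Gamma> \<rho>"
  using rename_body[OF vtyp_rename assms, of _ id] unfolding binds_def by simp

abbreviation restrict_keys :: "ident set \<Rightarrow> idenv \<Rightarrow> idenv" where
  "restrict_keys K \<Delta> \<equiv> filter_mset (\<lambda>x. fst x \<in> K) \<Delta>"

lemma restrict_keys_ident: "keys \<Delta> \<subseteq> K \<Longrightarrow> restrict_keys K \<Delta> = \<Delta>"
  by (auto simp: filter_mset_eq_conv)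

lemma restrict_keys_empty: "keys \<Delta> \<inter> K = {} \<Longrightarrow> restrict_keys K \<Delta> = {#}"
  by (auto simp: filter_mset_eq_conv)

lemma restrict_keys_split: "\<Delta> = restrict_keys (- {u}) \<Delta> + restrict_keys {u} \<Delta>"
  using multiset_partition[of \<Delta> "\<lambda>x. fst x \<in> {u}"] by (simp add: add.commute)

lemma keys_mset_zip: "keys (mset (zip ks Ts)) \<subseteq> set ks"
  by (auto dest: set_zip_leftD)

lemma restrict_keys_mset_zip: "set ks \<subseteq> K \<Longrightarrow> restrict_keys K (mset (zip ks Ts)) = mset (zip ks Ts)"
  using keys_mset_zip[of ks Ts] by (intro restrict_keys_ident) auto

lemma restrict_keys_Pair: "u \<in> K \<Longrightarrow> restrict_keys K (image_mset (Pair u) M) = image_mset (Pair u) M"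
  by (rule restrict_keys_ident) auto

lemma assign_range: "length ks = length vs \<Longrightarrow> assign \<rho> vs ks v \<in> (if v \<in> set vs then set ks else {\<rho> v})"
  by (induction ks vs rule: list_induct2) auto

text \<open>At fresh keys, restricting to \<open>K\<close> together with \<open>ks\<close> keeps the
  new assumptions and removes from \<open>\<Gamma>\<close> exactly what restricting to
  \<open>K\<close> removes. At keys that clash with \<open>\<Gamma>\<close> it could keep more.
  \<open>binds_fresh\<close> then returns to arbitrary keys.\<close>

lemma binds_strengthen:
  assumes IH: "\<And>\<Delta> \<rho> K. vtyp P \<Delta> \<rho> S \<Longrightarrow> \<rho> ` fids P \<subseteq> K \<Longrightarrow> vtyp P (restrict_keys K \<Delta>) \<rho> S"
    and "binds vs Ts (\<lambda>\<Delta> \<rho>. vtyp P \<Delta> \<rho> S) \<Gamma> \<rho>" and K: "\<rho> ` (fids P - set vs) \<subseteq> K"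
  shows "binds vs Ts (\<lambda>\<Delta> \<rho>. vtyp P \<Delta> \<rho> S) (restrict_keys K \<Gamma>) \<rho>"
proof -
  obtain ks where ks: "length ks = length vs" "distinct ks" "set ks \<inter> (keys \<Gamma> \<union> \<rho> ` fids P) = {}"
    using fresh_idents[of "keys \<Gamma> \<union> \<rho> ` fids P"] by auto
  have "vtyp P (\<Gamma> + mset (zip ks Ts)) (assign \<rho> vs ks) S"
    using assms(2) ks unfolding binds_def by auto
  moreover have "assign \<rho> vs ks ` fids P \<subseteq> K \<union> set ks"
    using assign_range[OF ks(1), of \<rho>] K by (fastforce split: if_splits)
  ultimately have "vtyp P (restrict_keys (K \<union> set ks) (\<Gamma> + mset (zip ks Ts))) (assign \<rho> vs ks) S"
    by (rule IH)
  moreover have "restrict_keys (K \<union> set ks) \<Gamma> = restrict_keys K \<Gamma>"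
    by (rule filter_mset_cong) (use ks in auto)
  ultimately have "vtyp P (restrict_keys K \<Gamma> + mset (zip ks Ts)) (assign \<rho> vs ks) S"
    using restrict_keys_mset_zip[of ks "K \<union> set ks" Ts] by (simp only: filter_union_mset Un_upper2)
  then show ?thesis by (rule binds_fresh) (use ks in auto)
qed

text \<open>Each structural step acts at a single key, so filtering by keys commutes with
  \<open>reaches\<close>. Strengthening is needed to undo scope extrusion and, on the way back to
  \<open>rtyp\<close>, to make bound identifiers fresh.\<close>

lemma vtyp_strengthen:
  "vtyp P \<Delta> \<rho> S \<Longrightarrow> \<rho> ` fids P \<subseteq> K \<Longrightarrow> vtyp P (restrict_keys K \<Delta>) \<rho> S"
proof (induction P arbitrary: \<Delta> \<rho> S K)
  case (Out u vs P)
  then obtain \<Gamma> Ts a D where *: "\<Delta> \<leadsto> \<Gamma> + {#(\<rho> u, ChT Ts a)#} + mset (zip (map \<rho> vs) Ts)"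
    "length vs = length Ts" "decrement Ts a = Some D" "vtyp P (\<Gamma> + image_mset (Pair (\<rho> u)) D) \<rho> S"
    by auto
  have K: "\<rho> u \<in> K" "set (map \<rho> vs) \<subseteq> K" "\<rho> ` fids P \<subseteq> K" using Out.prems(2) by auto
  have "restrict_keys K \<Delta> \<leadsto> restrict_keys K \<Gamma> + {#(\<rho> u, ChT Ts a)#} + mset (zip (map \<rho> vs) Ts)"
    using reaches_filter_keys[OF *(1), of K] K by (simp add: restrict_keys_mset_zip)
  moreover have "vtyp P (restrict_keys K \<Gamma> + image_mset (Pair (\<rho> u)) D) \<rho> S"
    using Out.IH[OF *(4) K(3)] K by (simp add: restrict_keys_Pair)
  ultimately show ?case using *(2,3) unfolding vtyp.simps by blast
next
  case (Inp u xs P)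
  then obtain \<Gamma> Ts a D where *: "\<Delta> \<leadsto> \<Gamma> + {#(\<rho> u, ChT Ts a)#}"
    "length xs = length Ts" "distinct xs" "decrement Ts a = Some D"
    "binds (map Vr xs) Ts (\<lambda>\<Delta> \<rho>. vtyp P \<Delta> \<rho> S) (\<Gamma> + image_mset (Pair (\<rho> u)) D) \<rho>"
    by auto
  have K: "\<rho> u \<in> K" "\<rho> ` (fids P - set (map Vr xs)) \<subseteq> K" using Inp.prems(2) by auto
  have "restrict_keys K \<Delta> \<leadsto> restrict_keys K \<Gamma> + {#(\<rho> u, ChT Ts a)#}"
    using reaches_filter_keys[OF *(1), of K] K by simp
  moreover have "binds (map Vr xs) Ts (\<lambda>\<Delta> \<rho>. vtyp P \<Delta> \<rho> S)
      (restrict_keys K \<Gamma> + image_mset (Pair (\<rho> u)) D) \<rho>"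
    using binds_strengthen[OF Inp.IH *(5) K(2)] K by (simp add: restrict_keys_Pair)
  ultimately show ?case using *(2-4) unfolding vtyp.simps by blast
next
  case (If u v P Q)
  have "vtyp P (restrict_keys K \<Delta>) \<rho> S" by (rule If.IH(1)) (use If.prems in auto)
  moreover have "vtyp Q (restrict_keys K \<Delta>) \<rho> S" by (rule If.IH(2)) (use If.prems in auto)
  ultimately show ?case using If.prems by auto
next
  case (Rec X P)
  then obtain \<Gamma> where "\<Delta> \<leadsto> \<Gamma>" "unr_env \<Gamma>" "vtyp P \<Gamma> \<rho> (insert X S)" by auto
  then have "restrict_keys K \<Delta> \<leadsto> restrict_keys K \<Gamma>" "unr_env (restrict_keys K \<Gamma>)"
    "vtyp P (restrict_keys K \<Gamma>) \<rho> (insert X S)"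
    using Rec.IH Rec.prems(2) by (auto intro: reaches_filter_keys)
  then show ?case by auto
next
  case (Par P Q)
  then obtain \<Gamma>1 \<Gamma>2 where "\<Delta> \<leadsto> \<Gamma>1 + \<Gamma>2" "vtyp P \<Gamma>1 \<rho> S" "vtyp Q \<Gamma>2 \<rho> S" by auto
  then have "restrict_keys K \<Delta> \<leadsto> restrict_keys K \<Gamma>1 + restrict_keys K \<Gamma>2"
    "vtyp P (restrict_keys K \<Gamma>1) \<rho> S" "vtyp Q (restrict_keys K \<Gamma>2) \<rho> S"
    using Par.IH Par.prems(2) reaches_filter_keys[of \<Delta> "\<Gamma>1 + \<Gamma>2" K] by (auto simp: image_Un)
  then show ?case unfolding vtyp.simps by blast
next
  case (Res c s P)
  then obtain T where "binds [Ch c] (res_tys s T) (\<lambda>\<Delta> \<rho>. vtyp P \<Delta> \<rho> S) \<Delta> \<rho>" by auto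
  then have "binds [Ch c] (res_tys s T) (\<lambda>\<Delta> \<rho>. vtyp P \<Delta> \<rho> S) (restrict_keys K \<Delta>) \<rho>"
    by (rule binds_strengthen[rotated]) (use Res.prems(2) in auto, rule Res.IH)
  then show ?case by auto
next
  case (Alloc x P)
  then obtain Ts where "binds [Vr x] [ChT Ts (Uniq 0)] (\<lambda>\<Delta> \<rho>. vtyp P \<Delta> \<rho> S) \<Delta> \<rho>" by auto
  then have "binds [Vr x] [ChT Ts (Uniq 0)] (\<lambda>\<Delta> \<rho>. vtyp P \<Delta> \<rho> S) (restrict_keys K \<Delta>) \<rho>"
    by (rule binds_strengthen[rotated]) (use Alloc.prems(2) in auto, rule Alloc.IH)
  then show ?case by auto
next
  case (Free u P)
  then obtain \<Gamma> Ts where *: "\<Delta> \<leadsto> \<Gamma> + {#(\<rho> u, ChT Ts (Uniq 0))#}" "vtyp P \<Gamma> \<rho> S" by auto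
  have "restrict_keys K \<Delta> \<leadsto> restrict_keys K \<Gamma> + {#(\<rho> u, ChT Ts (Uniq 0))#}"
    using reaches_filter_keys[OF *(1), of K] Free.prems(2) by simp
  moreover have "vtyp P (restrict_keys K \<Gamma>) \<rho> S"
    using Free.IH[OF *(2)] Free.prems(2) by simp
  ultimately show ?case unfolding vtyp.simps by blast
qed auto

section \<open>Substitution and structural congruence\<close>

lemma vtyp_chren: "d \<notin> bnch P \<Longrightarrow> vtyp (chren c d P) \<Delta> \<rho> S = vtyp P \<Delta> (\<lambda>v. \<rho> (chr c d v)) S"
proof (induction P arbitrary: \<Delta> \<rho> S)
  case (Inp u xs P)
  have "binds (map Vr xs) Ts (\<lambda>\<Delta> \<rho>. vtyp (chren c d P) \<Delta> \<rho> S) \<Gamma> \<rho> =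
      binds (map Vr xs) Ts (\<lambda>\<Delta> \<rho>. vtyp P \<Delta> \<rho> S) \<Gamma> (\<lambda>v. \<rho> (chr c d v))" for Ts \<Gamma>
  proof (rule binds_cong)
    fix \<Delta> and ks :: "ident list" assume ks: "length ks = length (map Vr xs)"
    have "(\<lambda>v. assign \<rho> (map Vr xs) ks (chr c d v)) = assign (\<lambda>v. \<rho> (chr c d v)) (map Vr xs) ks"
    proof
      fix v
      show "assign \<rho> (map Vr xs) ks (chr c d v) = assign (\<lambda>v. \<rho> (chr c d v)) (map Vr xs) ks v"
      proof (cases "v = Ch c")
        case True
        then have "v \<notin> set (map Vr xs)" "Ch d \<notin> set (map Vr xs)" by auto
        with True show ?thesis by (simp add: assign_notin chr_def)
      next
        case False
        then show ?thesis using ks by (auto simp: chr_def intro!: assign_cong)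
      qed
    qed
    moreover have "vtyp (chren c d P) \<Delta> \<rho>' S = vtyp P \<Delta> (\<lambda>v. \<rho>' (chr c d v)) S" for \<rho>'
      by (rule Inp.IH) (use Inp.prems in auto)
    ultimately show "vtyp (chren c d P) \<Delta> (assign \<rho> (map Vr xs) ks) S = vtyp P \<Delta> (assign (\<lambda>v. \<rho> (chr c d v)) (map Vr xs) ks) S"
      by (simp only:)
  qed
  then show ?case by simp
next
  case (Res c' s P)
  have "binds [Ch c'] Ts (\<lambda>\<Delta> \<rho>. vtyp (if c' = c then P else chren c d P) \<Delta> \<rho> S) \<Gamma> \<rho> =
      binds [Ch c'] Ts (\<lambda>\<Delta> \<rho>. vtyp P \<Delta> \<rho> S) \<Gamma> (\<lambda>v. \<rho> (chr c d v))" for Ts \<Gamma>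
  proof (rule binds_cong)
    fix \<Delta> and ks :: "ident list" assume "length ks = length [Ch c']"
    then obtain k where k: "ks = [k]" by (auto simp: length_Suc_conv)
    show "vtyp (if c' = c then P else chren c d P) \<Delta> (assign \<rho> [Ch c'] ks) S =
        vtyp P \<Delta> (assign (\<lambda>v. \<rho> (chr c d v)) [Ch c'] ks) S"
    \<comment> \<open>For an inner binder of \<open>c\<close> the renaming stops, and the update at
      \<open>c\<close> hides the effect of \<open>chr\<close>. Otherwise \<open>c'\<close> also
      differs from \<open>d\<close>, so the update at \<open>c'\<close> is never read through
      \<open>chr\<close>.\<close>
    proof (cases "c' = c")
      case True
      then have "assign \<rho> [Ch c'] ks = assign (\<lambda>v. \<rho> (chr c d v)) [Ch c'] ks"
        using k by (auto simp: chr_def fun_eq_iff)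
      with True show ?thesis by simp
    next
      case False
      then have "(\<lambda>v. assign \<rho> [Ch c'] ks (chr c d v)) = assign (\<lambda>v. \<rho> (chr c d v)) [Ch c'] ks"
        using k Res.prems by (auto simp: chr_def fun_eq_iff)
      moreover have "vtyp (chren c d P) \<Delta> \<rho>' S = vtyp P \<Delta> (\<lambda>v. \<rho>' (chr c d v)) S" for \<rho>'
        by (rule Res.IH) (use Res.prems in auto)
      ultimately show ?thesis using False by (simp only: if_False)
    qed
  qed
  then show ?case by (cases "c' = c") auto
next
  case (Alloc x P)
  have "binds [Vr x] Ts (\<lambda>\<Delta> \<rho>. vtyp (chren c d P) \<Delta> \<rho> S) \<Gamma> \<rho> =
      binds [Vr x] Ts (\<lambda>\<Delta> \<rho>. vtyp P \<Delta> \<rho> S) \<Gamma> (\<lambda>v. \<rho> (chr c d v))" for Ts \<Gamma>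
  proof (rule binds_cong)
    fix \<Delta> and ks :: "ident list" assume "length ks = length [Vr x]"
    then obtain k where k: "ks = [k]" by (auto simp: length_Suc_conv)
    then have "(\<lambda>v. assign \<rho> [Vr x] ks (chr c d v)) = assign (\<lambda>v. \<rho> (chr c d v)) [Vr x] ks"
      by (auto simp: chr_def fun_eq_iff)
    moreover have "vtyp (chren c d P) \<Delta> \<rho>' S = vtyp P \<Delta> (\<lambda>v. \<rho>' (chr c d v)) S" for \<rho>'
      by (rule Alloc.IH) (use Alloc.prems in auto)
    ultimately show "vtyp (chren c d P) \<Delta> (assign \<rho> [Vr x] ks) S = vtyp P \<Delta> (assign (\<lambda>v. \<rho> (chr c d v)) [Vr x] ks) S"
      by (simp only:)
  qed
  then show ?case by simp
qed (auto simp: comp_def)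

lemma assign_isu:
  assumes "length ks = length vs" "\<And>x. Vr x \<in> set vs \<Longrightarrow> f' x = None" "\<And>x. Vr x \<notin> set vs \<Longrightarrow> f' x = f x"
    and "ran f \<inter> set vs = {}"
  shows "(\<lambda>v. assign \<rho> vs ks (isu f' v)) = assign (\<lambda>v. \<rho> (isu f v)) vs ks"
proof
  fix v
  show "assign \<rho> vs ks (isu f' v) = assign (\<lambda>v. \<rho> (isu f v)) vs ks v"
  proof (cases "v \<in> set vs")
    case True
    then have "isu f' v = v" using assms(2) by (cases v rule: ident.exhaust) auto
    then show ?thesis using True assms(1) by (simp only:) (rule assign_cong, auto)
  next
    case False
    then have "isu f' v = isu f v" "isu f v \<notin> set vs"
      using assms(3,4) by (cases v; auto simp: ran_def split: option.splits)+
    then show ?thesis using False by (simp add: assign_notin)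
  qed
qed

lemma vtyp_isubst: "ran f \<inter> bids P = {} \<Longrightarrow> vtyp (isubst f P) \<Delta> \<rho> S = vtyp P \<Delta> (\<lambda>v. \<rho> (isu f v)) S"
proof (induction P arbitrary: \<Delta> \<rho> S f)
  case (Inp u xs P)
  let ?f = "\<lambda>y. if y \<in> set xs then None else f y"
  have "ran ?f \<subseteq> ran f" by (auto simp: ran_def)
  with Inp.prems have r: "ran ?f \<inter> bids P = {}" by auto
  have "binds (map Vr xs) Ts (\<lambda>\<Delta> \<rho>. vtyp (isubst ?f P) \<Delta> \<rho> S) \<Gamma> \<rho> =
      binds (map Vr xs) Ts (\<lambda>\<Delta> \<rho>. vtyp P \<Delta> \<rho> S) \<Gamma> (\<lambda>v. \<rho> (isu f v))" for Ts \<Gamma>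
  proof (rule binds_cong)
    fix \<Delta> and ks :: "ident list" assume ks: "length ks = length (map Vr xs)"
    have "(\<lambda>v. assign \<rho> (map Vr xs) ks (isu ?f v)) = assign (\<lambda>v. \<rho> (isu f v)) (map Vr xs) ks"
      by (rule assign_isu) (use ks Inp.prems in auto)
    then show "vtyp (isubst ?f P) \<Delta> (assign \<rho> (map Vr xs) ks) S =
        vtyp P \<Delta> (assign (\<lambda>v. \<rho> (isu f v)) (map Vr xs) ks) S"
      using Inp.IH[OF r, of \<Delta> "assign \<rho> (map Vr xs) ks" S] by (simp only:)
  qed
  then show ?case by simp
next
  case (Res c s P)
  have "binds [Ch c] Ts (\<lambda>\<Delta> \<rho>. vtyp (isubst f P) \<Delta> \<rho> S) \<Gamma> \<rho> =
      binds [Ch c] Ts (\<lambda>\<Delta> \<rho>. vtyp P \<Delta> \<rho> S) \<Gamma> (\<lambda>v. \<rho> (isu f v))" for Ts \<Gamma>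
  proof (rule binds_cong)
    fix \<Delta> and ks :: "ident list" assume ks: "length ks = length [Ch c]"
    have "(\<lambda>v. assign \<rho> [Ch c] ks (isu f v)) = assign (\<lambda>v. \<rho> (isu f v)) [Ch c] ks"
      by (rule assign_isu) (use ks Res.prems in auto)
    moreover have "vtyp (isubst f P) \<Delta> (assign \<rho> [Ch c] ks) S = vtyp P \<Delta> (\<lambda>v. assign \<rho> [Ch c] ks (isu f v)) S"
      by (rule Res.IH) (use Res.prems in auto)
    ultimately show "vtyp (isubst f P) \<Delta> (assign \<rho> [Ch c] ks) S = vtyp P \<Delta> (assign (\<lambda>v. \<rho> (isu f v)) [Ch c] ks) S"
      by (simp only:)
  qed
  then show ?case by simp
next
  case (Alloc x P)
  have "ran (f(x := None)) \<subseteq> ran f" by (auto simp: ran_def)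
  with Alloc.prems have r: "ran (f(x := None)) \<inter> bids P = {}" by auto
  have "binds [Vr x] Ts (\<lambda>\<Delta> \<rho>. vtyp (isubst (f(x := None)) P) \<Delta> \<rho> S) \<Gamma> \<rho> =
      binds [Vr x] Ts (\<lambda>\<Delta> \<rho>. vtyp P \<Delta> \<rho> S) \<Gamma> (\<lambda>v. \<rho> (isu f v))" for Ts \<Gamma>
  proof (rule binds_cong)
    fix \<Delta> and ks :: "ident list" assume ks: "length ks = length [Vr x]"
    have "(\<lambda>v. assign \<rho> [Vr x] ks (isu (f(x := None)) v)) = assign (\<lambda>v. \<rho> (isu f v)) [Vr x] ks"
      by (rule assign_isu) (use ks Alloc.prems in auto)
    then show "vtyp (isubst (f(x := None)) P) \<Delta> (assign \<rho> [Vr x] ks) S =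
        vtyp P \<Delta> (assign (\<lambda>v. \<rho> (isu f v)) [Vr x] ks) S"
      using Alloc.IH[OF r, of \<Delta> "assign \<rho> [Vr x] ks" S] by (simp only:)
  qed
  then show ?case by simp
qed (auto simp: comp_def Int_Un_distrib)

text \<open>Process variables have no valuation, so their renaming acts on the set of available
  ones: the set on the right is the preimage of \<open>S\<close> under the map sending
  \<open>X\<close> to \<open>Y\<close>.\<close>

lemma vtyp_psub_PV:
  "Y \<notin> bpv P \<Longrightarrow> vtyp (psub X (PV Y) P) \<Delta> \<rho> S = vtyp P \<Delta> \<rho> {Z. (if Z = X then Y else Z) \<in> S}"
proof (induction P arbitrary: \<Delta> \<rho> S)
  case (Rec Z P)
  have "{W. (if W = X then Y else W) \<in> insert Z S} = insert Z {W. (if W = X then Y else W) \<in> S}"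
    if "Z \<noteq> X" using that Rec.prems by auto
  moreover have "insert X S = insert X {W. (if W = X then Y else W) \<in> S}" by auto
  ultimately show ?case using Rec by simp
qed auto

text \<open>The assumptions \<open>\<Gamma>u\<close> of the substituted process travel through the
  whole derivation and are duplicated at each parallel composition, which their being unrestricted
  allows. The conditions on bound names exclude capture, so \<open>R\<close> keeps its typing when a
  binder updates the valuation or extends \<open>S\<close>.\<close>

lemma vtyp_psub:
  assumes "unr_env \<Gamma>u"
  shows "vtyp P \<Delta> \<rho> (insert X S) \<Longrightarrow> vtyp R \<Gamma>u \<rho> S \<Longrightarrow> bids P \<inter> fids R = {} \<Longrightarrow>
    bpv P \<inter> fpv R = {} \<Longrightarrow> vtyp (psub X R P) (\<Delta> + \<Gamma>u) \<rho> S"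
proof (induction P arbitrary: \<Delta> \<rho> S)
  case (Out u vs P)
  then obtain \<Gamma> Ts a D where *: "\<Delta> \<leadsto> \<Gamma> + {#(\<rho> u, ChT Ts a)#} + mset (zip (map \<rho> vs) Ts)"
    "length vs = length Ts" "decrement Ts a = Some D"
    "vtyp P (\<Gamma> + image_mset (Pair (\<rho> u)) D) \<rho> (insert X S)"
    by auto
  have "\<Delta> + \<Gamma>u \<leadsto> (\<Gamma> + \<Gamma>u) + {#(\<rho> u, ChT Ts a)#} + mset (zip (map \<rho> vs) Ts)"
    using reaches_add_right[OF *(1), of \<Gamma>u] by (simp add: ac_simps)
  moreover have "vtyp (psub X R P) ((\<Gamma> + \<Gamma>u) + image_mset (Pair (\<rho> u)) D) \<rho> S"
    using Out.IH[OF *(4)] Out.prems by (simp add: ac_simps)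
  ultimately show ?case using *(2,3) unfolding vtyp.simps psub.simps by blast
next
  case (Inp u xs P)
  then obtain \<Gamma> Ts a D where *: "\<Delta> \<leadsto> \<Gamma> + {#(\<rho> u, ChT Ts a)#}"
    "length xs = length Ts" "distinct xs" "decrement Ts a = Some D"
    "binds (map Vr xs) Ts (\<lambda>\<Delta> \<rho>. vtyp P \<Delta> \<rho> (insert X S)) (\<Gamma> + image_mset (Pair (\<rho> u)) D) \<rho>"
    by auto
  have "\<Delta> + \<Gamma>u \<leadsto> (\<Gamma> + \<Gamma>u) + {#(\<rho> u, ChT Ts a)#}"
    using reaches_add_right[OF *(1), of \<Gamma>u] by (simp add: ac_simps)
  moreover have "binds (map Vr xs) Ts (\<lambda>\<Delta> \<rho>. vtyp (psub X R P) \<Delta> \<rho> S)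
      ((\<Gamma> + \<Gamma>u) + image_mset (Pair (\<rho> u)) D) \<rho>"
    unfolding binds_def
  proof (intro allI impI)
    fix ks :: "ident list" assume ks: "length ks = length (map Vr xs)"
    have "vtyp R \<Gamma>u (assign \<rho> (map Vr xs) ks) S = vtyp R \<Gamma>u \<rho> S"
      by (rule vtyp_cong) (use Inp.prems in \<open>auto intro!: assign_notin\<close>)
    then have "vtyp (psub X R P) (\<Gamma> + image_mset (Pair (\<rho> u)) D + mset (zip ks Ts) + \<Gamma>u)
        (assign \<rho> (map Vr xs) ks) S"
      using *(5) ks Inp.prems unfolding binds_def by (intro Inp.IH) auto
    then show "vtyp (psub X R P) (\<Gamma> + \<Gamma>u + image_mset (Pair (\<rho> u)) D + mset (zip ks Ts))
        (assign \<rho> (map Vr xs) ks) S" by (simp add: ac_simps)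
  qed
  ultimately show ?case using *(2-4) unfolding vtyp.simps psub.simps by blast
next
  case (If u v P Q)
  have "vtyp (psub X R P) (\<Delta> + \<Gamma>u) \<rho> S" "vtyp (psub X R Q) (\<Delta> + \<Gamma>u) \<rho> S"
    by (rule If.IH; use If.prems in \<open>auto simp: Int_Un_distrib2\<close>)+
  then show ?case using If.prems by auto
next
  case (Rec Y P)
  then obtain \<Gamma> where *: "\<Delta> \<leadsto> \<Gamma>" "unr_env \<Gamma>" "vtyp P \<Gamma> \<rho> (insert Y (insert X S))" by auto
  show ?case
  proof (cases "Y = X")
    \<comment> \<open>The inner recursion shadows \<open>X\<close>: nothing is substituted and
      \<open>\<Gamma>u\<close> is mere weakening.\<close>
    case True
    then have "vtyp (Rec Y P) \<Delta> \<rho> S" using * by auto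
    then show ?thesis using True vtyp_weaken[of "Rec Y P" \<Delta> \<rho> S \<Gamma>u] by (simp only: psub.simps simp_thms if_True)
  next
    case False
    have "vtyp R \<Gamma>u \<rho> (insert Y S) = vtyp R \<Gamma>u \<rho> S"
      by (rule vtyp_cong) (use Rec.prems in auto)
    then have "vtyp (psub X R P) (\<Gamma> + \<Gamma>u) \<rho> (insert Y S)"
      using * Rec.prems by (intro Rec.IH) (auto simp: insert_commute)
    moreover have "\<Delta> + \<Gamma>u \<leadsto> \<Gamma> + \<Gamma>u" "unr_env (\<Gamma> + \<Gamma>u)"
      using * assms reaches_add_right by auto
    ultimately show ?thesis using False by (simp only: vtyp.simps psub.simps if_False) blast
  qed
next
  case (PV Y)
  then show ?case using vtyp_reaches[of R \<Gamma>u \<rho> S "\<Delta> + \<Gamma>u"] reaches_weaken_left by auto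
next
  case (Par P Q)
  then obtain \<Gamma>1 \<Gamma>2 where *: "\<Delta> \<leadsto> \<Gamma>1 + \<Gamma>2" "vtyp P \<Gamma>1 \<rho> (insert X S)" "vtyp Q \<Gamma>2 \<rho> (insert X S)" by auto
  have "vtyp (psub X R P) (\<Gamma>1 + \<Gamma>u) \<rho> S" "vtyp (psub X R Q) (\<Gamma>2 + \<Gamma>u) \<rho> S"
    by (rule Par.IH; use Par.prems * in \<open>auto simp: Int_Un_distrib2\<close>)+
  moreover have "\<Delta> + \<Gamma>u \<leadsto> (\<Gamma>1 + \<Gamma>u) + (\<Gamma>2 + \<Gamma>u)"
    using reaches_add[OF *(1) reaches_contract[OF assms]] by (simp add: ac_simps)
  ultimately show ?case unfolding vtyp.simps psub.simps by blast
next
  case (Res c s P)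
  then obtain T where T: "binds [Ch c] (res_tys s T) (\<lambda>\<Delta> \<rho>. vtyp P \<Delta> \<rho> (insert X S)) \<Delta> \<rho>" by auto
  have "binds [Ch c] (res_tys s T) (\<lambda>\<Delta> \<rho>. vtyp (psub X R P) \<Delta> \<rho> S) (\<Delta> + \<Gamma>u) \<rho>"
    unfolding binds_def
  proof (intro allI impI)
    fix ks :: "ident list" assume ks: "length ks = length [Ch c]"
    have "vtyp R \<Gamma>u (assign \<rho> [Ch c] ks) S = vtyp R \<Gamma>u \<rho> S"
      by (rule vtyp_cong) (use Res.prems in \<open>auto intro!: assign_notin\<close>)
    then have "vtyp (psub X R P) (\<Delta> + mset (zip ks (res_tys s T)) + \<Gamma>u) (assign \<rho> [Ch c] ks) S"
      using T ks Res.prems unfolding binds_def by (intro Res.IH) auto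
    then show "vtyp (psub X R P) (\<Delta> + \<Gamma>u + mset (zip ks (res_tys s T))) (assign \<rho> [Ch c] ks) S"
      by (simp add: ac_simps)
  qed
  then show ?case by auto
next
  case (Alloc x P)
  then obtain Ts where T: "binds [Vr x] [ChT Ts (Uniq 0)] (\<lambda>\<Delta> \<rho>. vtyp P \<Delta> \<rho> (insert X S)) \<Delta> \<rho>" by auto
  have "binds [Vr x] [ChT Ts (Uniq 0)] (\<lambda>\<Delta> \<rho>. vtyp (psub X R P) \<Delta> \<rho> S) (\<Delta> + \<Gamma>u) \<rho>"
    unfolding binds_def
  proof (intro allI impI)
    fix ks :: "ident list" assume ks: "length ks = length [Vr x]"
    have "vtyp R \<Gamma>u (assign \<rho> [Vr x] ks) S = vtyp R \<Gamma>u \<rho> S"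
      by (rule vtyp_cong) (use Alloc.prems in \<open>auto intro!: assign_notin\<close>)
    then have "vtyp (psub X R P) (\<Delta> + mset (zip ks [ChT Ts (Uniq 0)]) + \<Gamma>u) (assign \<rho> [Vr x] ks) S"
      using T ks Alloc.prems unfolding binds_def by (intro Alloc.IH) auto
    then show "vtyp (psub X R P) (\<Delta> + \<Gamma>u + mset (zip ks [ChT Ts (Uniq 0)])) (assign \<rho> [Vr x] ks) S"
      by (simp add: ac_simps)
  qed
  then show ?case by auto
next
  case (Free u P)
  then obtain \<Gamma> Ts where *: "\<Delta> \<leadsto> \<Gamma> + {#(\<rho> u, ChT Ts (Uniq 0))#}" "vtyp P \<Gamma> \<rho> (insert X S)" by auto
  have "\<Delta> + \<Gamma>u \<leadsto> (\<Gamma> + \<Gamma>u) + {#(\<rho> u, ChT Ts (Uniq 0))#}"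
    using reaches_add_right[OF *(1), of \<Gamma>u] by (simp add: ac_simps)
  moreover have "vtyp (psub X R P) (\<Gamma> + \<Gamma>u) \<rho> S" using Free *(2) by auto
  ultimately show ?case unfolding vtyp.simps psub.simps by blast
qed auto

lemma isu_map_of: "length vs = length xs \<Longrightarrow> isu (map_of (zip xs vs)) v = assign id (map Vr xs) vs v"
proof (induction vs xs rule: list_induct2)
  case Nil
  then show ?case by (cases v) auto
next
  case (Cons w vs x xs)
  then show ?case by (cases v) auto
qed

lemma assign_isu_map_of:
  assumes "length ks = length xs" "length ys = length xs" "distinct ys" "v \<notin> Vr ` set ys"
  shows "assign \<rho> (map Vr ys) ks (isu (map_of (zip xs (map Vr ys))) v) = assign \<rho> (map Vr xs) ks v"
  using assms assign_assign[of "map Vr ys" "map Vr xs" ks v id \<rho>]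
  by (auto simp: isu_map_of distinct_map inj_on_def)

lemma ran_map_of_zip: "ran (map_of (zip xs vs)) \<subseteq> set vs"
  by (auto simp: ran_def dest!: map_of_SomeD set_zip_rightD)

lemma binds_isubst:
  assumes "distinct ys" "length ys = length xs" "set ys \<inter> (fv P \<union> bv P) = {}"
  shows "binds (map Vr ys) Ts (\<lambda>\<Delta> \<rho>. vtyp (isubst (map_of (zip xs (map Vr ys))) P) \<Delta> \<rho> S) \<Gamma> \<rho> =
    binds (map Vr xs) Ts (\<lambda>\<Delta> \<rho>. vtyp P \<Delta> \<rho> S) \<Gamma> \<rho>"
proof (rule binds_cong_idents)
  fix \<Delta> and ks :: "ident list" assume ks: "length ks = length (map Vr ys)"
  let ?f = "map_of (zip xs (map Vr ys))"
  have "ran ?f \<inter> bids P = {}"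
    using ran_map_of_zip[of xs "map Vr ys"] assms(3) by (auto simp: bids_def)
  then have "vtyp (isubst ?f P) \<Delta> (assign \<rho> (map Vr ys) ks) S =
      vtyp P \<Delta> (\<lambda>v. assign \<rho> (map Vr ys) ks (isu ?f v)) S"
    by (rule vtyp_isubst)
  also have "\<dots> = vtyp P \<Delta> (assign \<rho> (map Vr xs) ks) S"
  proof (rule vtyp_cong)
    fix v assume "v \<in> fids P"
    then have "v \<notin> Vr ` set ys" using assms(3) by (auto simp: fids_def)
    then show "assign \<rho> (map Vr ys) ks (isu ?f v) = assign \<rho> (map Vr xs) ks v"
      using assms ks by (intro assign_isu_map_of) auto
  qed simp
  finally show "vtyp (isubst ?f P) \<Delta> (assign \<rho> (map Vr ys) ks) S = vtyp P \<Delta> (assign \<rho> (map Vr xs) ks) S" .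
qed (use assms in auto)

text \<open>Each clause of \<open>vtyp\<close> uses its subprocesses only through
  \<open>vtyp\<close>. With an equation between functions, reflexivity, symmetry, transitivity and
  congruence are therefore rewriting, and only the four renaming axioms need an argument.\<close>

lemma vtyp_aeq: "aeq P Q \<Longrightarrow> vtyp P = vtyp Q"
proof (induction rule: aeq.induct)
  case (alpha_Res d P c s)
  have "binds [Ch d] Ts (\<lambda>\<Delta> \<rho>. vtyp (chren c d P) \<Delta> \<rho> S) \<Delta> \<rho> = binds [Ch c] Ts (\<lambda>\<Delta> \<rho>. vtyp P \<Delta> \<rho> S) \<Delta> \<rho>"
    for Ts S \<Delta> \<rho>
  proof (rule binds_cong_idents)
    fix \<Delta> and ks :: "ident list" assume "length ks = length [Ch d]"
    then obtain k where k: "ks = [k]" by (auto simp: length_Suc_conv)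
    have "vtyp (chren c d P) \<Delta> (assign \<rho> [Ch d] ks) S = vtyp P \<Delta> (\<lambda>v. assign \<rho> [Ch d] ks (chr c d v)) S"
      by (rule vtyp_chren) (use alpha_Res in auto)
    also have "\<dots> = vtyp P \<Delta> (assign \<rho> [Ch c] ks) S"
      by (rule vtyp_cong) (use alpha_Res k in \<open>auto simp: chr_def fids_def\<close>)
    finally show "vtyp (chren c d P) \<Delta> (assign \<rho> [Ch d] ks) S = vtyp P \<Delta> (assign \<rho> [Ch c] ks) S" .
  qed simp
  then show ?case by (simp add: fun_eq_iff)
next
  case (alpha_Inp xs ys P u)
  have "binds (map Vr ys) Ts (\<lambda>\<Delta> \<rho>. vtyp (isubst (map_of (zip xs (map Vr ys))) P) \<Delta> \<rho> S) \<Gamma> \<rho> =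
    binds (map Vr xs) Ts (\<lambda>\<Delta> \<rho>. vtyp P \<Delta> \<rho> S) \<Gamma> \<rho>" for Ts S \<Gamma> \<rho>
    by (rule binds_isubst) (use alpha_Inp in auto)
  then show ?case using alpha_Inp by (simp add: fun_eq_iff)
next
  case (alpha_Alloc y P x)
  have "binds [Vr y] Ts (\<lambda>\<Delta> \<rho>. vtyp (isubst ((\<lambda>_. None)(x := Some (Vr y))) P) \<Delta> \<rho> S) \<Gamma> \<rho> =
    binds [Vr x] Ts (\<lambda>\<Delta> \<rho>. vtyp P \<Delta> \<rho> S) \<Gamma> \<rho>" for Ts S \<Gamma> \<rho>
    using binds_isubst[of "[y]" "[x]" P Ts S \<Gamma> \<rho>] alpha_Alloc by auto
  then show ?case by (simp add: fun_eq_iff)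
next
  case (alpha_Rec Y P X)
  have "vtyp (psub X (PV Y) P) \<Delta> \<rho> (insert Y S) = vtyp P \<Delta> \<rho> (insert X S)" for \<Delta> \<rho> S
  proof -
    have "vtyp (psub X (PV Y) P) \<Delta> \<rho> (insert Y S) = vtyp P \<Delta> \<rho> {Z. (if Z = X then Y else Z) \<in> insert Y S}"
      by (rule vtyp_psub_PV) (use alpha_Rec in auto)
    also have "\<dots> = vtyp P \<Delta> \<rho> (insert X S)"
      by (rule vtyp_cong) (use alpha_Rec in auto)
    finally show ?thesis .
  qed
  then show ?case by (simp add: fun_eq_iff)
qed simp_all

section \<open>Invariance under structural congruence\<close>

text \<open>The type of the inner restriction is chosen after the outer key and may depend on it, so
  the quantifiers cannot simply be exchanged. Opening both binders once, at distinct fresh keys,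
  fixes both types; \<open>binds_fresh\<close> then closes them in the other order.\<close>

lemma vtyp_Res_swap:
  assumes "c \<noteq> d" "vtyp (Res c s (Res d t P)) \<Delta> \<rho> S"
  shows "vtyp (Res d t (Res c s P)) \<Delta> \<rho> S"
proof -
  obtain T where T: "binds [Ch c] (res_tys s T) (\<lambda>\<Delta> \<rho>. vtyp (Res d t P) \<Delta> \<rho> S) \<Delta> \<rho>"
    using assms(2) unfolding vtyp.simps(8)[of c] by blast
  obtain kl where "length kl = 2" "distinct kl" "set kl \<inter> (keys \<Delta> \<union> \<rho> ` fids P) = {}"
    using fresh_idents[of "keys \<Delta> \<union> \<rho> ` fids P" 2] by auto
  then obtain k l where kl: "k \<noteq> l" "{k, l} \<inter> (keys \<Delta> \<union> \<rho> ` fids P) = {}"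
    by (auto simp: length_Suc_conv numeral_2_eq_2)
  define \<Delta>k where "\<Delta>k = mset (zip [k] (res_tys s T))"
  have keysk: "keys \<Delta>k \<subseteq> {k}" unfolding \<Delta>k_def using keys_mset_zip[of "[k]"] by simp
  have "vtyp (Res d t P) (\<Delta> + \<Delta>k) (\<rho>(Ch c := k)) S"
    using T[unfolded binds_def, rule_format, of "[k]"] by (simp add: \<Delta>k_def)
  then obtain T' where "binds [Ch d] (res_tys t T') (\<lambda>\<Delta> \<rho>. vtyp P \<Delta> \<rho> S) (\<Delta> + \<Delta>k) (\<rho>(Ch c := k))"
    unfolding vtyp.simps by blast
  moreover define \<Delta>l where "\<Delta>l = mset (zip [l] (res_tys t T'))"
  ultimately have "vtyp P (\<Delta> + \<Delta>k + \<Delta>l) (\<rho>(Ch c := k, Ch d := l)) S"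
    unfolding binds_def by (elim allE[of _ "[l]"]) simp
  then have P: "vtyp P (\<Delta> + \<Delta>l + mset (zip [k] (res_tys s T))) (assign (\<rho>(Ch d := l)) [Ch c] [k]) S"
    using assms(1) by (simp add: \<Delta>k_def ac_simps fun_upd_twist)
  have keysl: "keys \<Delta>l \<subseteq> {l}" unfolding \<Delta>l_def using keys_mset_zip[of "[l]"] by simp
  have "binds [Ch c] (res_tys s T) (\<lambda>\<Delta> \<rho>. vtyp P \<Delta> \<rho> S) (\<Delta> + \<Delta>l) (\<rho>(Ch d := l))"
    using P by (rule binds_fresh) (use kl keysl in \<open>auto simp: image_Un\<close>)
  then have "vtyp (Res c s P) (\<Delta> + mset (zip [l] (res_tys t T'))) (assign \<rho> [Ch d] [l]) S"
    unfolding \<Delta>l_def by auto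
  then have "binds [Ch d] (res_tys t T') (\<lambda>\<Delta> \<rho>. vtyp (Res c s P) \<Delta> \<rho> S) \<Delta> \<rho>"
    by (rule binds_fresh) (use kl in auto)
  then show ?thesis unfolding vtyp.simps(8)[of d] by blast
qed

lemma vtyp_Res_extrude:
  assumes c: "c \<notin> fnch Q"
  shows "vtyp (Par (Res c s P) Q) \<Delta> \<rho> S = vtyp (Res c s (Par P Q)) \<Delta> \<rho> S"
proof
  have Q: "vtyp Q \<Gamma> (assign \<rho> [Ch c] ks) S = vtyp Q \<Gamma> \<rho> S" for \<Gamma> ks
    by (rule vtyp_cong) (use c in \<open>auto simp: fids_def intro!: assign_notin\<close>)
  {
    assume "vtyp (Par (Res c s P) Q) \<Delta> \<rho> S"
    then obtain \<Gamma>1 \<Gamma>2 T where *: "\<Delta> \<leadsto> \<Gamma>1 + \<Gamma>2" "vtyp Q \<Gamma>2 \<rho> S"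
      "binds [Ch c] (res_tys s T) (\<lambda>\<Delta> \<rho>. vtyp P \<Delta> \<rho> S) \<Gamma>1 \<rho>"
      by auto
    have "binds [Ch c] (res_tys s T) (\<lambda>\<Delta> \<rho>. vtyp (Par P Q) \<Delta> \<rho> S) \<Delta> \<rho>"
      unfolding binds_def
    proof (intro allI impI)
      fix ks :: "ident list" assume "length ks = length [Ch c]"
      then have "vtyp P (\<Gamma>1 + mset (zip ks (res_tys s T))) (assign \<rho> [Ch c] ks) S"
        using *(3) unfolding binds_def by blast
      moreover have "\<Delta> + mset (zip ks (res_tys s T)) \<leadsto> \<Gamma>1 + mset (zip ks (res_tys s T)) + \<Gamma>2"
        using reaches_add_right[OF *(1), of "mset (zip ks (res_tys s T))"] by (simp add: ac_simps)
      ultimately show "vtyp (Par P Q) (\<Delta> + mset (zip ks (res_tys s T))) (assign \<rho> [Ch c] ks) S"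
        using *(2) Q unfolding vtyp.simps by blast
    qed
    then show "vtyp (Res c s (Par P Q)) \<Delta> \<rho> S" by auto
  next
    assume "vtyp (Res c s (Par P Q)) \<Delta> \<rho> S"
    then obtain T where T: "binds [Ch c] (res_tys s T) (\<lambda>\<Delta> \<rho>. vtyp (Par P Q) \<Delta> \<rho> S) \<Delta> \<rho>"
      unfolding vtyp.simps(8) by blast
    obtain ks where "length ks = 1" "distinct ks" "set ks \<inter> (keys \<Delta> \<union> \<rho> ` (fids P \<union> fids Q)) = {}"
      using fresh_idents[of "keys \<Delta> \<union> \<rho> ` (fids P \<union> fids Q)" 1] by auto
    then obtain k where k: "k \<notin> keys \<Delta>" "k \<notin> \<rho> ` fids P" "k \<notin> \<rho> ` fids Q"
      by (auto simp: length_Suc_conv image_Un)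
    let ?\<Delta>k = "mset (zip [k] (res_tys s T))"
    have keysk: "keys ?\<Delta>k \<subseteq> {k}" using keys_mset_zip[of "[k]"] by simp
    have "vtyp (Par P Q) (\<Delta> + ?\<Delta>k) (assign \<rho> [Ch c] [k]) S"
      using T unfolding binds_def by (elim allE[of _ "[k]"]) simp
    then obtain \<Gamma>1 \<Gamma>2 where *: "\<Delta> + ?\<Delta>k \<leadsto> \<Gamma>1 + \<Gamma>2" "vtyp P \<Gamma>1 (assign \<rho> [Ch c] [k]) S" "vtyp Q \<Gamma>2 \<rho> S"
      unfolding vtyp.simps Q by blast
    have \<Delta>: "restrict_keys (- {k}) \<Delta> = \<Delta>" "restrict_keys {k} \<Delta> = {#}"
      using k(1) by (intro restrict_keys_ident restrict_keys_empty; blast)+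
    have \<Delta>k: "restrict_keys (- {k}) ?\<Delta>k = {#}" "restrict_keys {k} ?\<Delta>k = ?\<Delta>k"
      using keysk by (intro restrict_keys_ident restrict_keys_empty; blast)+
    have "\<Delta> \<leadsto> restrict_keys (- {k}) \<Gamma>1 + restrict_keys (- {k}) \<Gamma>2"
      using reaches_filter_keys[OF *(1), of "- {k}"] by (simp only: filter_union_mset \<Delta> \<Delta>k add_0_right)
    moreover have "vtyp Q (restrict_keys (- {k}) \<Gamma>2) \<rho> S"
      using *(3) by (rule vtyp_strengthen) (use k in auto)
    moreover have "vtyp (Res c s P) (restrict_keys (- {k}) \<Gamma>1) \<rho> S"
    proof -
      have "?\<Delta>k \<leadsto> restrict_keys {k} \<Gamma>1 + restrict_keys {k} \<Gamma>2"
        using reaches_filter_keys[OF *(1), of "{k}"] by (simp only: filter_union_mset \<Delta> \<Delta>k add_0_left)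
      then have "?\<Delta>k \<leadsto> restrict_keys {k} \<Gamma>1"
        by (rule rtranclp_trans) (rule reaches_weaken_right)
      then have "restrict_keys (- {k}) \<Gamma>1 + ?\<Delta>k \<leadsto> restrict_keys (- {k}) \<Gamma>1 + restrict_keys {k} \<Gamma>1"
        by (intro reaches_add) auto
      then have "vtyp P (restrict_keys (- {k}) \<Gamma>1 + ?\<Delta>k) (assign \<rho> [Ch c] [k]) S"
        using *(2) vtyp_reaches restrict_keys_split[of \<Gamma>1 k] by metis
      then have "binds [Ch c] (res_tys s T) (\<lambda>\<Delta> \<rho>. vtyp P \<Delta> \<rho> S) (restrict_keys (- {k}) \<Gamma>1) \<rho>"
        by (rule binds_fresh) (use k in auto)
      then show ?thesis by auto
    qed
    ultimately show "vtyp (Par (Res c s P) Q) \<Delta> \<rho> S" unfolding vtyp.simps(7) by blast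
  }
qed

lemma vtyp_sc: "P \<equiv>\<^sub>s Q \<Longrightarrow> vtyp P = vtyp Q"
proof (induction rule: sc.induct)
  case (sc_alpha P Q)
  then show ?case by (rule vtyp_aeq)
next
  case (sc_Par_Nil P)
  have "(\<exists>\<Gamma>1 \<Gamma>2. \<Delta> \<leadsto> \<Gamma>1 + \<Gamma>2 \<and> vtyp P \<Gamma>1 \<rho> S) = vtyp P \<Delta> \<rho> S" for \<Delta> \<rho> S
  proof
    assume "\<exists>\<Gamma>1 \<Gamma>2. \<Delta> \<leadsto> \<Gamma>1 + \<Gamma>2 \<and> vtyp P \<Gamma>1 \<rho> S"
    then show "vtyp P \<Delta> \<rho> S" using vtyp_weaken vtyp_reaches by blast
  next
    assume "vtyp P \<Delta> \<rho> S"
    moreover have "\<Delta> \<leadsto> \<Delta> + {#}" by simp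
    ultimately show "\<exists>\<Gamma>1 \<Gamma>2. \<Delta> \<leadsto> \<Gamma>1 + \<Gamma>2 \<and> vtyp P \<Gamma>1 \<rho> S" by blast
  qed
  then show ?case by (simp add: fun_eq_iff)
next
  case (sc_Par_comm P Q)
  have "vtyp (Par P Q) \<Delta> \<rho> S \<Longrightarrow> vtyp (Par Q P) \<Delta> \<rho> S" for P Q \<Delta> \<rho> S
    unfolding vtyp.simps by (metis add.commute)
  then show ?case by blast
next
  case (sc_Par_assoc P Q R)
  show ?case
  proof (intro ext iffI)
    fix \<Delta> \<rho> S assume "vtyp (Par (Par P Q) R) \<Delta> \<rho> S"
    then obtain \<Gamma> \<Gamma>1 \<Gamma>2 \<Gamma>3 where *: "\<Delta> \<leadsto> \<Gamma> + \<Gamma>3" "\<Gamma> \<leadsto> \<Gamma>1 + \<Gamma>2" "vtyp P \<Gamma>1 \<rho> S" "vtyp Q \<Gamma>2 \<rho> S" "vtyp R \<Gamma>3 \<rho> S"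
      by auto
    have "\<Delta> \<leadsto> \<Gamma>1 + (\<Gamma>2 + \<Gamma>3)"
      using rtranclp_trans[OF *(1) reaches_add_right[OF *(2)]] by (simp add: ac_simps)
    then show "vtyp (Par P (Par Q R)) \<Delta> \<rho> S" using * unfolding vtyp.simps by blast
  next
    fix \<Delta> \<rho> S assume "vtyp (Par P (Par Q R)) \<Delta> \<rho> S"
    then obtain \<Gamma> \<Gamma>1 \<Gamma>2 \<Gamma>3 where *: "\<Delta> \<leadsto> \<Gamma>1 + \<Gamma>" "\<Gamma> \<leadsto> \<Gamma>2 + \<Gamma>3" "vtyp P \<Gamma>1 \<rho> S" "vtyp Q \<Gamma>2 \<rho> S" "vtyp R \<Gamma>3 \<rho> S"
      by auto
    have "\<Delta> \<leadsto> (\<Gamma>1 + \<Gamma>2) + \<Gamma>3"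
      using rtranclp_trans[OF *(1) reaches_add[OF _ *(2), of \<Gamma>1 \<Gamma>1]] by (simp add: ac_simps)
    then show "vtyp (Par (Par P Q) R) \<Delta> \<rho> S" using * unfolding vtyp.simps by blast
  qed
next
  case (sc_Res_Nil c s)
  then show ?case by (simp add: binds_def)
next
  case (sc_Res_swap c d s t P)
  then show ?case using vtyp_Res_swap by (intro ext iffI) metis+
next
  case (sc_Res_extr c Q s P)
  then show ?case using vtyp_Res_extrude by blast
qed simp_all

section \<open>Coherent environments\<close>

text \<open>The attributes that can be derived from a single assumption by structural rules: a unique
  assumption after \<open>i\<close> steps coexists only with affine ones, and with at most \<open>i\<close> of them.\<close>

definition compatible :: "attr multiset \<Rightarrow> bool" where
  "compatible A \<longleftrightarrow> (\<forall>i. Uniq i \<in># A \<longrightarrow> (\<forall>b\<in>#A - {#Uniq i#}. b = Affine) \<and> size A \<le> Suc i)"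

definition consistent :: "ty multiset \<Rightarrow> bool" where
  "consistent M \<longleftrightarrow> (\<forall>T\<in>#M. T = Proc) \<or> (\<exists>Ts A. M = image_mset (ChT Ts) A \<and> compatible A)"

definition types_at :: "ident \<Rightarrow> idenv \<Rightarrow> ty multiset" where
  "types_at u \<Delta> = image_mset snd (restrict_keys {u} \<Delta>)"

definition coherent :: "idenv \<Rightarrow> bool" where
  "coherent \<Delta> \<longleftrightarrow> (\<forall>u. consistent (types_at u \<Delta>))"

lemma types_at_simps [simp]:
  "types_at u {#} = {#}"
  "types_at u (add_mset x \<Delta>) = (if fst x = u then add_mset (snd x) (types_at u \<Delta>) else types_at u \<Delta>)"
  "types_at u (\<Delta> + \<Gamma>) = types_at u \<Delta> + types_at u \<Gamma>"
  by (auto simp: types_at_def)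

lemma types_at_Pair: "types_at v (image_mset (Pair u) M) = (if u = v then M else {#})"
  by (induction M) auto

lemma image_types_at: "image_mset (Pair u) (types_at u \<Delta>) = restrict_keys {u} \<Delta>"
  by (induction \<Delta>) (auto simp: types_at_def)

lemma compatible_add_Uniq:
  "compatible (add_mset (Uniq i) B) \<longleftrightarrow> (\<forall>b\<in>#B. b = Affine) \<and> size B \<le> i"
  unfolding compatible_def by (auto simp: add_mset_remove_trivial_If)

lemma compatible_add_Unr: "compatible (add_mset Unr B) \<longleftrightarrow> (\<forall>i. Uniq i \<notin># B)"
  unfolding compatible_def by (auto simp: add_mset_remove_trivial_If)

lemma compatible_subset:
  assumes "compatible A" "B \<subseteq># A"
  shows "compatible B"
  unfolding compatible_def
proof (intro allI impI)
  fix i assume "Uniq i \<in># B"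
  then have "Uniq i \<in># A" using assms(2) by (meson mset_subset_eqD)
  moreover have "B - {#Uniq i#} \<subseteq># A - {#Uniq i#}" 
    using assms(2) by (auto simp: subseteq_mset_def intro: diff_le_mono)
  ultimately show "(\<forall>b\<in>#B - {#Uniq i#}. b = Affine) \<and> size B \<le> Suc i"
    using assms size_mset_mono[OF assms(2)] unfolding compatible_def
    by (meson le_trans mset_subset_eqD)
qed

lemma consistent_add_ChT:
  "consistent (add_mset (ChT Ts a) M) \<longleftrightarrow> (\<exists>A. M = image_mset (ChT Ts) A \<and> compatible (add_mset a A))"
proof
  assume "consistent (add_mset (ChT Ts a) M)"
  then obtain Ts' A' where *: "add_mset (ChT Ts a) M = image_mset (ChT Ts') A'" "compatible A'"
    unfolding consistent_def by auto
  then obtain b A where A: "A' = add_mset b A" "ChT Ts a = ChT Ts' b" "M = image_mset (ChT Ts') A"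
    by (metis msed_map_invR)
  with * show "\<exists>A. M = image_mset (ChT Ts) A \<and> compatible (add_mset a A)" by auto
next
  assume "\<exists>A. M = image_mset (ChT Ts) A \<and> compatible (add_mset a A)"
  then obtain A where "M = image_mset (ChT Ts) A" "compatible (add_mset a A)" by blast
  then have "add_mset (ChT Ts a) M = image_mset (ChT Ts) (add_mset a A) \<and> compatible (add_mset a A)" by simp
  then show "consistent (add_mset (ChT Ts a) M)" unfolding consistent_def by blast
qed

lemma consistent_add_Proc: "consistent (add_mset Proc M) \<longleftrightarrow> (\<forall>T\<in>#M. T = Proc)"
proof -
  have "add_mset Proc M \<noteq> image_mset (ChT Ts) A" for Ts A
  proof
    assume "add_mset Proc M = image_mset (ChT Ts) A"
    then have "Proc \<in># image_mset (ChT Ts) A" by (metis union_single_eq_member)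
    then show False by auto
  qed
  then show ?thesis unfolding consistent_def by auto
qed

lemma consistent_subset: "consistent M \<Longrightarrow> N \<subseteq># M \<Longrightarrow> consistent N"
proof -
  assume M: "consistent M" and N: "N \<subseteq># M"
  show ?thesis
  proof (cases "\<forall>T\<in>#M. T = Proc")
    case True
    then show ?thesis using N unfolding consistent_def by (meson mset_subset_eqD)
  next
    case False
    then obtain Ts A where A: "M = image_mset (ChT Ts) A" "compatible A"
      using M unfolding consistent_def by blast
    with N obtain K where "N + K = image_mset (ChT Ts) A" by (metis subset_mset.add_diff_inverse)
    then obtain B C where "A = B + C" "N = image_mset (ChT Ts) B"
      by (metis image_mset_eq_plusD)
    with A show ?thesis unfolding consistent_def
      by (metis compatible_subset mset_subset_eq_add_left)
  qed
qed

lemma consistent_singleton: "consistent {#T#}"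
  by (cases T) (auto simp: consistent_add_ChT consistent_add_Proc compatible_def)

text \<open>Splitting \<open>Uniq i\<close> adds one affine assumption and raises the admissible
  size by one. Subtyping only relaxes the requirement on the attribute. The payload changes only at
  \<open>Uniq 0\<close>, where compatibility leaves no other assumption that could disagree with the
  new one.\<close>

lemma consistent_splits_to:
  assumes "splits_to T M" "consistent (N + {#T#})"
  shows "consistent (N + M)"
  using assms
proof cases
  case 1
  then show ?thesis using assms(2) by (auto intro: consistent_subset)
next
  case (2 T1 T2)
  from 2(2) show ?thesis
  proof cases
    case (1 Ts)
    then obtain A where A: "N = image_mset (ChT Ts) A" "\<forall>i. Uniq i \<notin># A"
      using assms(2) by (auto simp: consistent_add_ChT compatible_add_Unr)
    then have "compatible (add_mset Unr (add_mset Unr A))" by (auto simp: compatible_add_Unr)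
    moreover have "N + M = add_mset (ChT Ts Unr) (image_mset (ChT Ts) (add_mset Unr A))"
      using 1 2 A by simp
    ultimately show ?thesis using consistent_add_ChT by metis
  next
    case 2
    then show ?thesis using assms(2) \<open>M = {#T1, T2#}\<close> by (auto simp: consistent_add_Proc)
  next
    case (3 Ts i)
    then obtain A where A: "N = image_mset (ChT Ts) A" "\<forall>b\<in>#A. b = Affine" "size A \<le> i"
      using assms(2) by (auto simp: consistent_add_ChT compatible_add_Uniq)
    then have "compatible (add_mset (Uniq (Suc i)) (add_mset Affine A))"
      by (auto simp: compatible_add_Uniq)
    moreover have "N + M = add_mset (ChT Ts (Uniq (Suc i))) (image_mset (ChT Ts) (add_mset Affine A))"
      using 3 2 A by simp
    ultimately show ?thesis using consistent_add_ChT by metis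
  qed
next
  case (3 T2)
  from 3(2) obtain Ts a1 a2 where T: "T = ChT Ts a1" "T2 = ChT Ts a2" "sub_attr a1 a2" by cases auto
  with assms(2) obtain A where A: "N = image_mset (ChT Ts) A" "compatible (add_mset a1 A)"
    by (auto simp: consistent_add_ChT)
  from T(3) A(2) have "compatible (add_mset a2 A)"
  proof cases
    case (1 i)
    with A(2) show ?thesis by (auto simp: compatible_add_Uniq)
  next
    case (2 i)
    with A(2) show ?thesis by (auto simp: compatible_add_Uniq compatible_add_Unr)
  next
    case 3
    with A(2) show ?thesis by (auto simp: compatible_add_Unr) (auto simp: compatible_def)
  qed
  then show ?thesis using A T 3 by (auto simp: consistent_add_ChT)
next
  case (4 Ts1 Ts2)
  then have "N = {#}" using assms(2) by (auto simp: consistent_add_ChT compatible_add_Uniq)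
  then show ?thesis using 4 by (simp add: consistent_singleton)
qed

lemma coherent_replace:
  assumes "coherent (\<Gamma> + image_mset (Pair u) M)"
    and "consistent (types_at u \<Gamma> + M) \<Longrightarrow> consistent (types_at u \<Gamma> + M')"
  shows "coherent (\<Gamma> + image_mset (Pair u) M')"
  unfolding coherent_def
proof
  fix v
  have "consistent (types_at v (\<Gamma> + image_mset (Pair u) M))"
    using assms(1) unfolding coherent_def by blast
  then show "consistent (types_at v (\<Gamma> + image_mset (Pair u) M'))"
    using assms(2) by (auto simp: types_at_Pair split: if_splits)
qed

lemma coherent_reaches: "\<Delta> \<leadsto> \<Gamma> \<Longrightarrow> coherent \<Delta> \<Longrightarrow> coherent \<Gamma>"
proof (induction rule: rtranclp_induct)
  case (step y z)
  from step(2) show ?case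
  proof cases
    case (env_stepI T M \<Gamma> u)
    then show ?thesis
      using coherent_replace[of \<Gamma> u "{#T#}" M] consistent_splits_to step by simp
  qed
qed

text \<open>One communication consumes a send and a receive permission on the channel; at most one of the
  two is unique, so the decremented pair is again derivable from one assumption.\<close>

lemma consistent_decrement:
  assumes "consistent (M + {#ChT Ts a, ChT Ts' a'#})" "decrement Ts a = Some D" "decrement Ts' a' = Some D'"
  shows "Ts' = Ts" "consistent (M + (D + D'))"
proof -
  obtain A where A: "add_mset (ChT Ts' a') M = image_mset (ChT Ts) A" "compatible (add_mset a A)"
    using assms(1) by (auto simp: consistent_add_ChT)
  then obtain b B where B: "A = add_mset b B" "ChT Ts' a' = ChT Ts b" "M = image_mset (ChT Ts) B"
    by (metis msed_map_invR)
  then show Ts: "Ts' = Ts" by simp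
  have *: "compatible (add_mset a (add_mset a' B))" using A B by simp
  have "\<exists>A'. D + D' = image_mset (ChT Ts) A' \<and> compatible (B + A')"
  proof (cases a)
    case Affine
    note a = this
    show ?thesis
    proof (cases a')
      case Affine
      have "compatible B" using * by (rule compatible_subset) (simp add: subset_mset.le_add_same_cancel2)
      then show ?thesis using a Affine assms by auto
    next
      case Unr
      have "compatible (B + {#Unr#})" using * by (rule compatible_subset) (simp add: Unr)
      then show ?thesis using a Unr assms Ts by (intro exI[of _ "{#Unr#}"]) auto
    next
      case (Uniq j)
      then obtain i where i: "j = Suc i" using assms by (cases j) auto
      have "compatible (B + {#Uniq i#})"
        using * a Uniq i by (auto simp: compatible_add_Uniq add_mset_commute[of Affine])
      then show ?thesis using a Uniq i assms Ts by (intro exI[of _ "{#Uniq i#}"]) auto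
    qed
  next
    case Unr
    note a = this
    show ?thesis
    proof (cases a')
      case Affine
      have "compatible (B + {#Unr#})" using * by (rule compatible_subset) (simp add: Unr)
      then show ?thesis using a Affine assms by (intro exI[of _ "{#Unr#}"]) auto
    next
      case Unr
      then show ?thesis using * a assms Ts by (intro exI[of _ "{#Unr, Unr#}"]) auto
    next
      case (Uniq j)
      then show ?thesis using * a by (auto simp: compatible_add_Unr)
    qed
  next
    case (Uniq j)
    note a = this
    then obtain i where i: "j = Suc i" using assms by (cases j) auto
    have "a' = Affine" "compatible (B + {#Uniq i#})"
      using * a i by (auto simp: compatible_add_Uniq)
    then show ?thesis using a i assms by (intro exI[of _ "{#Uniq i#}"]) auto
  qed
  then obtain A' where "M + (D + D') = image_mset (ChT Ts) (B + A')" "compatible (B + A')"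
    using B by auto
  then show "consistent (M + (D + D'))" unfolding consistent_def by blast
qed

section \<open>Deriving a consistent multiset from a single assumption\<close>

lemma reaches_single: "splits_to T M \<Longrightarrow> {#(u, T)#} \<leadsto> image_mset (Pair u) M"
  using env_stepI[of T M "{#}" u] by auto

lemma reaches_copies:
  assumes "unr_ty T" "\<forall>T'\<in>#M. {#(u, T)#} \<leadsto> {#(u, T')#}"
  shows "{#(u, T)#} \<leadsto> image_mset (Pair u) M"
  using assms(2)
proof (induction M)
  case empty
  then show ?case using reaches_weaken_left[of "{#(u, T)#}" "{#}"] by simp
next
  case (add T' M)
  have "{#(u, T)#} \<leadsto> {#(u, T)#} + {#(u, T)#}" using assms(1) by (intro reaches_contract) auto
  also have "{#(u, T)#} + {#(u, T)#} \<leadsto> {#(u, T')#} + image_mset (Pair u) M"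
    using add by (intro reaches_add) auto
  finally show ?case by simp
qed

lemma reaches_Uniq_sub: "{#(u, ChT Ts (Uniq j))#} \<leadsto> {#(u, ChT Ts (Uniq (j + m)))#}"
proof (induction m)
  case (Suc m)
  have "{#(u, ChT Ts (Uniq (j + m)))#} \<leadsto> {#(u, ChT Ts (Uniq (Suc (j + m))))#}"
    using reaches_single[OF splits_to.intros(3)[OF sub_ty.intros[OF sub_attr.intros(1)]]] by simp
  with Suc show ?case by (metis add_Suc_right rtranclp_trans)
qed simp

lemma reaches_Uniq_split:
  "{#(u, ChT Ts (Uniq j))#} \<leadsto> add_mset (u, ChT Ts (Uniq (j + n))) (replicate_mset n (u, ChT Ts Affine))"
proof (induction n arbitrary: j)
  case (Suc n)
  have "{#(u, ChT Ts (Uniq j))#} \<leadsto> {#(u, ChT Ts Affine)#} + {#(u, ChT Ts (Uniq (Suc j)))#}"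
    using reaches_single[OF splits_to.intros(2)[OF tsplit.intros(3)[of Ts j]], of u] by (simp add: add_mset_commute)
  also have "\<dots> \<leadsto> {#(u, ChT Ts Affine)#} + add_mset (u, ChT Ts (Uniq (Suc j + n))) (replicate_mset n (u, ChT Ts Affine))"
    by (intro reaches_add Suc) simp
  finally show ?case by (simp add: add_mset_commute)
qed simp

text \<open>If \<open>Uniq i\<close> occurs beside \<open>n\<close> affine attributes, the source is
  \<open>Uniq 0\<close>: \<open>n\<close> splits produce the affine ones and \<open>Uniq n\<close>,
  and \<open>i - n\<close> subtyping steps raise it to \<open>Uniq i\<close>. This is where the size
  bound in \<open>compatible\<close> is used. Without a unique attribute, \<open>Unr\<close> is
  copied and its copies lowered to \<open>Affine\<close> where needed; \<open>Proc\<close> serves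
  for the remaining multisets, the empty one included.\<close>

lemma consistent_from_single:
  assumes "consistent M"
  shows "\<exists>T. {#(u, T)#} \<leadsto> image_mset (Pair u) M"
proof (cases "\<forall>T\<in>#M. T = Proc")
  case True
  then have "{#(u, Proc)#} \<leadsto> image_mset (Pair u) M" by (intro reaches_copies) auto
  then show ?thesis by blast
next
  case False
  then obtain Ts A where A: "M = image_mset (ChT Ts) A" "compatible A"
    using assms unfolding consistent_def by blast
  show ?thesis
  proof (cases "\<exists>i. Uniq i \<in># A")
    case True
    then obtain i B where B: "A = add_mset (Uniq i) B" by (meson multi_member_split)
    with A have Aff: "\<forall>b\<in>#B. b = Affine" and i: "size B \<le> i" by (auto simp: compatible_add_Uniq)
    let ?n = "size B"
    have "B = replicate_mset ?n Affine" using Aff by (metis set_mset_subset_singletonD singleton_iff subsetI)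
    then have M: "image_mset (Pair u) M =
        replicate_mset ?n (u, ChT Ts Affine) + {#(u, ChT Ts (Uniq (?n + (i - ?n))))#}"
      using A B i by (metis add_mset_add_single image_mset_add_mset image_replicate_mset le_add_diff_inverse)
    have "{#(u, ChT Ts (Uniq 0))#} \<leadsto> replicate_mset ?n (u, ChT Ts Affine) + {#(u, ChT Ts (Uniq ?n))#}"
      using reaches_Uniq_split[of u Ts 0 ?n] by simp
    also have "\<dots> \<leadsto> image_mset (Pair u) M"
      unfolding M by (intro reaches_add reaches_Uniq_sub) simp
    finally show ?thesis by blast
  next
    case False
    have "{#(u, ChT Ts Unr)#} \<leadsto> {#(u, T)#}" if T: "T \<in># M" for T
    proof -
      obtain a where a: "T = ChT Ts a" "a \<in># A" using T A by auto
      then have "a = Unr \<or> a = Affine" using False by (cases a) auto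
      then show ?thesis
        using a(1) reaches_single[OF splits_to.intros(3)[OF sub_ty.intros[OF sub_attr.intros(3)]], of u Ts] by auto
    qed
    then show ?thesis using reaches_copies[of "ChT Ts Unr" M u] by auto
  qed
qed

lemma coherent_collapse:
  assumes "coherent \<Delta>"
  shows "\<exists>\<Gamma>. \<Gamma> \<leadsto> \<Delta> \<and> keys \<Gamma> \<subseteq> keys \<Delta> \<and> (\<forall>u. size (restrict_keys {u} \<Gamma>) \<le> 1)"
proof -
  have "finite (keys \<Delta>)" by simp
  then show ?thesis using assms
  proof (induction "keys \<Delta>" arbitrary: \<Delta> rule: finite_psubset_induct)
    case (psubset \<Delta>)
    show ?case
    proof (cases "\<Delta> = {#}")
      case False
      then obtain u where u: "u \<in> keys \<Delta>" by fastforce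
      let ?\<Delta> = "restrict_keys (- {u}) \<Delta>"
      have "coherent ?\<Delta>" using psubset.prems coherent_reaches reaches_filter_subset by blast
      moreover have "keys ?\<Delta> \<subset> keys \<Delta>" using u by auto
      ultimately obtain \<Gamma> where \<Gamma>: "\<Gamma> \<leadsto> ?\<Delta>" "keys \<Gamma> \<subseteq> keys ?\<Delta>" "\<forall>u. size (restrict_keys {u} \<Gamma>) \<le> 1"
        using psubset.hyps(2)[of ?\<Delta>] by blast
      obtain T where "{#(u, T)#} \<leadsto> restrict_keys {u} \<Delta>"
        using consistent_from_single[of "types_at u \<Delta>" u] psubset.prems
        by (auto simp: image_types_at coherent_def)
      then have "\<Gamma> + {#(u, T)#} \<leadsto> \<Delta>"
        using reaches_add[OF \<Gamma>(1)] restrict_keys_split[of \<Delta> u] by metis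
      moreover have "keys (\<Gamma> + {#(u, T)#}) \<subseteq> keys \<Delta>" using \<Gamma>(2) u by auto
      moreover have "size (restrict_keys {v} (\<Gamma> + {#(u, T)#})) \<le> 1" for v
      proof (cases "v = u")
        case True
        have "restrict_keys {u} \<Gamma> = {#}" using \<Gamma>(2) by (intro restrict_keys_empty) auto
        with True show ?thesis by simp
      next
        case False
        then show ?thesis using \<Gamma>(3) by simp
      qed
      ultimately show ?thesis by blast
    qed (use rtranclp.rtrancl_refl in fastforce)
  qed
qed

section \<open>Subject reduction\<close>

definition allocated :: "chstates \<Rightarrow> idenv \<Rightarrow> bool" where
  "allocated \<sigma> \<Delta> \<longleftrightarrow> (\<forall>c. Ch c \<in> keys \<Delta> \<longrightarrow> \<sigma> c = Some Top)"

lemma allocated_mono: "allocated \<sigma> \<Delta> \<Longrightarrow> keys \<Gamma> \<subseteq> keys \<Delta> \<Longrightarrow> allocated \<sigma> \<Gamma>"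
  unfolding allocated_def by blast

lemma allocated_upd: "allocated \<sigma> \<Delta> \<Longrightarrow> Ch c \<notin> keys \<Delta> \<Longrightarrow> allocated (\<sigma>(c := s)) \<Delta>"
  unfolding allocated_def by auto

text \<open>The frame \<open>E\<close> stands for the permissions owned by the context of the redex.\<close>

definition preserves_typing :: "chstates \<Rightarrow> proc \<Rightarrow> chstates \<Rightarrow> proc \<Rightarrow> bool" where
  "preserves_typing \<sigma> P \<sigma>' P' \<longleftrightarrow> (\<forall>\<Delta> E S. vtyp P \<Delta> id S \<longrightarrow> coherent (\<Delta> + E) \<longrightarrow> allocated \<sigma> (\<Delta> + E) \<longrightarrow>
     (\<exists>\<Delta>'. vtyp P' \<Delta>' id S \<and> coherent (\<Delta>' + E) \<and> allocated \<sigma>' (\<Delta>' + E)))"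

section \<open>Preservation for the reduction axioms\<close>

text \<open>Covers unfolding, conditionals and allocation, where the old environment also types the
  result. Communication and deallocation are the axioms that need a new environment.\<close>

lemma preserves_typing_same_env:
  "(\<And>\<Delta> S. vtyp P \<Delta> id S \<Longrightarrow> vtyp P' \<Delta> id S) \<Longrightarrow> preserves_typing \<sigma> P \<sigma> P'"
  unfolding preserves_typing_def by blast

lemma preserves_typing_comm:
  assumes "length bs = length xs" "set bs \<inter> bnch P = {}"
  shows "preserves_typing \<sigma> (Par (Out (Ch c) (map Ch bs) Q) (Inp (Ch c) xs P))
    \<sigma> (Par Q (isubst (map_of (zip xs (map Ch bs))) P))"
  unfolding preserves_typing_def
proof (intro allI impI)
  fix \<Delta> E S
  assume P: "vtyp (Par (Out (Ch c) (map Ch bs) Q) (Inp (Ch c) xs P)) \<Delta> id S"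
    and coh: "coherent (\<Delta> + E)" and alloc: "allocated \<sigma> (\<Delta> + E)"
  let ?f = "map_of (zip xs (map Ch bs))"
  from P obtain \<Gamma>1 \<Gamma>2 where \<Gamma>: "\<Delta> \<leadsto> \<Gamma>1 + \<Gamma>2"
    and out: "vtyp (Out (Ch c) (map Ch bs) Q) \<Gamma>1 id S" and inp: "vtyp (Inp (Ch c) xs P) \<Gamma>2 id S"
    unfolding vtyp.simps(7) by blast
  from out obtain G1 Ts a D where o: "\<Gamma>1 \<leadsto> G1 + {#(Ch c, ChT Ts a)#} + mset (zip (map Ch bs) Ts)"
    "decrement Ts a = Some D" "vtyp Q (G1 + image_mset (Pair (Ch c)) D) id S"
    by auto
  from inp obtain G2 Ts' a' D' where i: "\<Gamma>2 \<leadsto> G2 + {#(Ch c, ChT Ts' a')#}"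
    "length xs = length Ts'" "decrement Ts' a' = Some D'"
    "binds (map Vr xs) Ts' (\<lambda>\<Delta> \<rho>. vtyp P \<Delta> \<rho> S) (G2 + image_mset (Pair (Ch c)) D') id"
    by auto
  \<comment> \<open>Everything except the two permissions consumed on \<open>c\<close>. It contains
    the assumptions on the transmitted channels, among which \<open>c\<close> itself may occur;
    consistency at \<open>c\<close> then takes those into account too.\<close>
  define Z where "Z = G1 + mset (zip (map Ch bs) Ts) + G2 + E"
  have "\<Delta> \<leadsto> (G1 + {#(Ch c, ChT Ts a)#} + mset (zip (map Ch bs) Ts)) + (G2 + {#(Ch c, ChT Ts' a')#})"
    using rtranclp_trans[OF \<Gamma> reaches_add[OF o(1) i(1)]] .
  from reaches_add_right[OF this, of E]
  have Z: "\<Delta> + E \<leadsto> Z + image_mset (Pair (Ch c)) {#ChT Ts a, ChT Ts' a'#}"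
    by (simp add: Z_def ac_simps)
  then have cohZ: "coherent (Z + image_mset (Pair (Ch c)) {#ChT Ts a, ChT Ts' a'#})"
    using coh coherent_reaches by blast
  then have "consistent (types_at (Ch c) Z + {#ChT Ts a, ChT Ts' a'#})"
    unfolding coherent_def by (elim allE[of _ "Ch c"]) (simp add: types_at_Pair)
  from consistent_decrement[OF this o(2) i(3)]
  have Ts: "Ts' = Ts" and "consistent (types_at (Ch c) Z + (D + D'))" by auto
  then have "coherent (Z + image_mset (Pair (Ch c)) (D + D'))"
    by (intro coherent_replace[OF cohZ])
  moreover define \<Delta>1 where "\<Delta>1 = G1 + image_mset (Pair (Ch c)) D"
  \<comment> \<open>The sender gives up the assumptions on the transmitted channels and the receiver
    takes them over; they fit its parameters because \<open>Ts' = Ts\<close>.\<close>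
  moreover define \<Delta>2 where "\<Delta>2 = G2 + image_mset (Pair (Ch c)) D' + mset (zip (map Ch bs) Ts)"
  ultimately have "coherent ((\<Delta>1 + \<Delta>2) + E)" by (simp add: Z_def ac_simps)
  moreover have "allocated \<sigma> ((\<Delta>1 + \<Delta>2) + E)"
  proof -
    have "keys ((\<Delta>1 + \<Delta>2) + E) \<subseteq> keys (Z + image_mset (Pair (Ch c)) {#ChT Ts a, ChT Ts' a'#})"
      by (auto simp: \<Delta>1_def \<Delta>2_def Z_def)
    from allocated_mono[OF alloc subset_trans[OF this reaches_keys[OF Z]]] show ?thesis .
  qed
  moreover have "vtyp (Par Q (isubst ?f P)) (\<Delta>1 + \<Delta>2) id S"
  proof -
    have "ran ?f \<inter> bids P = {}"
      using ran_map_of_zip[of xs "map Ch bs"] assms(2) by (auto simp: bids_def)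
    then have "vtyp (isubst ?f P) \<Delta>2 id S = vtyp P \<Delta>2 (\<lambda>v. id (isu ?f v)) S"
      by (rule vtyp_isubst)
    also have "(\<lambda>v. id (isu ?f v)) = assign id (map Vr xs) (map Ch bs)"
      using assms(1) by (simp add: isu_map_of fun_eq_iff)
    also have "vtyp P \<Delta>2 (assign id (map Vr xs) (map Ch bs)) S"
      using i(4) assms(1) Ts unfolding binds_def \<Delta>2_def by simp
    finally have "vtyp (isubst ?f P) \<Delta>2 id S" .
    moreover have "vtyp Q \<Delta>1 id S" using o(3) by (simp add: \<Delta>1_def)
    ultimately show ?thesis unfolding vtyp.simps by blast
  qed
  ultimately show "\<exists>\<Delta>'. vtyp (Par Q (isubst ?f P)) \<Delta>' id S \<and> coherent (\<Delta>' + E) \<and> allocated \<sigma> (\<Delta>' + E)"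
    by blast
qed

lemma preserves_typing_rec:
  assumes "bnch P \<inter> fnch (Rec X P) = {}" "bv P \<inter> fv (Rec X P) = {}" "bpv P \<inter> fpv (Rec X P) = {}"
  shows "preserves_typing \<sigma> (Rec X P) \<sigma> (psub X (Rec X P) P)"
proof (rule preserves_typing_same_env)
  fix \<Delta> S assume "vtyp (Rec X P) \<Delta> id S"
  then obtain \<Gamma> where \<Gamma>: "\<Delta> \<leadsto> \<Gamma>" "unr_env \<Gamma>" "vtyp P \<Gamma> id (insert X S)" by auto
  then have "vtyp (Rec X P) \<Gamma> id S" by auto
  \<comment> \<open>One copy of \<open>\<Gamma>\<close> types the body and the other the recursion
    substituted into it; contraction supplies both.\<close>
  then have "vtyp (psub X (Rec X P) P) (\<Gamma> + \<Gamma>) id S"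
    using \<Gamma> assms by (intro vtyp_psub) (auto simp: bids_def fids_def simp del: vtyp.simps)
  then show "vtyp (psub X (Rec X P) P) \<Delta> id S"
    using rtranclp_trans[OF \<Gamma>(1) reaches_contract[OF \<Gamma>(2)]] vtyp_reaches by blast
qed

text \<open>Seen through valuations, the binder of the variable \<open>x\<close> and the binder of
  the channel \<open>c\<close> introduce the same key with the same unique type. The new channel
  stays restricted, so neither the environment nor the channel state changes.\<close>

lemma preserves_typing_alloc:
  assumes "c \<notin> fnch P" "c \<notin> bnch P"
  shows "preserves_typing \<sigma> (Alloc x P) \<sigma> (Res c Top (isubst ((\<lambda>_. None)(x := Some (Ch c))) P))"
proof (rule preserves_typing_same_env)
  fix \<Delta> S
  let ?f = "(\<lambda>_. None)(x := Some (Ch c))"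
  assume "vtyp (Alloc x P) \<Delta> id S"
  then obtain Ts where Ts: "binds [Vr x] [ChT Ts (Uniq 0)] (\<lambda>\<Delta> \<rho>. vtyp P \<Delta> \<rho> S) \<Delta> id" by auto
  have "binds [Ch c] [ChT Ts (Uniq 0)] (\<lambda>\<Delta> \<rho>. vtyp (isubst ?f P) \<Delta> \<rho> S) \<Delta> id =
      binds [Vr x] [ChT Ts (Uniq 0)] (\<lambda>\<Delta> \<rho>. vtyp P \<Delta> \<rho> S) \<Delta> id"
  proof (rule binds_cong_idents)
    fix \<Delta> and ks :: "ident list" assume "length ks = length [Ch c]"
    then obtain k where k: "ks = [k]" by (auto simp: length_Suc_conv)
    have "vtyp (isubst ?f P) \<Delta> (assign id [Ch c] ks) S = vtyp P \<Delta> (\<lambda>v. assign id [Ch c] ks (isu ?f v)) S"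
      by (rule vtyp_isubst) (use assms(2) in \<open>auto simp: bids_def ran_def\<close>)
    also have "\<dots> = vtyp P \<Delta> (assign id [Vr x] ks) S"
    proof (rule vtyp_cong)
      fix v assume "v \<in> fids P"
      then show "assign id [Ch c] ks (isu ?f v) = assign id [Vr x] ks v"
        using assms(1) k by (cases v) (auto simp: fids_def)
    qed simp
    finally show "vtyp (isubst ?f P) \<Delta> (assign id [Ch c] ks) S = vtyp P \<Delta> (assign id [Vr x] ks) S" .
  qed simp
  with Ts have "binds [Ch c] (res_tys Top (ChT Ts (Uniq 0))) (\<lambda>\<Delta> \<rho>. vtyp (isubst ?f P) \<Delta> \<rho> S) \<Delta> id"
    by (simp add: res_tys_def)
  then show "vtyp (Res c Top (isubst ?f P)) \<Delta> id S" unfolding vtyp.simps by blast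
qed

lemma types_at_eq_empty: "types_at u \<Delta> = {#} \<longleftrightarrow> u \<notin> keys \<Delta>"
  by (induction \<Delta>) auto

lemma preserves_typing_free: "preserves_typing \<sigma> (Free (Ch c) P) (\<sigma>(c \<mapsto> Bot)) P"
  unfolding preserves_typing_def
proof (intro allI impI)
  fix \<Delta> E S
  assume "vtyp (Free (Ch c) P) \<Delta> id S" and coh: "coherent (\<Delta> + E)" and alloc: "allocated \<sigma> (\<Delta> + E)"
  then obtain \<Gamma> Ts where \<Gamma>: "\<Delta> \<leadsto> \<Gamma> + {#(Ch c, ChT Ts (Uniq 0))#}" "vtyp P \<Gamma> id S" by auto
  then have reach: "\<Delta> + E \<leadsto> (\<Gamma> + E) + {#(Ch c, ChT Ts (Uniq 0))#}"
    using reaches_add_right[OF \<Gamma>(1), of E] by (simp add: ac_simps)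
  then have coh': "coherent ((\<Gamma> + E) + {#(Ch c, ChT Ts (Uniq 0))#})"
    using coh coherent_reaches by blast
  then have "consistent (add_mset (ChT Ts (Uniq 0)) (types_at (Ch c) (\<Gamma> + E)))"
    unfolding coherent_def by (elim allE[of _ "Ch c"]) simp
  then have "types_at (Ch c) (\<Gamma> + E) = {#}"
    by (auto simp: consistent_add_ChT compatible_add_Uniq simp del: types_at_simps)
  then have "Ch c \<notin> keys (\<Gamma> + E)" unfolding types_at_eq_empty .
  moreover have "allocated \<sigma> (\<Gamma> + E)"
    by (rule allocated_mono[OF alloc]) (use reaches_keys[OF reach] in simp)
  ultimately have "allocated (\<sigma>(c \<mapsto> Bot)) (\<Gamma> + E)" by (intro allocated_upd)
  moreover have "coherent (\<Gamma> + E)"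
    using coherent_reaches[OF reaches_weaken_right coh'] .
  ultimately show "\<exists>\<Delta>'. vtyp P \<Delta>' id S \<and> coherent (\<Delta>' + E) \<and> allocated (\<sigma>(c \<mapsto> Bot)) (\<Delta>' + E)"
    using \<Gamma>(2) by blast
qed

section \<open>Preservation under contexts and structural congruence\<close>

text \<open>The share \<open>\<Gamma>2\<close> of the idle component joins the frame during the step
  and is recovered from it afterwards.\<close>

lemma preserves_typing_Par_left:
  assumes "preserves_typing \<sigma> P \<sigma>' P'"
  shows "preserves_typing \<sigma> (Par P Q) \<sigma>' (Par P' Q)"
  unfolding preserves_typing_def
proof (intro allI impI)
  fix \<Delta> E S
  assume "vtyp (Par P Q) \<Delta> id S" and coh: "coherent (\<Delta> + E)" and alloc: "allocated \<sigma> (\<Delta> + E)"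
  then obtain \<Gamma>1 \<Gamma>2 where \<Gamma>: "\<Delta> \<leadsto> \<Gamma>1 + \<Gamma>2" "vtyp P \<Gamma>1 id S" "vtyp Q \<Gamma>2 id S" by auto
  have reach: "\<Delta> + E \<leadsto> \<Gamma>1 + (\<Gamma>2 + E)"
    using reaches_add_right[OF \<Gamma>(1), of E] by (simp add: ac_simps)
  have "coherent (\<Gamma>1 + (\<Gamma>2 + E))" using coherent_reaches[OF reach coh] .
  moreover have "allocated \<sigma> (\<Gamma>1 + (\<Gamma>2 + E))" using allocated_mono[OF alloc reaches_keys[OF reach]] .
  ultimately obtain \<Delta>' where \<Delta>': "vtyp P' \<Delta>' id S" "coherent (\<Delta>' + (\<Gamma>2 + E))" "allocated \<sigma>' (\<Delta>' + (\<Gamma>2 + E))"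
    using assms \<Gamma>(2) unfolding preserves_typing_def by blast
  moreover have "vtyp (Par P' Q) (\<Delta>' + \<Gamma>2) id S" using \<Delta>'(1) \<Gamma>(3) unfolding vtyp.simps by blast
  ultimately show "\<exists>\<Delta>'. vtyp (Par P' Q) \<Delta>' id S \<and> coherent (\<Delta>' + E) \<and> allocated \<sigma>' (\<Delta>' + E)"
    by (metis add.assoc)
qed

lemma preserves_typing_sc:
  assumes "P \<equiv>\<^sub>s P1" "preserves_typing \<sigma> P1 \<sigma>' Q1" "Q1 \<equiv>\<^sub>s Q"
  shows "preserves_typing \<sigma> P \<sigma>' Q"
  using assms(2) unfolding preserves_typing_def vtyp_sc[OF assms(1)] vtyp_sc[OF assms(3)] .

lemma preserves_typing_Par_right:
  "preserves_typing \<sigma> P \<sigma>' P' \<Longrightarrow> preserves_typing \<sigma> (Par Q P) \<sigma>' (Par Q P')"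
  using preserves_typing_sc[OF sc_Par_comm preserves_typing_Par_left sc_Par_comm] .

text \<open>The binder is opened at the key \<open>Ch c\<close> itself, the step is applied to the
  body, and the binder is closed again over whatever assumptions on \<open>c\<close> remain. The
  type of the restriction, and its state, may differ before and after the step.\<close>

lemma preserves_typing_Res:
  assumes pres: "preserves_typing \<sigma> P \<sigma>' P'" and c: "\<sigma> c = Some s" "\<sigma>' c = Some s'"
  shows "preserves_typing (\<sigma>(c := None)) (Res c s P) (\<sigma>'(c := None)) (Res c s' P')"
  unfolding preserves_typing_def
proof (intro allI impI)
  fix \<Delta> E S
  assume "vtyp (Res c s P) \<Delta> id S" and coh: "coherent (\<Delta> + E)"
    and alloc: "allocated (\<sigma>(c := None)) (\<Delta> + E)"
  then obtain T where T: "binds [Ch c] (res_tys s T) (\<lambda>\<Delta> \<rho>. vtyp P \<Delta> \<rho> S) \<Delta> id" by auto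
  let ?C = "mset (zip [Ch c] (res_tys s T))"
  \<comment> \<open>The outer state is undefined at \<open>c\<close>, so \<open>allocated\<close>
    rules out assumptions on it and the channel is a fresh key for its own binder.\<close>
  have cE: "Ch c \<notin> keys (\<Delta> + E)" using alloc unfolding allocated_def by fastforce
  have "vtyp P (\<Delta> + ?C) id S"
    using T unfolding binds_def by (elim allE[of _ "[Ch c]"]) (simp add: fun_upd_idem)
  moreover have "coherent ((\<Delta> + ?C) + E)"
  proof -
    have "types_at (Ch c) (\<Delta> + E) = {#}" using cE unfolding types_at_eq_empty .
    moreover have "?C = image_mset (Pair (Ch c)) (mset (res_tys s T))" by (simp add: res_tys_def)
    moreover have "consistent (mset (res_tys s T))"
      using consistent_singleton consistent_subset[OF consistent_singleton, of "{#}"] by (simp add: res_tys_def)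
    ultimately have "coherent ((\<Delta> + E) + ?C)"
      using coherent_replace[of "\<Delta> + E" "Ch c" "{#}"] coh by simp
    then show ?thesis by (simp add: ac_simps)
  qed
  moreover have "allocated \<sigma> ((\<Delta> + ?C) + E)"
  proof -
    have "\<sigma> d = Some Top" if "Ch d \<in> keys (\<Delta> + E)" for d
    proof -
      have "(\<sigma>(c := None)) d = Some Top" using alloc that unfolding allocated_def by blast
      then show ?thesis by (cases "d = c") auto
    qed
    then show ?thesis using c(1) by (cases s) (auto simp: allocated_def res_tys_def)
  qed
  ultimately obtain \<Delta>' where \<Delta>': "vtyp P' \<Delta>' id S" "coherent (\<Delta>' + E)" "allocated \<sigma>' (\<Delta>' + E)"
    using pres unfolding preserves_typing_def by blast
  let ?\<Gamma> = "restrict_keys (- {Ch c}) \<Delta>'"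
  have sub: "\<Delta>' + E \<leadsto> ?\<Gamma> + E" using reaches_add_right[OF reaches_filter_subset] .
  \<comment> \<open>The new body may hold several assumptions on \<open>c\<close>, but a restriction
    supplies only one: coherence gives a common source. If \<open>c\<close> is deallocated,
    \<open>allocated\<close> shows that no assumption on it is left.\<close>
  have "\<exists>T'. mset (zip [Ch c] (res_tys s' T')) \<leadsto> restrict_keys {Ch c} \<Delta>'"
  proof (cases s')
    case Top
    have "coherent \<Delta>'" using coherent_reaches[OF reaches_weaken_right \<Delta>'(2)] .
    then obtain T' where "{#(Ch c, T')#} \<leadsto> restrict_keys {Ch c} \<Delta>'"
      using consistent_from_single[of "types_at (Ch c) \<Delta>'" "Ch c"]
      by (auto simp: coherent_def image_types_at)
    then show ?thesis using Top by (auto simp: res_tys_def)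
  next
    case Bot
    then have "Ch c \<notin> keys \<Delta>'" using \<Delta>'(3) c(2) unfolding allocated_def by fastforce
    then have no_c: "restrict_keys {Ch c} \<Delta>' = {#}"
      by (intro restrict_keys_empty) (simp only: Int_insert_right if_False Int_empty_right)
    show ?thesis unfolding no_c using Bot by (simp add: res_tys_def)
  qed
  then obtain T' where T': "mset (zip [Ch c] (res_tys s' T')) \<leadsto> restrict_keys {Ch c} \<Delta>'" by blast
  have "?\<Gamma> + mset (zip [Ch c] (res_tys s' T')) \<leadsto> ?\<Gamma> + restrict_keys {Ch c} \<Delta>'"
    by (intro reaches_add T') simp
  also have "?\<Gamma> + restrict_keys {Ch c} \<Delta>' = \<Delta>'" using restrict_keys_split[of \<Delta>' "Ch c"] by simp
  finally have "vtyp P' (?\<Gamma> + mset (zip [Ch c] (res_tys s' T'))) (assign id [Ch c] [Ch c]) S"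
    using \<Delta>'(1) vtyp_reaches by (simp add: fun_upd_idem)
  then have "binds [Ch c] (res_tys s' T') (\<lambda>\<Delta> \<rho>. vtyp P' \<Delta> \<rho> S) ?\<Gamma> id"
    by (rule binds_fresh) auto
  then have "vtyp (Res c s' P') ?\<Gamma> id S" unfolding vtyp.simps by blast
  moreover have "coherent (?\<Gamma> + E)" using coherent_reaches[OF sub \<Delta>'(2)] .
  moreover have "Ch c \<notin> keys (?\<Gamma> + E)" using cE by auto
  then have "allocated (\<sigma>'(c := None)) (?\<Gamma> + E)"
    using allocated_upd allocated_mono[OF \<Delta>'(3) reaches_keys[OF sub]] by blast
  ultimately show "\<exists>\<Delta>'. vtyp (Res c s' P') \<Delta>' id S \<and> coherent (\<Delta>' + E) \<and> allocated (\<sigma>'(c := None)) (\<Delta>' + E)"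
    by blast
qed

lemma preserves_typing_ctx:
  assumes "preserves_typing \<sigma> P \<sigma>' P'"
  shows "capp C \<sigma> P = Some (\<sigma>1, P1) \<Longrightarrow> capp C \<sigma>' P' = Some (\<sigma>2, P2) \<Longrightarrow> preserves_typing \<sigma>1 P1 \<sigma>2 P2"
proof (induction C arbitrary: \<sigma>1 P1 \<sigma>2 P2)
  case Hole
  then show ?case using assms by simp
next
  case (CParL C Q)
  then show ?case by (auto split: option.splits intro: preserves_typing_Par_left)
next
  case (CParR Q C)
  then show ?case by (auto split: option.splits intro: preserves_typing_Par_right)
next
  case (CRes c C)
  from CRes.prems obtain \<sigma>a Pa s where a: "capp C \<sigma> P = Some (\<sigma>a, Pa)" "\<sigma>a c = Some s"
    "\<sigma>1 = \<sigma>a(c := None)" "P1 = Res c s Pa"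
    by (auto split: option.splits)
  from CRes.prems obtain \<sigma>b Pb t where b: "capp C \<sigma>' P' = Some (\<sigma>b, Pb)" "\<sigma>b c = Some t"
    "\<sigma>2 = \<sigma>b(c := None)" "P2 = Res c t Pb"
    by (auto split: option.splits)
  show ?case unfolding a(3,4) b(3,4)
    by (rule preserves_typing_Res[OF CRes.IH[OF a(1) b(1)] a(2) b(2)])
qed

lemma red_preserves_typing: "red \<sigma> P \<sigma>' P' \<Longrightarrow> preserves_typing \<sigma> P \<sigma>' P'"
proof (induction rule: red.induct)
  case (red_comm \<sigma> c bs Q xs P)
  then show ?case by (intro preserves_typing_comm)
next
  case (red_rec \<sigma> X P)
  then show ?case by (intro preserves_typing_rec)
next
  case (red_if_eq \<sigma> c P Q)
  then show ?case by (auto intro: preserves_typing_same_env)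
next
  case (red_if_neq \<sigma> c d P Q)
  then show ?case by (auto intro: preserves_typing_same_env)
next
  case (red_alloc \<sigma> x P c)
  then show ?case by (intro preserves_typing_alloc) (auto simp: closed_config_def config_def)
next
  case (red_free \<sigma> c P)
  then show ?case by (intro preserves_typing_free)
next
  case (red_ctx \<sigma> P \<sigma>'' P'' C \<sigma>1 P1 \<sigma>2 P2)
  show ?case by (rule preserves_typing_ctx[OF red_ctx.IH red_ctx.hyps(2,3)])
next
  case (red_sc P P1 \<sigma> \<sigma>' Q1 Q)
  show ?case by (rule preserves_typing_sc[OF red_sc.hyps(1) red_sc.IH red_sc.hyps(3)])
qed

section \<open>From the typing rules to valuations and back\<close>

definition ident_env :: "env \<Rightarrow> idenv" where
  "ident_env \<Gamma> = (\<Sum>a\<in>#\<Gamma>. case a of Has u T \<Rightarrow> {#(u, T)#} | IsProc X \<Rightarrow> {#})"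

lemma ident_env_simps [simp]:
  "ident_env {#} = {#}"
  "ident_env (add_mset (Has u T) \<Gamma>) = add_mset (u, T) (ident_env \<Gamma>)"
  "ident_env (add_mset (IsProc X) \<Gamma>) = ident_env \<Gamma>"
  "ident_env (\<Gamma> + \<Gamma>') = ident_env \<Gamma> + ident_env \<Gamma>'"
  by (auto simp: ident_env_def)

lemma keys_ident_env [simp]: "keys (ident_env \<Gamma>) = ids \<Gamma>"
proof (induction \<Gamma>)
  case (add a \<Gamma>)
  then show ?case by (cases a) (auto simp: ids_def)
qed (simp add: ids_def)

lemma unr_ident_env: "\<forall>a\<in>#\<Gamma>. unr a \<Longrightarrow> unr_env (ident_env \<Gamma>)"
proof (induction \<Gamma>)
  case (add a \<Gamma>)
  then show ?case by (cases a) auto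
qed simp

lemma ident_env_Has: "ident_env (mset (map2 (\<lambda>x. Has (h x)) xs Ts)) = mset (zip (map h xs) Ts)"
  by (induction xs Ts rule: list_induct2') auto

lemma pvs_simps [simp]:
  "pvs {#} = {}"
  "pvs (add_mset (Has u T) \<Gamma>) = pvs \<Gamma>"
  "pvs (add_mset (IsProc X) \<Gamma>) = insert X (pvs \<Gamma>)"
  "pvs (\<Gamma> + \<Gamma>') = pvs \<Gamma> \<union> pvs \<Gamma>'"
  by (auto simp: pvs_def)

lemma pvs_Has: "pvs (mset (map2 (\<lambda>x. Has (h x)) xs Ts)) = {}"
  by (induction xs Ts rule: list_induct2') auto

lemma decrement_if_dec:
  "dec u Ts a = Some D \<Longrightarrow> \<exists>M. decrement Ts a = Some M \<and> ident_env D = image_mset (Pair u) M \<and> pvs D = {}"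
  by (cases "(u, Ts, a)" rule: dec.cases) auto

lemma vtyp_mono: "vtyp P \<Delta> \<rho> S \<Longrightarrow> S \<subseteq> S' \<Longrightarrow> vtyp P \<Delta> \<rho> S'"
proof (induction P arbitrary: \<Delta> \<rho> S S')
  case (Out u vs P)
  show ?case using Out.prems(1) Out.IH[OF _ Out.prems(2)] unfolding vtyp.simps by blast
next
  case (Inp u xs P)
  show ?case using Inp.prems(1) Inp.IH[OF _ Inp.prems(2)] unfolding vtyp.simps binds_def by blast
next
  case (Rec X P)
  have "insert X S \<subseteq> insert X S'" using Rec.prems(2) by blast
  then show ?case using Rec.prems(1) Rec.IH unfolding vtyp.simps by blast
next
  case (Par P Q)
  show ?case using Par.prems(1) Par.IH(1)[OF _ Par.prems(2)] Par.IH(2)[OF _ Par.prems(2)]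
    unfolding vtyp.simps by blast
next
  case (Res c s P)
  show ?case using Res.prems(1) Res.IH[OF _ Res.prems(2)] unfolding vtyp.simps binds_def by blast
next
  case (Alloc x P)
  show ?case using Alloc.prems(1) Alloc.IH[OF _ Alloc.prems(2)] unfolding vtyp.simps binds_def by blast
next
  case (Free u P)
  show ?case using Free.prems(1) Free.IH[OF _ Free.prems(2)] unfolding vtyp.simps by blast
qed auto

lemma rename_assign:
  assumes "set vs \<inter> keys \<Gamma> = {}"
  shows "rename (assign \<rho> vs ks) \<Gamma> = rename \<rho> \<Gamma>"
  by (rule rename_cong) (use assms in \<open>auto intro!: assign_notin\<close>)

text \<open>The valuation is arbitrary because the binder cases use the induction hypothesis at all
  its updates. The freshness conditions of \<open>rtyp\<close> ensure that such an update does not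
  affect the rest of the environment.\<close>

lemma vtyp_if_rtyp: "rtyp \<Gamma> P \<Longrightarrow> vtyp P (rename \<rho> (ident_env \<Gamma>)) \<rho> (pvs \<Gamma>)"
proof (induction arbitrary: \<rho> rule: rtyp.induct)
  case (t_in u Ts a D xs \<Gamma> P)
  obtain M where M: "decrement Ts a = Some M" "ident_env D = image_mset (Pair u) M" "pvs D = {}"
    using decrement_if_dec[OF t_in(1)] by blast
  have "binds (map Vr xs) Ts (\<lambda>\<Delta> \<rho>. vtyp P \<Delta> \<rho> (pvs \<Gamma>))
      (rename \<rho> (ident_env \<Gamma>) + image_mset (Pair (\<rho> u)) M) \<rho>"
    unfolding binds_def
  proof (intro allI impI)
    fix ks :: "ident list" assume ks: "length ks = length (map Vr xs)"
    have "rename (assign \<rho> (map Vr xs) ks) (ident_env \<Gamma>) = rename \<rho> (ident_env \<Gamma>)"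
      by (rule rename_assign) (use t_in(4) in auto)
    moreover have "assign \<rho> (map Vr xs) ks u = \<rho> u"
      by (rule assign_notin) (use t_in(4) in auto)
    moreover have "map (assign \<rho> (map Vr xs) ks) (map Vr xs) = ks"
      by (rule map_assign) (use t_in(3) ks in \<open>auto simp: distinct_map inj_on_def\<close>)
    ultimately show "vtyp P (rename \<rho> (ident_env \<Gamma>) + image_mset (Pair (\<rho> u)) M + mset (zip ks Ts))
        (assign \<rho> (map Vr xs) ks) (pvs \<Gamma>)"
      using t_in(6)[of "assign \<rho> (map Vr xs) ks"]
      by (simp only: ident_env_simps pvs_simps ident_env_Has pvs_Has M(2,3) Un_empty_right
          rename_simps rename_mset_zip)
  qed
  moreover have "rename \<rho> (ident_env (\<Gamma> + {#Has u (ChT Ts a)#})) \<leadsto> rename \<rho> (ident_env \<Gamma>) + {#(\<rho> u, ChT Ts a)#}"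
    by simp
  ultimately show ?case using t_in(2,3) M(1) by auto
next
  case (t_out u Ts a D vs \<Gamma> P)
  obtain M where M: "decrement Ts a = Some M" "ident_env D = image_mset (Pair u) M" "pvs D = {}"
    using decrement_if_dec[OF t_out(1)] by blast
  have "vtyp P (rename \<rho> (ident_env \<Gamma>) + image_mset (Pair (\<rho> u)) M) \<rho> (pvs \<Gamma>)"
    using t_out(4)[of \<rho>] M by simp
  moreover have "ident_env (mset (map2 Has vs Ts)) = mset (zip vs Ts)" "pvs (mset (map2 Has vs Ts)) = {}"
    using ident_env_Has[of id vs Ts] pvs_Has[of id vs Ts] by simp_all
  moreover have "rename \<rho> (ident_env \<Gamma>) + {#(\<rho> u, ChT Ts a)#} + mset (zip (map \<rho> vs) Ts) \<leadsto>
      rename \<rho> (ident_env \<Gamma>) + {#(\<rho> u, ChT Ts a)#} + mset (zip (map \<rho> vs) Ts)" by simp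
  ultimately show ?case using t_out(2) M(1) by auto
next
  case (t_par \<Gamma>1 P \<Gamma>2 Q)
  have "vtyp P (rename \<rho> (ident_env \<Gamma>1)) \<rho> (pvs (\<Gamma>1 + \<Gamma>2))" "vtyp Q (rename \<rho> (ident_env \<Gamma>2)) \<rho> (pvs (\<Gamma>1 + \<Gamma>2))"
    using t_par.IH by (auto intro: vtyp_mono)
  moreover have "rename \<rho> (ident_env (\<Gamma>1 + \<Gamma>2)) \<leadsto> rename \<rho> (ident_env \<Gamma>1) + rename \<rho> (ident_env \<Gamma>2)"
    by simp
  ultimately show ?case unfolding vtyp.simps by blast
next
  case (t_if u \<Gamma> v P Q)
  then show ?case by simp
next
  case (t_rec \<Gamma> X P)
  have "unr_env (rename \<rho> (ident_env \<Gamma>))"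
    using unr_ident_env[OF t_rec(1)] by (auto simp: rename_def)
  moreover have "vtyp P (rename \<rho> (ident_env \<Gamma>)) \<rho> (insert X (pvs \<Gamma>))"
    using t_rec.IH[of \<rho>] by simp
  ultimately show ?case by auto
next
  case (t_alloc x \<Gamma> Ts P)
  have "binds [Vr x] [ChT Ts (Uniq 0)] (\<lambda>\<Delta> \<rho>. vtyp P \<Delta> \<rho> (pvs \<Gamma>)) (rename \<rho> (ident_env \<Gamma>)) \<rho>"
    unfolding binds_def
  proof (intro allI impI)
    fix ks :: "ident list" assume "length ks = length [Vr x]"
    then obtain k where k: "ks = [k]" by (auto simp: length_Suc_conv)
    have "rename (assign \<rho> [Vr x] ks) (ident_env \<Gamma>) = rename \<rho> (ident_env \<Gamma>)"
      by (rule rename_assign) (use t_alloc(1) in simp)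
    moreover have "assign \<rho> [Vr x] ks (Vr x) = k" "mset (zip ks [ChT Ts (Uniq 0)]) = {#(k, ChT Ts (Uniq 0))#}"
      using k by simp_all
    ultimately show "vtyp P (rename \<rho> (ident_env \<Gamma>) + mset (zip ks [ChT Ts (Uniq 0)])) (assign \<rho> [Vr x] ks) (pvs \<Gamma>)"
      using t_alloc.IH[of "assign \<rho> [Vr x] ks"]
      by (simp only: ident_env_simps rename_simps pvs_simps fst_conv snd_conv Un_empty_right)
  qed
  then show ?case by auto
next
  case (t_free \<Gamma> P u Ts)
  have "rename \<rho> (ident_env (\<Gamma> + {#Has u (ChT Ts (Uniq 0))#})) \<leadsto> rename \<rho> (ident_env \<Gamma>) + {#(\<rho> u, ChT Ts (Uniq 0))#}"
    by simp
  moreover have "vtyp P (rename \<rho> (ident_env \<Gamma>)) \<rho> (pvs (\<Gamma> + {#Has u (ChT Ts (Uniq 0))#}))"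
    using t_free.IH by simp
  ultimately show ?case unfolding vtyp.simps by blast
next
  case (t_res_top c \<Gamma> T P)
  have "binds [Ch c] [T] (\<lambda>\<Delta> \<rho>. vtyp P \<Delta> \<rho> (pvs \<Gamma>)) (rename \<rho> (ident_env \<Gamma>)) \<rho>"
    unfolding binds_def
  proof (intro allI impI)
    fix ks :: "ident list" assume "length ks = length [Ch c]"
    then obtain k where k: "ks = [k]" by (auto simp: length_Suc_conv)
    have "rename (assign \<rho> [Ch c] ks) (ident_env \<Gamma>) = rename \<rho> (ident_env \<Gamma>)"
      by (rule rename_assign) (use t_res_top(1) in simp)
    moreover have "assign \<rho> [Ch c] ks (Ch c) = k" "mset (zip ks [T]) = {#(k, T)#}"
      using k by simp_all
    ultimately show "vtyp P (rename \<rho> (ident_env \<Gamma>) + mset (zip ks [T])) (assign \<rho> [Ch c] ks) (pvs \<Gamma>)"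
      using t_res_top.IH[of "assign \<rho> [Ch c] ks"]
      by (simp only: ident_env_simps rename_simps pvs_simps fst_conv snd_conv Un_empty_right)
  qed
  then show ?case by (auto simp: res_tys_def)
next
  case (t_res_bot c \<Gamma> P)
  have "binds [Ch c] [] (\<lambda>\<Delta> \<rho>. vtyp P \<Delta> \<rho> (pvs \<Gamma>)) (rename \<rho> (ident_env \<Gamma>)) \<rho>"
    unfolding binds_def
  proof (intro allI impI)
    fix ks :: "ident list" assume "length ks = length [Ch c]"
    have "rename (assign \<rho> [Ch c] ks) (ident_env \<Gamma>) = rename \<rho> (ident_env \<Gamma>)"
      by (rule rename_assign) (use t_res_bot(1) in simp)
    then show "vtyp P (rename \<rho> (ident_env \<Gamma>) + mset (zip ks [])) (assign \<rho> [Ch c] ks) (pvs \<Gamma>)"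
      using t_res_bot.IH[of "assign \<rho> [Ch c] ks"] by simp
  qed
  then show ?case by (auto simp: res_tys_def)
next
  case (t_split T T1 T2 \<Gamma> u P)
  have "rename \<rho> (ident_env \<Gamma>) + {#(\<rho> u, T)#} \<leadsto> rename \<rho> (ident_env \<Gamma>) + image_mset (Pair (\<rho> u)) {#T1, T2#}"
    using env_stepI[OF splits_to.intros(2)[OF t_split(1)]] by blast
  then show ?case using vtyp_reaches[of P _ \<rho>] t_split.IH[of \<rho>] by simp
next
  case (t_split_pv \<Gamma> X P)
  then show ?case by simp
next
  case (t_weak \<Gamma> P A)
  then show ?case
    using vtyp_weaken[of P "rename \<rho> (ident_env \<Gamma>)" \<rho> "pvs \<Gamma>" "rename \<rho> (ident_env {#A#})"]
    by (cases A) (auto intro: vtyp_mono)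
next
  case (t_sub \<Gamma> u T2 P T1)
  have "rename \<rho> (ident_env \<Gamma>) + {#(\<rho> u, T1)#} \<leadsto> rename \<rho> (ident_env \<Gamma>) + image_mset (Pair (\<rho> u)) {#T2#}"
    using env_stepI[OF splits_to.intros(3)[OF t_sub(2)]] by blast
  then show ?case using vtyp_reaches[of P _ \<rho>] t_sub.IH[of \<rho>] by simp
next
  case (t_bullet0 \<Gamma> u Ts2 P Ts1)
  have "rename \<rho> (ident_env \<Gamma>) + {#(\<rho> u, ChT Ts1 (Uniq 0))#} \<leadsto>
      rename \<rho> (ident_env \<Gamma>) + image_mset (Pair (\<rho> u)) {#ChT Ts2 (Uniq 0)#}"
    using env_stepI[OF splits_to.intros(4)] by blast
  then show ?case using vtyp_reaches[of P _ \<rho>] t_bullet0.IH[of \<rho>] by simp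
qed simp_all

section \<open>From valuations back to the typing rules\<close>

text \<open>Each process variable occurs exactly once. As \<open>mset_set\<close> of an infinite set
  is empty, the lemmas that read variables off \<open>S\<close> assume it finite.\<close>

definition full_env :: "idenv \<Rightarrow> pvar set \<Rightarrow> env" where
  "full_env \<Delta> S = image_mset (\<lambda>x. Has (fst x) (snd x)) \<Delta> + image_mset IsProc (mset_set S)"

lemma full_env_add [simp]:
  "full_env (add_mset x \<Delta>) S = add_mset (Has (fst x) (snd x)) (full_env \<Delta> S)"
  "full_env (\<Delta> + \<Gamma>) S = image_mset (\<lambda>x. Has (fst x) (snd x)) \<Gamma> + full_env \<Delta> S"
  by (auto simp: full_env_def)

lemma ids_full_env: "ids (full_env \<Delta> S) = keys \<Delta>"
  by (force simp: ids_def full_env_def)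

lemma pvs_full_env: "finite S \<Longrightarrow> pvs (full_env \<Delta> S) = S"
  by (auto simp: pvs_def full_env_def)

lemma rtyp_weaken: "rtyp \<Gamma> P \<Longrightarrow> rtyp (\<Gamma> + E) P"
proof (induction E)
  case (add x E)
  then show ?case using t_weak[of "\<Gamma> + E" P x] by simp
qed simp

lemma rtyp_splits_to:
  assumes "splits_to T M" "rtyp (\<Gamma> + image_mset (Has u) M) P"
  shows "rtyp (\<Gamma> + {#Has u T#}) P"
  using assms
proof cases
  case 1
  then show ?thesis using assms(2) t_weak[of \<Gamma> P "Has u T"] by simp
next
  case (2 T1 T2)
  then show ?thesis using assms(2) t_split[of T T1 T2 \<Gamma> u P] by simp
next
  case (3 T2)
  then show ?thesis using assms(2) t_sub[of \<Gamma> u T2 P T] by simp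
next
  case (4 Ts1 Ts2)
  then show ?thesis using assms(2) t_bullet0[of \<Gamma> u Ts2 P Ts1] by simp
qed

lemma rtyp_reaches: "\<Delta> \<leadsto> \<Gamma> \<Longrightarrow> rtyp (full_env \<Gamma> S) P \<Longrightarrow> rtyp (full_env \<Delta> S) P"
proof (induction rule: converse_rtranclp_induct)
  case (step y z)
  from step(1) show ?case
  proof cases
    case (env_stepI T M \<Gamma> u)
    then show ?thesis
      using rtyp_splits_to[of T M "full_env \<Gamma> S" u P] step
      by (simp add: multiset.map_comp comp_def ac_simps)
  qed
qed

text \<open>In a parallel composition \<open>vtyp\<close> offers all of \<open>S\<close> to both
  components, whereas \<open>t_par\<close> adds the two environments, so every process variable
  arrives twice.\<close>

lemma rtyp_contract_pvs:
  assumes "finite S"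
  shows "rtyp (\<Gamma> + image_mset IsProc (mset_set S) + image_mset IsProc (mset_set S)) P \<Longrightarrow>
    rtyp (\<Gamma> + image_mset IsProc (mset_set S)) P"
  using assms
proof (induction S arbitrary: \<Gamma> rule: finite_induct)
  case (insert X S)
  let ?S = "image_mset IsProc (mset_set S)"
  have "rtyp ((\<Gamma> + {#IsProc X, IsProc X#}) + ?S + ?S) P" using insert by (simp add: ac_simps)
  then have "rtyp ((\<Gamma> + {#IsProc X, IsProc X#}) + ?S) P" by (rule insert.IH)
  then show ?case using t_split_pv[of "\<Gamma> + ?S" X P] insert by (simp add: ac_simps)
qed simp

lemma rtyp_subset: "rtyp \<Gamma> P \<Longrightarrow> \<Gamma> \<subseteq># \<Gamma>' \<Longrightarrow> rtyp \<Gamma>' P"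
  using rtyp_weaken[of \<Gamma> P "\<Gamma>' - \<Gamma>"] by simp

text \<open>An input whose subject is among its own bound variables is typed by no rule, whereas its
  alpha-variants may be.\<close>

primrec subjects_free :: "proc \<Rightarrow> bool" where
  "subjects_free (Out u vs P) = subjects_free P"
| "subjects_free (Inp u xs P) = ((distinct xs \<longrightarrow> u \<notin> Vr ` set xs) \<and> subjects_free P)"
| "subjects_free Nil = True"
| "subjects_free (If u v P Q) = (subjects_free P \<and> subjects_free Q)"
| "subjects_free (Rec X P) = subjects_free P"
| "subjects_free (PV X) = True"
| "subjects_free (Par P Q) = (subjects_free P \<and> subjects_free Q)"
| "subjects_free (Res c s P) = subjects_free P"
| "subjects_free (Alloc x P) = subjects_free P"
| "subjects_free (Free u P) = subjects_free P"

lemma assign_id_self: "assign id vs vs = id"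
  by (induction vs) (auto simp: fun_upd_idem)

text \<open>A binder instantiated with its own identifiers. It may shadow identifiers already
  present in \<open>\<Gamma>\<close>; strengthening removes those assumptions first, which yields
  the freshness that the rules of \<open>rtyp\<close> require.\<close>

lemma binds_self:
  assumes "binds vs Ts (\<lambda>\<Delta> \<rho>. vtyp P \<Delta> \<rho> S) \<Gamma> id"
  shows "vtyp P (restrict_keys (- set vs) \<Gamma> + mset (zip vs Ts)) id S"
proof -
  have "binds vs Ts (\<lambda>\<Delta> \<rho>. vtyp P \<Delta> \<rho> S) (restrict_keys (- set vs) \<Gamma>) id"
    using assms by (rule binds_strengthen[rotated]) (auto intro: vtyp_strengthen)
  then show ?thesis unfolding binds_def by (elim allE[of _ vs]) (simp add: assign_id_self)
qed

lemma dec_if_decrement: "decrement Ts a = Some M \<Longrightarrow> dec u Ts a = Some (image_mset (Has u) M)"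
  by (cases "(u, Ts, a)" rule: dec.cases) auto

lemma image_Has_Pair [simp]: "image_mset (\<lambda>x. Has (fst x) (snd x)) (image_mset (Pair u) M) = image_mset (Has u) M"
  by (simp add: multiset.map_comp comp_def)

lemma image_Has_zip [simp]:
  "image_mset (\<lambda>x. Has (fst x) (snd x)) (mset (zip (map h xs) Ts)) = mset (map2 (\<lambda>x. Has (h x)) xs Ts)"
  by (induction xs Ts rule: list_induct2') auto

lemma rtyp_if_vtyp:
  "vtyp P \<Delta> id S \<Longrightarrow> subjects_free P \<Longrightarrow> finite S \<Longrightarrow> rtyp (full_env \<Delta> S) P"
proof (induction P arbitrary: \<Delta> S)
  case (Out u vs P)
  then obtain \<Gamma> Ts a M where *: "\<Delta> \<leadsto> \<Gamma> + {#(u, ChT Ts a)#} + mset (zip vs Ts)"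
    "length vs = length Ts" "decrement Ts a = Some M" "vtyp P (\<Gamma> + image_mset (Pair u) M) id S"
    unfolding vtyp.simps id_apply list.map_ident by blast
  have "rtyp (full_env \<Gamma> S + image_mset (Has u) M) P"
    using Out.IH[OF *(4)] Out.prems by (simp add: ac_simps)
  from t_out[OF dec_if_decrement[OF *(3)] *(2) this]
  have "rtyp (full_env (\<Gamma> + {#(u, ChT Ts a)#} + mset (zip vs Ts)) S) (Out u vs P)"
    using image_Has_zip[of id vs Ts] by (simp add: ac_simps)
  with *(1) show ?case by (rule rtyp_reaches)
next
  case (Inp u xs P)
  then obtain \<Gamma> Ts a M where *: "\<Delta> \<leadsto> \<Gamma> + {#(u, ChT Ts a)#}"
    "length xs = length Ts" "distinct xs" "decrement Ts a = Some M"
    "binds (map Vr xs) Ts (\<lambda>\<Delta> \<rho>. vtyp P \<Delta> \<rho> S) (\<Gamma> + image_mset (Pair u) M) id"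
    unfolding vtyp.simps id_apply by blast
  let ?\<Gamma> = "restrict_keys (- set (map Vr xs)) \<Gamma>"
  \<comment> \<open>Otherwise the restriction to keys outside \<open>xs\<close> could drop the
    decremented assumption on the subject.\<close>
  have u: "u \<notin> Vr ` set xs" using Inp.prems(2) *(3) by simp
  have "restrict_keys (- set (map Vr xs)) (image_mset (Pair u) M) = image_mset (Pair u) M"
    using u by (intro restrict_keys_Pair) auto
  then have "vtyp P (?\<Gamma> + image_mset (Pair u) M + mset (zip (map Vr xs) Ts)) id S"
    using binds_self[OF *(5)] by (simp only: filter_union_mset)
  then have "rtyp (full_env (?\<Gamma> + image_mset (Pair u) M + mset (zip (map Vr xs) Ts)) S) P"
    by (rule Inp.IH) (use Inp.prems in auto)
  then have "rtyp (full_env ?\<Gamma> S + image_mset (Has u) M + mset (map2 (\<lambda>x. Has (Vr x)) xs Ts)) P"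
    by (simp add: full_env_def ac_simps)
  moreover have "\<forall>x\<in>set xs. Vr x \<notin> ids (full_env ?\<Gamma> S) \<and> Vr x \<noteq> u"
    using u unfolding ids_full_env by auto
  ultimately have "rtyp (full_env (?\<Gamma> + {#(u, ChT Ts a)#}) S) (Inp u xs P)"
    using t_in[OF dec_if_decrement[OF *(4)] *(2,3), of "full_env ?\<Gamma> S"] by simp
  moreover have "\<Delta> \<leadsto> ?\<Gamma> + {#(u, ChT Ts a)#}"
    using rtranclp_trans[OF *(1) reaches_add_right[OF reaches_filter_subset]] .
  ultimately show ?case by (rule rtyp_reaches[rotated])
next
  case Nil
  then show ?case using rtyp_subset[OF t_nil] by simp
next
  case (If u v P Q)
  then have "u \<in> ids (full_env \<Delta> S)" "v \<in> ids (full_env \<Delta> S)"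
    unfolding ids_full_env by simp_all
  then show ?case using If by (intro t_if) auto
next
  case (Rec X P)
  then obtain \<Gamma> where \<Gamma>: "\<Delta> \<leadsto> \<Gamma>" "unr_env \<Gamma>" "vtyp P \<Gamma> id (insert X S)" 
    unfolding vtyp.simps by blast
  have "rtyp (full_env \<Gamma> (insert X S)) P" using Rec.IH[OF \<Gamma>(3)] Rec.prems by simp
  \<comment> \<open>\<open>X\<close> may already belong to \<open>S\<close>, while
    \<open>t_rec\<close> asks for a new process variable. The outer \<open>X\<close> is removed here
    and restored by weakening below.\<close>
  moreover have "full_env \<Gamma> (insert X S) = full_env \<Gamma> (S - {X}) + {#IsProc X#}"
    using Rec.prems(3) by (simp add: full_env_def mset_set.insert_remove)
  moreover have "X \<notin> pvs (full_env \<Gamma> (S - {X}))" using Rec.prems(3) by (simp add: pvs_full_env)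
  moreover have "\<forall>a\<in>#full_env \<Gamma> (S - {X}). unr a" using \<Gamma>(2) by (auto simp: full_env_def)
  ultimately have "rtyp (full_env \<Gamma> (S - {X})) (Rec X P)" using t_rec by simp
  moreover have "full_env \<Gamma> (S - {X}) \<subseteq># full_env \<Gamma> S"
    using Rec.prems(3) by (auto simp: full_env_def intro!: image_mset_subseteq_mono subset_imp_msubset_mset_set)
  ultimately have "rtyp (full_env \<Gamma> S) (Rec X P)" by (rule rtyp_subset)
  with \<Gamma>(1) show ?case by (rule rtyp_reaches)
next
  case (PV X)
  then have "IsProc X \<in># full_env \<Delta> S" by (simp add: full_env_def)
  then show ?case using rtyp_subset[OF t_pv] by (simp add: single_subset_iff)
next
  case (Par P Q)
  then obtain \<Gamma>1 \<Gamma>2 where *: "\<Delta> \<leadsto> \<Gamma>1 + \<Gamma>2" "vtyp P \<Gamma>1 id S" "vtyp Q \<Gamma>2 id S" 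
    unfolding vtyp.simps by blast
  have "rtyp (full_env \<Gamma>1 S) P" "rtyp (full_env \<Gamma>2 S) Q"
    using Par.IH(1)[OF *(2)] Par.IH(2)[OF *(3)] Par.prems by simp_all
  then have "rtyp (full_env \<Gamma>1 S + full_env \<Gamma>2 S) (Par P Q)" by (rule t_par)
  then have "rtyp (full_env (\<Gamma>1 + \<Gamma>2) S) (Par P Q)"
    using rtyp_contract_pvs[OF Par.prems(3), of "image_mset (\<lambda>x. Has (fst x) (snd x)) (\<Gamma>1 + \<Gamma>2)"]
    by (simp add: full_env_def ac_simps)
  with *(1) show ?case by (rule rtyp_reaches)
next
  case (Res c s P)
  then obtain T where T: "binds [Ch c] (res_tys s T) (\<lambda>\<Delta> \<rho>. vtyp P \<Delta> \<rho> S) \<Delta> id" 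
    unfolding vtyp.simps by blast
  let ?\<Gamma> = "restrict_keys (- {Ch c}) \<Delta>"
  have "vtyp P (?\<Gamma> + mset (zip [Ch c] (res_tys s T))) id S" using binds_self[OF T] by simp
  then have body: "rtyp (full_env (?\<Gamma> + mset (zip [Ch c] (res_tys s T))) S) P"
    by (rule Res.IH) (use Res.prems in auto)
  have c: "Ch c \<notin> ids (full_env ?\<Gamma> S)" by (auto simp: ids_full_env)
  have "rtyp (full_env ?\<Gamma> S) (Res c s P)"
  proof (cases s)
    case Top
    then show ?thesis using t_res_top[OF c, of T P] body by (simp add: res_tys_def)
  next
    case Bot
    then show ?thesis using t_res_bot[OF c, of P] body by (simp add: res_tys_def)
  qed
  with reaches_filter_subset show ?case by (rule rtyp_reaches)
next
  case (Alloc x P)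
  then obtain Ts where Ts: "binds [Vr x] [ChT Ts (Uniq 0)] (\<lambda>\<Delta> \<rho>. vtyp P \<Delta> \<rho> S) \<Delta> id" 
    unfolding vtyp.simps by blast
  let ?\<Gamma> = "restrict_keys (- {Vr x}) \<Delta>"
  have "vtyp P (?\<Gamma> + {#(Vr x, ChT Ts (Uniq 0))#}) id S" using binds_self[OF Ts] by simp
  then have "rtyp (full_env (?\<Gamma> + {#(Vr x, ChT Ts (Uniq 0))#}) S) P"
    by (rule Alloc.IH) (use Alloc.prems in auto)
  moreover have "Vr x \<notin> ids (full_env ?\<Gamma> S)" by (auto simp: ids_full_env)
  ultimately have "rtyp (full_env ?\<Gamma> S) (Alloc x P)"
    using t_alloc[of x "full_env ?\<Gamma> S" Ts P] by simp
  with reaches_filter_subset show ?case by (rule rtyp_reaches)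
next
  case (Free u P)
  then obtain \<Gamma> Ts where *: "\<Delta> \<leadsto> \<Gamma> + {#(u, ChT Ts (Uniq 0))#}" "vtyp P \<Gamma> id S"
    unfolding vtyp.simps id_apply by blast
  have "rtyp (full_env (\<Gamma> + {#(u, ChT Ts (Uniq 0))#}) S) (Free u P)"
    using t_free[of "full_env \<Gamma> S" P u Ts] Free.IH[OF *(2)] Free.prems by simp
  with *(1) show ?case by (rule rtyp_reaches)
qed

section \<open>Alpha-variants whose inputs do not bind their own subject\<close>

lemma subjects_free_isubst:
  "subjects_free P \<Longrightarrow> ran f \<inter> bids P = {} \<Longrightarrow> subjects_free (isubst f P)"
proof (induction P arbitrary: f)
  case (Inp u xs P)
  have "isu f u \<notin> Vr ` set xs" if "u \<notin> Vr ` set xs"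
    using that Inp.prems(2) by (cases u) (auto simp: ran_def split: option.splits)
  moreover have "ran (\<lambda>y. if y \<in> set xs then None else f y) \<subseteq> ran f" by (auto simp: ran_def)
  ultimately show ?case using Inp by (simp, blast)
next
  case (Alloc x P)
  have "ran (f(x := None)) \<subseteq> ran f" by (auto simp: ran_def)
  then show ?case using Alloc by (simp, blast)
qed (simp_all, blast+)

lemma finite_fv_bv: "finite (fv P \<union> bv P)"
proof -
  have "finite (ivs u)" for u by (cases u) auto
  then show ?thesis by (induction P) auto
qed

text \<open>Inputs that bind their own subject get new parameters. \<open>alpha_Inp\<close> cannot
  rename an input with repeated parameters, hence the exception for these in
  \<open>subjects_free\<close>; \<open>vtyp\<close> rejects them anyway.\<close>

lemma aeq_subjects_free: "\<exists>P0. aeq P P0 \<and> subjects_free P0"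
proof (induction P)
  case (Out u vs P)
  then show ?case using aeq_Out subjects_free.simps(1) by blast
next
  case (Inp u xs P)
  then obtain P0 where P0: "aeq P P0" "subjects_free P0" by blast
  show ?case
  proof (cases "distinct xs \<and> u \<in> Vr ` set xs")
    case True
    obtain m where m: "\<forall>x\<in>fv P0 \<union> bv P0 \<union> set xs. x < m"
      using finite_fv_bv[of P0] finite_nat_set_iff_bounded[of "fv P0 \<union> bv P0 \<union> set xs"] by auto
    define ys where "ys = [m..<m + length xs]"
    have "x \<notin> set ys" if "x < m" for x using that by (simp add: ys_def)
    with m have ys: "set ys \<inter> (fv P0 \<union> bv P0 \<union> set xs) = {}" by blast
    let ?f = "map_of (zip xs (map Vr ys))"
    have "aeq (Inp u xs P) (Inp u ys (isubst ?f P0))"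
      by (rule aeq_trans[OF aeq_Inp[OF P0(1)] alpha_Inp]) (use True ys in \<open>simp_all add: ys_def\<close>)
    moreover have "ran ?f \<inter> bids P0 = {}"
      using ran_map_of_zip[of xs "map Vr ys"] ys by (auto simp: bids_def)
    then have "subjects_free (isubst ?f P0)" by (rule subjects_free_isubst[OF P0(2)])
    moreover have "u \<notin> Vr ` set ys" using True ys by auto
    ultimately show ?thesis by (intro exI[of _ "Inp u ys (isubst ?f P0)"]) simp
  next
    case False
    then show ?thesis using P0 by (intro exI[of _ "Inp u xs P0"]) (auto intro: aeq_Inp)
  qed
next
  case (If u v P Q)
  then obtain P0 Q0 where "aeq P P0" "subjects_free P0" "aeq Q Q0" "subjects_free Q0" by blast
  then show ?case
    by (intro exI[of _ "If u v P0 Q0"]) (auto intro: aeq_trans[OF aeq_If1 aeq_If2])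
next
  case (Par P Q)
  then obtain P0 Q0 where "aeq P P0" "subjects_free P0" "aeq Q Q0" "subjects_free Q0" by blast
  then show ?case
    by (intro exI[of _ "Par P0 Q0"]) (auto intro: aeq_trans[OF aeq_Par1 aeq_Par2])
next
  case (Rec X P)
  then show ?case using aeq_Rec subjects_free.simps(5) by blast
next
  case (Res c s P)
  then show ?case using aeq_Res subjects_free.simps(8) by blast
next
  case (Alloc x P)
  then show ?case using aeq_Alloc subjects_free.simps(9) by blast
next
  case (Free u P)
  then show ?case using aeq_Free subjects_free.simps(10) by blast
qed (rule exI, rule conjI, rule aeq_refl, simp)+

lemma size_types_at_ident_env:
  "size (types_at u (ident_env \<Gamma>)) = size (filter_mset (\<lambda>a. akey a = KId u) \<Gamma>)"
proof (induction \<Gamma>)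
  case (add a \<Gamma>)
  then show ?case by (cases a) auto
qed simp

lemma coherent_ident_env:
  assumes "env_partial_fun \<Gamma>"
  shows "coherent (ident_env \<Gamma>)"
  unfolding coherent_def
proof
  fix u
  have "size (types_at u (ident_env \<Gamma>)) \<le> 1"
    using assms unfolding env_partial_fun_def size_types_at_ident_env by blast
  then have "types_at u (ident_env \<Gamma>) = {#} \<or> (\<exists>T. types_at u (ident_env \<Gamma>) = {#T#})"
    by (metis One_nat_def le_Suc_eq le_zero_eq size_1_singleton_mset size_eq_0_iff_empty)
  moreover have "consistent {#}" by (simp add: consistent_def)
  ultimately show "consistent (types_at u (ident_env \<Gamma>))"
    using consistent_singleton by auto
qed

lemma env_partial_fun_full_env:
  assumes "\<forall>u. size (restrict_keys {u} \<Gamma>) \<le> 1" "finite S"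
  shows "env_partial_fun (full_env \<Gamma> S)"
  unfolding env_partial_fun_def
proof
  fix k
  show "size (filter_mset (\<lambda>a. akey a = k) (full_env \<Gamma> S)) \<le> 1"
  proof (cases k)
    case (KId u)
    then show ?thesis using assms(1)[rule_format, of u]
      by (simp add: full_env_def filter_mset_image_mset)
  next
    case (KPV X)
    have "size (filter_mset (\<lambda>Y. Y = X) (mset_set S)) \<le> 1"
      using assms(2) by (simp add: filter_eq_replicate_mset count_mset_set')
    then show ?thesis using KPV by (simp add: full_env_def filter_mset_image_mset)
  qed
qed

theorem mainTheorem3:
  fixes \<Gamma> :: env and \<sigma> \<sigma>' :: chstates and P P' :: proc
  assumes "config \<sigma> P"
    and "config_typing \<Gamma> \<sigma> P"
    and "red \<sigma> P \<sigma>' P'"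
  shows "\<exists>\<Gamma>'. config_typing \<Gamma>' \<sigma>' P'"
proof -
  obtain P0 where P0: "aeq P P0" "rtyp \<Gamma> P0"
    using assms(2) unfolding config_typing_def typing_def by blast
  have "vtyp P (ident_env \<Gamma>) id (pvs \<Gamma>)"
    using vtyp_if_rtyp[OF P0(2), of id] vtyp_aeq[OF P0(1)] by simp
  moreover have "coherent (ident_env \<Gamma> + {#})" "allocated \<sigma> (ident_env \<Gamma> + {#})"
    using assms(2) coherent_ident_env unfolding config_typing_def allocated_def by auto
  ultimately have "\<exists>\<Delta>. vtyp P' \<Delta> id (pvs \<Gamma>) \<and> coherent (\<Delta> + {#}) \<and> allocated \<sigma>' (\<Delta> + {#})"
    using red_preserves_typing[OF assms(3)] unfolding preserves_typing_def by blast
  then obtain \<Delta> where \<Delta>: "vtyp P' \<Delta> id (pvs \<Gamma>)" "coherent \<Delta>" "allocated \<sigma>' \<Delta>"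
    unfolding add_0_right by blast
  obtain \<Gamma>' where \<Gamma>': "\<Gamma>' \<leadsto> \<Delta>" "keys \<Gamma>' \<subseteq> keys \<Delta>" "\<forall>u. size (restrict_keys {u} \<Gamma>') \<le> 1"
    using coherent_collapse[OF \<Delta>(2)] by blast
  have fin: "finite (pvs \<Gamma>)"
  proof -
    have "IsProc ` pvs \<Gamma> \<subseteq> set_mset \<Gamma>" by (auto simp: pvs_def)
    then show ?thesis by (metis asm.inject(2) finite_imageD finite_set_mset finite_subset inj_onI)
  qed
  \<comment> \<open>The reduct may contain an input that shadows its own subject, for which
    \<open>rtyp\<close> has no rule. \<open>typing\<close> allows an alpha-variant, and
    \<open>vtyp\<close> does not distinguish the two.\<close>
  obtain P1 where P1: "aeq P' P1" "subjects_free P1" using aeq_subjects_free by blast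
  have "vtyp P1 \<Gamma>' id (pvs \<Gamma>)" using vtyp_reaches[OF \<Delta>(1) \<Gamma>'(1)] vtyp_aeq[OF P1(1)] by simp
  then have "rtyp (full_env \<Gamma>' (pvs \<Gamma>)) P1" using P1(2) fin by (rule rtyp_if_vtyp)
  then have "full_env \<Gamma>' (pvs \<Gamma>) \<turnstile>\<^sub>P P'" using P1(1) unfolding typing_def by blast
  moreover have "allocated \<sigma>' \<Gamma>'" using allocated_mono[OF \<Delta>(3) \<Gamma>'(2)] .
  moreover have "env_partial_fun (full_env \<Gamma>' (pvs \<Gamma>))"
    using \<Gamma>'(3) fin by (rule env_partial_fun_full_env)
  ultimately have "config_typing (full_env \<Gamma>' (pvs \<Gamma>)) \<sigma>' P'"
    unfolding config_typing_def allocated_def ids_full_env by blast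
  then show ?thesis by blast
qed

end
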